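(* Let $k$ be a field, let $X\subset\mathbb P^3_k$ be an irreducible (reduced) subvariety of codimension $2$, and let $I_X\subset R=k[x_1,x_2,x_3,x_4]$ be its homogeneous (prime) defining ideal. Assume that there is a point $\mathfrak p\in X$ such that the localization of $I_X$ at $\mathfrak p$ is not a complete intersection. Then for all $m\geq 2$ the saturation of $I_X^m$ has an embedded component at $\mathfrak p$. In particular, $I_X^m\neq I_X^{(m)}$ for all $m\geq 2$.
   Context: Let $\mathfrak m=(x_1,x_2,x_3,x_4)$. A point $\mathfrak p\in X$ is identified with a homogeneous prime ideal $\mathfrak p$ of $R$ with $I_X\subseteq\mathfrak p\subsetneq\mathfrak m$. An ideal is a complete intersection if it is generated by a regular sequence of length equal to its height; the hypothesis says that $I_XR_{\mathfrak p}$ is not a complete intersection ideal of $R_{\mathfrak p}$. The saturation of an ideal $J$ is $\bigcup_j(J:\mathfrak m^j)$. An ideal $J$ has an embedded component at $\mathfrak p$ if $\mathfrak p\in\mathrm{Ass}(R/J)$ and $\mathfrak p$ is not a minimal prime of $J$. The $n$-th symbolic power of an ideal $I$ is $I^{(n)}:=\bigcap_{\mathfrak p\in \mathrm{Ass}(R/I)}(I^nR_{\mathfrak p}\cap R)$. *)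

theory Defs
  imports
    "HOL-Algebra.Ideal_Product"
    "HOL-Algebra.Algebraic_Closure_Type"
    "HOL-Library.Poly_Mapping"
    "HOL-Library.Numeral_Type"
    "HOL-Library.Extended_Nat"
    "HOL-Computational_Algebra.Fraction_Field"
begin

section \<open>Commutative algebra over a ring record\<close>

abbreviation ideal_pow :: "('a, 'b) ring_scheme \<Rightarrow> 'a set \<Rightarrow> nat \<Rightarrow> 'a set"
  where "ideal_pow A I n \<equiv> I [^]\<^bsub>ideals_set A\<^esub> n"

definition ideal_colon :: "('a, 'b) ring_scheme \<Rightarrow> 'a set \<Rightarrow> 'a set \<Rightarrow> 'a set"
  where "ideal_colon A J K = {r \<in> carrier A. \<forall>s\<in>K. r \<otimes>\<^bsub>A\<^esub> s \<in> J}"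

definition height_prime :: "('a, 'b) ring_scheme \<Rightarrow> 'a set \<Rightarrow> enat"
  where "height_prime A P =
    (SUP n \<in> {n. \<exists>Q. (\<forall>i\<le>n. primeideal (Q i) A) \<and> (\<forall>i<n. Q i \<subset> Q (Suc i)) \<and> Q n = P}. enat n)"

definition height :: "('a, 'b) ring_scheme \<Rightarrow> 'a set \<Rightarrow> enat"
  where "height A J = (INF P \<in> {P. primeideal P A \<and> J \<subseteq> P}. height_prime A P)"

text \<open>
  The second conjunct says that each entry is a nonzerodivisor on the quotient by its predecessors,
  the third that the quotient by the whole sequence is nonzero.
\<close>
definition regular_seq :: "('a, 'b) ring_scheme \<Rightarrow> 'a list \<Rightarrow> bool"
  where "regular_seq A xs \<longleftrightarrow>
    set xs \<subseteq> carrier A \<and>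
    (\<forall>i<length xs. \<forall>a\<in>carrier A.
       xs ! i \<otimes>\<^bsub>A\<^esub> a \<in> genideal A (set (take i xs)) \<longrightarrow> a \<in> genideal A (set (take i xs))) \<and>
    genideal A (set xs) \<noteq> carrier A"

definition complete_intersection :: "('a, 'b) ring_scheme \<Rightarrow> 'a set \<Rightarrow> bool"
  where "complete_intersection A J \<longleftrightarrow>
    (\<exists>xs. regular_seq A xs \<and> J = genideal A (set xs) \<and> enat (length xs) = height A J)"

text \<open>
  \<open>Ass(A/J)\<close>: the primes that annihilate an element of \<open>A/J\<close>; the annihilator of the class of
  \<open>f\<close> is \<open>(J : f)\<close>.
\<close>
definition Ass_quot :: "('a, 'b) ring_scheme \<Rightarrow> 'a set \<Rightarrow> 'a set set"
  where "Ass_quot A J = {P. primeideal P A \<and> (\<exists>f\<in>carrier A. P = ideal_colon A J {f})}"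

definition minimal_primes :: "('a, 'b) ring_scheme \<Rightarrow> 'a set \<Rightarrow> 'a set set"
  where "minimal_primes A J =
    {P. primeideal P A \<and> J \<subseteq> P \<and> \<not> (\<exists>Q. primeideal Q A \<and> J \<subseteq> Q \<and> Q \<subset> P)}"

definition embedded_component_at :: "('a, 'b) ring_scheme \<Rightarrow> 'a set \<Rightarrow> 'a set \<Rightarrow> bool"
  where "embedded_component_at A J P \<longleftrightarrow> P \<in> Ass_quot A J \<and> P \<notin> minimal_primes A J"


section \<open>Localization of an integral domain at a prime\<close>

text \<open>
  The base ring is a type of class \<open>idom\<close>, so its localization at a prime \<open>P\<close> is taken as the
  subring of the fraction field of the fractions with denominator outside \<open>P\<close>.
  In \<open>Fract a s\<close> with \<open>s \<notin> P\<close> the denominator is nonzero because \<open>0 \<in> P\<close>.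
\<close>
definition localization :: "'a::idom set \<Rightarrow> 'a fract ring"
  where "localization P = ring_of_type_algebra \<lparr>carrier := {Fract a s |a s. s \<notin> P}\<rparr>"

definition extend_ideal :: "'a::idom set \<Rightarrow> 'a set \<Rightarrow> 'a fract set"
  where "extend_ideal P J = genideal (localization P) ((\<lambda>f. Fract f 1) ` J)"

definition contract_ideal :: "'a::idom fract set \<Rightarrow> 'a set"
  where "contract_ideal K = {f. Fract f 1 \<in> K}"

definition symbolic_power :: "'a::idom set \<Rightarrow> nat \<Rightarrow> 'a set"
  where "symbolic_power I n =
    (\<Inter>P \<in> Ass_quot ring_of_type_algebra I.
       contract_ideal (extend_ideal P (ideal_pow ring_of_type_algebra I n)))"


section \<open>The polynomial ring in four variables and projective three-space\<close>

text \<open>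
  Monomials are exponent vectors indexed by the four-element type \<open>4\<close>; multiplication of
  \<open>poly_mapping\<close>s is convolution, i.e. the product of polynomials.
\<close>
type_synonym 'k poly4 = "(4 \<Rightarrow>\<^sub>0 nat) \<Rightarrow>\<^sub>0 'k"

abbreviation poly4_ring :: "'k::field poly4 ring"
  where "poly4_ring \<equiv> ring_of_type_algebra"

definition poly_var :: "4 \<Rightarrow> 'k::field poly4"
  where "poly_var i = Poly_Mapping.single (Poly_Mapping.single i 1) 1"

definition irrelevant_ideal :: "'k::field poly4 set"
  where "irrelevant_ideal = genideal poly4_ring (range poly_var)"

definition homogeneous_poly :: "nat \<Rightarrow> 'k::field poly4 \<Rightarrow> bool"
  where "homogeneous_poly d f \<longleftrightarrow>
    (\<forall>t\<in>Poly_Mapping.keys f. (\<Sum>i\<in>UNIV. Poly_Mapping.lookup t i) = d)"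

definition homogeneous_ideal :: "'k::field poly4 set \<Rightarrow> bool"
  where "homogeneous_ideal J \<longleftrightarrow>
    (\<exists>S. (\<forall>f\<in>S. \<exists>d. homogeneous_poly d f) \<and> J = genideal poly4_ring S)"

definition saturation :: "'k::field poly4 set \<Rightarrow> 'k poly4 set"
  where "saturation J = (\<Union>j. ideal_colon poly4_ring J (ideal_pow poly4_ring irrelevant_ideal j))"

text \<open>
  Points are scheme points, closed or not. Closed sets are those of the Zariski topology; a
  reduced closed subscheme is identified with its underlying closed set.
\<close>
definition proj3 :: "'k::field poly4 set set"
  where "proj3 = {P. primeideal P poly4_ring \<and> homogeneous_ideal P \<and> P \<subset> irrelevant_ideal}"

definition zero_locus :: "'k::field poly4 set \<Rightarrow> 'k poly4 set set"
  where "zero_locus J = {P \<in> proj3. J \<subseteq> P}"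

definition proj_closed :: "'k::field poly4 set set \<Rightarrow> bool"
  where "proj_closed Z \<longleftrightarrow> (\<exists>J. homogeneous_ideal J \<and> Z = zero_locus J)"

definition irreducible_closed :: "'k::field poly4 set set \<Rightarrow> bool"
  where "irreducible_closed Z \<longleftrightarrow>
    proj_closed Z \<and> Z \<noteq> {} \<and>
    (\<forall>A B. proj_closed A \<and> proj_closed B \<and> Z = A \<union> B \<longrightarrow> Z = A \<or> Z = B)"

definition proj_codim :: "'k::field poly4 set set \<Rightarrow> enat"
  where "proj_codim V =
    (SUP n \<in> {n. \<exists>C. (\<forall>i\<le>n. irreducible_closed (C i)) \<and> (\<forall>i<n. C i \<subset> C (Suc i)) \<and> C 0 = V}. enat n)"

text \<open>The polynomials vanishing at all points of \<open>V\<close>; vanishing at \<open>P\<close> means lying in \<open>P\<close>.\<close>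
definition defining_ideal :: "'k::field poly4 set set \<Rightarrow> 'k poly4 set"
  where "defining_ideal V = \<Inter>V"

end

theory Submission
  imports Defs "Jordan_Normal_Form.Determinant"
begin

text \<open>
  Write \<open>I\<close> for the ideal of \<open>V\<close>. Since \<open>I\<close> has height two and the homogeneous prime \<open>p\<close> has
  dimension at least one, either \<open>p = I\<close>, where \<open>I\<^sub>p\<close> is generated by a regular system of
  parameters, or \<open>A = R\<^sub>p\<close> is regular local of dimension three with maximal ideal
  \<open>M = (y, z, x)\<close>. In the second case \<open>J = I\<^sub>p\<close> is a height-two prime with \<open>N \<ge> 3\<close> minimal
  generators, and \<open>y \<notin> J\<close> for a suitable choice of parameters. By Hilbert-Burch the generators are
  the maximal minors of a matrix with \<open>N - 1\<close> rows and entries in \<open>M\<close>. Add \<open>s\<close> times the matrix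
  with rows \<open>(x, y, z, 0, \<dots>)\<close>, \<open>(0, x, y, 0, \<dots>)\<close> and an identity block. The deformed minors
  still lie in \<open>M\<^sup>2\<close>, as two rows have entries in \<open>M\<close>. If \<open>J\<^sup>m\<close> had no embedded component,
  every polynomial in \<open>s\<close> that lies in the \<open>m\<close>-th power of the deformed ideal generically along
  \<open>J\<close> would have its coefficients in \<open>M\<^sup>2\<^sup>m\<close>. Cramer's rule for the first two rows gives such a
  polynomial: \<open>1/y\<close> times a combination of products of two minors, times a power of a minor, with
  top coefficient \<open>-x\<^sup>2\<^sup>m\<^sup>-\<^sup>1 \<notin> M\<^sup>2\<^sup>m\<close>. So \<open>J\<^sup>m\<close> has an associated prime other than \<open>J\<close>, which
  by dimension can only be \<open>M\<close>. The regular parameters come from minimal polynomials of the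
  variables over a polynomial subring that is a Noether-style base of the prime, which also yields
  the dimension theory that is needed.
\<close>

section \<open>Subrings, ideals and their powers\<close>

text \<open>The entries of the Hilbert-Burch matrix may lie in arbitrarily high powers of
  \<open>M\<close>, so its minors give no control from below on orders along \<open>M\<close>. After
  the deformation the top coefficient in s sees only the added matrix, which is known. Products of m
  deformed minors have all coefficients in the 2m-th power of \<open>M\<close>, while the polynomial
  from Cramer's rule loses one order by the division by \<open>y\<close>. Absence of embedded
  components passes to the deformed ideal because every relation among the minors is a combination
  of matrix rows and therefore lifts. That \<open>y\<close> lies outside \<open>J\<close> is used
  twice: it gives the quotient by \<open>J\<close> positive depth, hence free syzygies, and it is
  the multiplier that carries the polynomial into the power of the deformed ideal. Such a
  \<open>y\<close> exists because the first parameter at p can be taken as a polynomial in two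
  variables that are algebraically independent modulo I. All bases consist of variables; no linear
  change of coordinates occurs, so finite fields are not special.\<close>

locale csubring =
  fixes S :: "'a::comm_ring_1 set"
  assumes zero [simp, intro]: "0 \<in> S"
    and one [simp, intro]: "1 \<in> S"
    and add [intro]: "a \<in> S \<Longrightarrow> b \<in> S \<Longrightarrow> a + b \<in> S"
    and uminus [intro]: "a \<in> S \<Longrightarrow> - a \<in> S"
    and mult [intro]: "a \<in> S \<Longrightarrow> b \<in> S \<Longrightarrow> a * b \<in> S"
begin

lemma diff [intro]: "a \<in> S \<Longrightarrow> b \<in> S \<Longrightarrow> a - b \<in> S"
  using add[of a "- b"] uminus by simp

lemma sum [intro]: "(\<And>i. i \<in> Y \<Longrightarrow> f i \<in> S) \<Longrightarrow> sum f Y \<in> S"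
  by (induction Y rule: infinite_finite_induct) auto

lemma prod [intro]: "(\<And>i. i \<in> Y \<Longrightarrow> f i \<in> S) \<Longrightarrow> prod f Y \<in> S"
  by (induction Y rule: infinite_finite_induct) auto

lemma power [intro]: "a \<in> S \<Longrightarrow> a ^ n \<in> S"
  by (induction n) auto

end

lemma csubring_UNIV [simp]: "csubring UNIV"
  by unfold_locales auto

text \<open>Ideals are taken relative to a subring that is a set. Polynomial subrings, localizations
  inside a fraction field and whole types are then treated alike.\<close>

definition ideal_of :: "'a::comm_ring_1 set \<Rightarrow> 'a set \<Rightarrow> bool"
  where "ideal_of S I \<longleftrightarrow> I \<subseteq> S \<and> 0 \<in> I \<and> (\<forall>a\<in>I. \<forall>b\<in>I. a + b \<in> I) \<and> (\<forall>s\<in>S. \<forall>a\<in>I. s * a \<in> I)"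

definition prime_of :: "'a::comm_ring_1 set \<Rightarrow> 'a set \<Rightarrow> bool"
  where "prime_of S P \<longleftrightarrow> ideal_of S P \<and> 1 \<notin> P \<and> (\<forall>a\<in>S. \<forall>b\<in>S. a * b \<in> P \<longrightarrow> a \<in> P \<or> b \<in> P)"

definition lin_span :: "'a::comm_ring_1 set \<Rightarrow> nat \<Rightarrow> (nat \<Rightarrow> 'a) \<Rightarrow> 'a set"
  where "lin_span S n g = {\<Sum>i<n. c i * g i | c. \<forall>i<n. c i \<in> S}"

definition noetherian_of :: "'a::comm_ring_1 set \<Rightarrow> bool"
  where "noetherian_of S \<longleftrightarrow> (\<forall>I. ideal_of S I \<longrightarrow> (\<exists>n g. (\<forall>i<n. g i \<in> I) \<and> I = lin_span S n g))"

lemma ideal_ofD: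
  assumes "ideal_of S I"
  shows "I \<subseteq> S" "0 \<in> I" "a \<in> I \<Longrightarrow> b \<in> I \<Longrightarrow> a + b \<in> I" "s \<in> S \<Longrightarrow> a \<in> I \<Longrightarrow> s * a \<in> I"
    "s \<in> S \<Longrightarrow> a \<in> I \<Longrightarrow> a * s \<in> I" "a \<in> I \<Longrightarrow> a \<in> S"
  using assms unfolding ideal_of_def by (auto simp: mult.commute)

lemma ideal_of_sum:
  assumes "ideal_of S I" "\<And>i. i \<in> Y \<Longrightarrow> f i \<in> I"
  shows "sum f Y \<in> I"
  using assms(2) by (induction Y rule: infinite_finite_induct) (auto intro: ideal_ofD[OF assms(1)])

lemma prime_ofD:
  assumes "prime_of S P"
  shows "ideal_of S P" "1 \<notin> P" "a \<in> S \<Longrightarrow> b \<in> S \<Longrightarrow> a * b \<in> P \<Longrightarrow> a \<in> P \<or> b \<in> P"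
  using assms unfolding prime_of_def by auto

context csubring
begin

lemma ideal_uminus: "ideal_of S I \<Longrightarrow> a \<in> I \<Longrightarrow> - a \<in> I"
  using ideal_ofD(4)[of S I "- 1" a] uminus[OF one] by simp

lemma ideal_diff: "ideal_of S I \<Longrightarrow> a \<in> I \<Longrightarrow> b \<in> I \<Longrightarrow> a - b \<in> I"
  using ideal_ofD(3)[of S I a "- b"] ideal_uminus by simp

lemma ideal_add_cancel: "ideal_of S I \<Longrightarrow> a + b \<in> I \<Longrightarrow> b \<in> I \<Longrightarrow> a \<in> I"
  using ideal_diff[of I "a + b" b] by simp

lemma prime_power: "prime_of S P \<Longrightarrow> a \<in> S \<Longrightarrow> a ^ n \<in> P \<Longrightarrow> a \<in> P"
  by (induction n) (use prime_ofD power in \<open>force+\<close>)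

lemma prime_prod:
  assumes "prime_of S P" "finite Y" "\<And>i. i \<in> Y \<Longrightarrow> f i \<in> S - P"
  shows "prod f Y \<in> S - P"
  using assms(2,3) by (induction Y) (use prime_ofD[OF assms(1)] in auto)

lemma ideal_S: "ideal_of S S"
  unfolding ideal_of_def by auto

lemma lin_span_ideal:
  assumes "\<And>i. i < n \<Longrightarrow> g i \<in> S"
  shows "ideal_of S (lin_span S n g)"
  unfolding ideal_of_def
proof (intro conjI ballI subsetI)
  show "x \<in> S" if "x \<in> lin_span S n g" for x
    using that assms unfolding lin_span_def by auto
  show "0 \<in> lin_span S n g"
    unfolding lin_span_def by (auto intro!: exI[of _ "\<lambda>_. 0"])
next
  fix a b assume "a \<in> lin_span S n g" "b \<in> lin_span S n g"
  then obtain c d where "\<forall>i<n. c i \<in> S" "\<forall>i<n. d i \<in> S" "a = (\<Sum>i<n. c i * g i)" "b = (\<Sum>i<n. d i * g i)"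
    unfolding lin_span_def by auto
  then show "a + b \<in> lin_span S n g"
    unfolding lin_span_def
    by (auto intro!: exI[of _ "\<lambda>i. c i + d i"] simp: algebra_simps sum.distrib)
next
  fix s a assume "s \<in> S" "a \<in> lin_span S n g"
  then obtain c where "\<forall>i<n. c i \<in> S" "a = (\<Sum>i<n. c i * g i)"
    unfolding lin_span_def by auto
  then show "s * a \<in> lin_span S n g"
    using \<open>s \<in> S\<close> unfolding lin_span_def
    by (auto intro!: exI[of _ "\<lambda>i. s * c i"] simp: algebra_simps sum_distrib_left)
qed

lemma lin_span_gen:
  assumes "i < n"
  shows "g i \<in> lin_span S n g"
  unfolding lin_span_def
  using assms by (auto intro!: exI[of _ "\<lambda>j. if j = i then 1 else 0"] simp: if_distrib[of "\<lambda>x. x * _"] cong: if_cong)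

end

lemma lin_span_least:
  assumes "ideal_of S I" "\<And>i. i < n \<Longrightarrow> g i \<in> I"
  shows "lin_span S n g \<subseteq> I"
  using assms unfolding lin_span_def by (auto intro!: ideal_of_sum[OF assms(1)] intro: ideal_ofD)

lemma lin_spanI: "(\<And>i. i < n \<Longrightarrow> c i \<in> S) \<Longrightarrow> (\<Sum>i<n. c i * g i) \<in> lin_span S n g"
  unfolding lin_span_def by auto

lemma lin_spanE:
  assumes "x \<in> lin_span S n g"
  obtains c where "\<And>i. i < n \<Longrightarrow> c i \<in> S" "x = (\<Sum>i<n. c i * g i)"
  using assms unfolding lin_span_def by auto

text \<open>The two rules mirror those of the library's \<open>ideal_prod\<close>, so that
  \<open>ideal_prod_sub_ring\<close> converts rule by rule, and induction replaces indexed sums of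
  products.\<close>

inductive_set idprod :: "'a::comm_ring_1 set \<Rightarrow> 'a set \<Rightarrow> 'a set" for I J
  where prod: "a \<in> I \<Longrightarrow> b \<in> J \<Longrightarrow> a * b \<in> idprod I J"
  | sum: "x \<in> idprod I J \<Longrightarrow> y \<in> idprod I J \<Longrightarrow> x + y \<in> idprod I J"

primrec ipow :: "'a::comm_ring_1 set \<Rightarrow> 'a set \<Rightarrow> nat \<Rightarrow> 'a set"
  where "ipow S I 0 = S"
  | "ipow S I (Suc n) = idprod (ipow S I n) I"

lemma idprod_least:
  assumes "ideal_of S K" "\<And>a b. a \<in> I \<Longrightarrow> b \<in> J \<Longrightarrow> a * b \<in> K"
  shows "idprod I J \<subseteq> K"
proof
  show "x \<in> K" if "x \<in> idprod I J" for x
    using that by induction (use assms ideal_ofD(3)[OF assms(1)] in auto)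
qed

context csubring
begin

lemma idprod_ideal:
  assumes "ideal_of S I" "ideal_of S J"
  shows "ideal_of S (idprod I J)"
  unfolding ideal_of_def
proof (intro conjI ballI subsetI)
  show "x \<in> S" if "x \<in> idprod I J" for x
    using idprod_least[OF ideal_S, of I J] that assms ideal_ofD(6) by blast
  show "0 \<in> idprod I J"
    using idprod.prod[of 0 I 0 J] ideal_ofD(2)[OF assms(1)] ideal_ofD(2)[OF assms(2)] by simp
  show "s * x \<in> idprod I J" if "s \<in> S" "x \<in> idprod I J" for s x
    using that(2)
    by induction
      (use that(1) assms in \<open>auto intro: idprod.intros ideal_ofD simp: distrib_left mult.assoc[symmetric]\<close>)
qed (auto intro: idprod.intros)

lemma ipow_ideal: "ideal_of S I \<Longrightarrow> ideal_of S (ipow S I n)"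
  by (induction n) (auto intro: idprod_ideal ideal_S)

lemma ipow_1: 
  assumes "ideal_of S I"
  shows "ipow S I 1 = I"
proof
  show "ipow S I 1 \<subseteq> I"
    using idprod_least[OF assms, of S I] ideal_ofD(4)[OF assms] by simp
  show "I \<subseteq> ipow S I 1"
    using idprod.prod[of 1 S _ I] by auto
qed

lemma ipow_mult:
  assumes "ideal_of S I" "a \<in> ipow S I m" "b \<in> ipow S I n"
  shows "a * b \<in> ipow S I (m + n)"
  using assms(3)
proof (induction n arbitrary: b)
  case 0
  then show ?case using ideal_ofD(5)[OF ipow_ideal[OF assms(1)] _ assms(2)] by simp
next
  case (Suc n)
  from Suc.prems have "b \<in> idprod (ipow S I n) I" by simp
  then show ?case
  proof induction
    case (prod c d)
    then show ?case using idprod.prod[OF Suc.IH[OF prod(1)] prod(2)] by (simp add: mult.assoc)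
  next
    case (sum x y)
    then show ?case using idprod.sum by (simp add: distrib_left)
  qed
qed

lemma ipow_power: "ideal_of S I \<Longrightarrow> a \<in> I \<Longrightarrow> a ^ n \<in> ipow S I n"
  using idprod.prod[of "a ^ _" "ipow S I _" a I] by (induction n) (auto simp: mult.commute)

lemma ipow_le_prime:
  assumes "ideal_of S I" "prime_of S P" "I \<subseteq> P" "n > 0"
  shows "ipow S I n \<subseteq> P"
proof -
  obtain k where n: "n = Suc k" using assms(4) by (cases n) auto
  show ?thesis
    unfolding n ipow.simps
    by (rule idprod_least[OF prime_ofD(1)[OF assms(2)]])
      (use assms(3) ideal_ofD(4)[OF prime_ofD(1)[OF assms(2)]] ideal_ofD(1)[OF ipow_ideal[OF assms(1)]] in blast)
qed

end

lemma ipow_hom: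
  assumes h: "\<And>a b. h (a + b) = h a + h b" "\<And>a b. h (a * b) = h a * h b"
    and "\<And>a. a \<in> S \<Longrightarrow> h a \<in> S'" "\<And>a. a \<in> I \<Longrightarrow> h a \<in> I'"
  shows "x \<in> ipow S I n \<Longrightarrow> h x \<in> ipow S' I' n"
proof (induction n arbitrary: x)
  case (Suc n)
  from Suc.prems have "x \<in> idprod (ipow S I n) I" by simp
  then show ?case
    by induction (use Suc.IH assms in \<open>auto intro: idprod.intros\<close>)
qed (use assms in auto)

text \<open>With \<open>h\<close> the specialization at s = 0, this lifts elements of a power of
  \<open>J\<close> to the same power of the deformed ideal; \<open>ipow_hom\<close> is the way
  back.\<close>

lemma ipow_lift:
  assumes h: "\<And>a b. h (a + b) = h a + h b" "\<And>a b. h (a * b) = h a * h b"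
    and "S' \<subseteq> h ` S" "I' \<subseteq> h ` I"
  shows "x \<in> ipow S' I' n \<Longrightarrow> x \<in> h ` ipow S I n"
proof (induction n arbitrary: x)
  case (Suc n)
  from Suc.prems have "x \<in> idprod (ipow S' I' n) I'" by simp
  then show ?case
  proof induction
    case (prod a b)
    then obtain a' b' where "a' \<in> ipow S I n" "b' \<in> I" "a = h a'" "b = h b'"
      using Suc.IH assms(4) by blast
    then show ?case using h(2) idprod.prod[of a' "ipow S I n" b' I] by (auto intro!: image_eqI)
  next
    case (sum x y)
    then obtain x' y' where "x' \<in> ipow S I (Suc n)" "y' \<in> ipow S I (Suc n)" "x = h x'" "y = h y'"
      by blast
    then show ?case using h(1) idprod.sum[of x' _ _ y'] by (intro image_eqI[of _ _ "x' + y'"]) auto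
  qed
qed (use assms in auto)


section \<open>Polynomials with coefficients in a subring\<close>

definition polys :: "'a::comm_ring_1 set \<Rightarrow> 'a poly set"
  where "polys S = {f. \<forall>i. coeff f i \<in> S}"

lemma polysD: "f \<in> polys S \<Longrightarrow> coeff f i \<in> S"
  unfolding polys_def by auto

lemma polys_mono: "S \<subseteq> T \<Longrightarrow> polys S \<subseteq> polys T"
  unfolding polys_def by auto

lemma (in csubring) coeff_mult_ideal:
  assumes "ideal_of S I" "f \<in> polys S" "g \<in> polys I"
  shows "f * g \<in> polys I"
  unfolding polys_def mem_Collect_eq coeff_mult
  using assms by (intro allI ideal_of_sum[OF assms(1)] ideal_ofD(4)[OF assms(1)] polysD)

lemma (in csubring) polys_ideal:
  assumes "ideal_of S I"
  shows "ideal_of (polys S) (polys I)"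
  unfolding ideal_of_def
  using coeff_mult_ideal[OF assms] ideal_ofD[OF assms] polys_mono[of I S]
  by (auto simp: polys_def)

lemma (in csubring) csubring_polys [intro]: "csubring (polys S)"
proof
  show "1 \<in> polys S"
    unfolding polys_def by (auto simp: coeff_1 split: nat.splits)
  show "a * b \<in> polys S" if "a \<in> polys S" "b \<in> polys S" for a b
    using coeff_mult_ideal[OF ideal_S that] .
qed (auto simp: polys_def)

lemma pCons_in_polys:
  assumes "0 \<in> S"
  shows "pCons a f \<in> polys S \<longleftrightarrow> a \<in> S \<and> f \<in> polys S"
  unfolding polys_def by (auto simp: coeff_pCons assms split: nat.splits)

lemma polys_poly:
  assumes "csubring S" "f \<in> polys S" "v \<in> S"
  shows "poly f v \<in> S"
  unfolding poly_altdef using assms by (auto intro!: csubring.sum csubring.mult csubring.power dest: polysD)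

lemma poly_eq_0_imp_X:
  fixes f :: "'a::comm_ring_1 poly"
  assumes "poly f 0 = 0"
  obtains g where "f = [:0, 1:] * g" "\<And>i. coeff g i = coeff f (Suc i)"
proof (cases f)
  case (pCons a g)
  then show ?thesis using assms that[of g] by simp
qed

text \<open>If neither factor has all coefficients in \<open>P\<close>, let i and j be the lowest
  indices of coefficients outside \<open>P\<close>. In the coefficient of index i + j of the
  product, every other summand has a factor of lower index and so lies in \<open>P\<close>.\<close>

lemma (in csubring) prime_polys:
  assumes "prime_of S P"
  shows "prime_of (polys S) (polys P)"
  unfolding prime_of_def
proof (intro conjI ballI impI)
  show "ideal_of (polys S) (polys P)" using polys_ideal prime_ofD[OF assms] by blast
  have "coeff (1::'a poly) 0 \<notin> P" using prime_ofD[OF assms] by simp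
  then show "1 \<notin> polys P" using polysD by blast
  fix f g assume fg: "f \<in> polys S" "g \<in> polys S" "f * g \<in> polys P"
  note I = prime_ofD(1)[OF assms]
  show "f \<in> polys P \<or> g \<in> polys P"
  proof (rule ccontr)
    assume "\<not> ?thesis"
    then have ex: "\<exists>i. coeff f i \<notin> P" "\<exists>j. coeff g j \<notin> P" unfolding polys_def by auto
    define i j where "i = (LEAST i. coeff f i \<notin> P)" and "j = (LEAST j. coeff g j \<notin> P)"
    have i: "coeff f i \<notin> P" and j: "coeff g j \<notin> P"
      using LeastI_ex[OF ex(1)] LeastI_ex[OF ex(2)] by (auto simp: i_def j_def)
    have lt: "k < i \<Longrightarrow> coeff f k \<in> P" "k < j \<Longrightarrow> coeff g k \<in> P" for k
      using not_less_Least by (auto simp: i_def j_def)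
    have "(\<Sum>k\<in>{..i + j} - {i}. coeff f k * coeff g (i + j - k)) \<in> P"
    proof (rule ideal_of_sum[OF I])
      fix k assume "k \<in> {..i + j} - {i}"
      then consider "k < i" | "i + j - k < j" by force
      then show "coeff f k * coeff g (i + j - k) \<in> P"
        by cases (use lt ideal_ofD(4,5)[OF I] polysD[OF fg(1)] polysD[OF fg(2)] in auto)
    qed
    moreover have "coeff (f * g) (i + j)
        = coeff f i * coeff g j + (\<Sum>k\<in>{..i + j} - {i}. coeff f k * coeff g (i + j - k))"
      unfolding coeff_mult by (subst sum.remove[of _ i]) auto
    ultimately have "coeff f i * coeff g j \<in> P"
      using ideal_add_cancel[OF I] polysD[OF fg(3)] by metis
    then show False
      using prime_ofD(3)[OF assms] i j polysD[OF fg(1)] polysD[OF fg(2)] by blast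
  qed
qed

section \<open>Determinants of arrays\<close>

text \<open>Arrays are functions, so that replacing a row is a function update. Entries outside the
  N by N square have no influence, see \<open>dt_cong\<close>.\<close>

definition dt :: "nat \<Rightarrow> (nat \<Rightarrow> nat \<Rightarrow> 'a::comm_ring_1) \<Rightarrow> 'a"
  where "dt N f = det (mat N N (\<lambda>(i, j). f i j))"

definition unit_row :: "nat \<Rightarrow> nat \<Rightarrow> 'a::comm_ring_1"
  where "unit_row k i = (if i = k then 1 else 0)"

lemma dt_leibniz: "dt N f = (\<Sum>p | p permutes {0..<N}. signof p * (\<Prod>i<N. f i (p i)))"
  unfolding dt_def
  by (subst det_def'[of _ N])
    (auto simp: lessThan_atLeast0 permutes_in_image intro!: sum.cong prod.cong arg_cong2[of _ _ _ _ "(*)"])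

lemma dt_cong: "(\<And>i j. i < N \<Longrightarrow> j < N \<Longrightarrow> f i j = g i j) \<Longrightarrow> dt N f = dt N g"
  unfolding dt_def by (rule arg_cong[of _ _ det]) auto

lemma (in csubring) signof_mem: "signof p \<in> S"
  by (cases p rule: sign_cases) auto

lemma (in csubring) dt_mem:
  assumes "\<And>i j. i < N \<Longrightarrow> j < N \<Longrightarrow> f i j \<in> S"
  shows "dt N f \<in> S"
  unfolding dt_leibniz
  by (intro sum mult prod signof_mem) (use assms in \<open>auto dest: permutes_in_image\<close>)

lemma poly_dt: "poly (dt N f) a = dt N (\<lambda>i j. poly (f i j) a)"
  unfolding dt_leibniz by (auto simp: poly_sum poly_prod sign_def intro!: sum.cong)

lemma dt_expand_row:
  assumes "k < N"
  shows "dt N (f(k := u)) = (\<Sum>j<N. u j * dt N (f(k := unit_row j)))"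
proof -
  define c where "c j = cofactor (mat N N (\<lambda>(i, j). f i j)) k j" for j
  have del: "mat_delete (mat N N (\<lambda>(i, j). (f(k := v)) i j)) k j = mat_delete (mat N N (\<lambda>(i, j). f i j)) k j"
    if "j < N" for v j
    using that assms by (intro eq_matI) (auto simp: mat_delete_def)
  have e: "dt N (f(k := v)) = (\<Sum>j<N. v j * c j)" for v
    unfolding dt_def
    by (subst laplace_expansion_row[of _ N k])
      (use assms in \<open>auto simp: c_def cofactor_def del intro!: sum.cong\<close>)
  have "dt N (f(k := unit_row j)) = c j" if "j < N" for j
    using that by (simp add: e unit_row_def if_distrib[of "\<lambda>x. x * _"] cong: if_cong)
  then show ?thesis by (simp add: e)
qed

lemma dt_identical_rows:
  assumes "i < N" "j < N" "i \<noteq> j" "\<And>l. l < N \<Longrightarrow> f i l = f j l"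
  shows "dt N f = 0"
  unfolding dt_def
  by (rule det_identical_rows[of _ N i j]) (use assms in \<open>auto intro!: eq_vecI\<close>)

text \<open>The pairing is the determinant in which row \<open>k\<close> has been replaced by a
  second copy of row \<open>i\<close>.\<close>

lemma dt_cofactor_orthogonal:
  assumes "k < N" "i < N" "i \<noteq> k"
  shows "(\<Sum>j<N. f i j * dt N (f(k := unit_row j))) = 0"
  unfolding dt_expand_row[OF assms(1), symmetric]
  by (rule dt_identical_rows[of i N k]) (use assms in auto)

text \<open>Expanding each determinant on the right along its replaced row turns the sum into an
  entry of the product of the adjugate and the matrix. No division occurs, so the rule serves over
  any commutative ring.\<close>

lemma dt_cramer:
  assumes "j < N"
  shows "dt N f * b j = (\<Sum>i<N. dt N (f(i := b)) * f i j)"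
proof -
  define A where "A = mat N N (\<lambda>(i, j). f i j)"
  have A: "A \<in> carrier_mat N N" by (simp add: A_def)
  have adj: "(\<Sum>i<N. cofactor A i l * f i j) = (if l = j then dt N f else 0)" if "l < N" for l
  proof -
    have "(\<Sum>i<N. cofactor A i l * f i j) = (adj_mat A * A) $$ (l, j)"
      using that assms adj_mat(1)[OF A] A
      by (auto simp: scalar_prod_def lessThan_atLeast0 adj_mat_def A_def intro!: sum.cong)
    also have "\<dots> = (det A \<cdot>\<^sub>m 1\<^sub>m N) $$ (l, j)" using adj_mat(3)[OF A] by simp
    finally show ?thesis using that assms by (simp add: A_def dt_def)
  qed
  have del: "mat_delete (mat N N (\<lambda>(i, j). (f(k := b)) i j)) k l = mat_delete A k l"
    if "l < N" "k < N" for k l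
    using that assms by (intro eq_matI) (auto simp: mat_delete_def A_def)
  have e: "dt N (f(i := b)) = (\<Sum>l<N. b l * cofactor A i l)" if "i < N" for i
    unfolding dt_def
    by (subst laplace_expansion_row[of _ N i]) (use that in \<open>auto simp: cofactor_def del intro!: sum.cong\<close>)
  have "(\<Sum>i<N. dt N (f(i := b)) * f i j) = (\<Sum>i<N. \<Sum>l<N. b l * (cofactor A i l * f i j))"
    by (intro sum.cong) (auto simp: e sum_distrib_right mult.assoc)
  also have "\<dots> = (\<Sum>l<N. b l * (\<Sum>i<N. cofactor A i l * f i j))"
    by (subst sum.swap) (simp add: sum_distrib_left)
  also have "\<dots> = (\<Sum>l<N. b l * (if l = j then dt N f else 0))"
    by (intro sum.cong) (auto simp: adj)
  also have "\<dots> = dt N f * b j" using assms by (simp add: if_distrib mult.commute cong: if_cong)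
  finally show ?thesis ..
qed

lemma dt_transpose: "dt N (\<lambda>i j. f j i) = dt N f"
proof -
  have "transpose_mat (mat N N (\<lambda>(i, j). f i j)) = mat N N (\<lambda>(i, j). f j i)"
    by (intro eq_matI) auto
  then show ?thesis unfolding dt_def by (metis det_transpose mat_carrier)
qed

lemma dt_zero_iff_kernel:
  fixes f :: "nat \<Rightarrow> nat \<Rightarrow> 'a::field"
  shows "dt N f = 0 \<longleftrightarrow> (\<exists>v. (\<exists>j<N. v j \<noteq> 0) \<and> (\<forall>i<N. (\<Sum>j<N. f i j * v j) = 0))"
proof -
  define A where "A = mat N N (\<lambda>(i, j). f i j)"
  have A: "A \<in> carrier_mat N N" by (simp add: A_def)
  have "(\<exists>v. v \<in> carrier_vec N \<and> v \<noteq> 0\<^sub>v N \<and> A *\<^sub>v v = 0\<^sub>v N)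
      \<longleftrightarrow> (\<exists>v. (\<exists>j<N. v j \<noteq> 0) \<and> (\<forall>i<N. (\<Sum>j<N. f i j * v j) = 0))"
  proof
    assume "\<exists>v. v \<in> carrier_vec N \<and> v \<noteq> 0\<^sub>v N \<and> A *\<^sub>v v = 0\<^sub>v N"
    then obtain v where v: "v \<in> carrier_vec N" "v \<noteq> 0\<^sub>v N" "A *\<^sub>v v = 0\<^sub>v N" by blast
    have "\<exists>j<N. v $ j \<noteq> 0" using v(1,2) by (metis eq_vecI carrier_vecD index_zero_vec)
    moreover have "(\<Sum>j<N. f i j * v $ j) = 0" if "i < N" for i
    proof -
      have "(A *\<^sub>v v) $ i = 0" using v(3) that by simp
      then show ?thesis using that v(1) by (simp add: A_def scalar_prod_def lessThan_atLeast0)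
    qed
    ultimately show "\<exists>v. (\<exists>j<N. v j \<noteq> 0) \<and> (\<forall>i<N. (\<Sum>j<N. f i j * v j) = 0)"
      by (intro exI[of _ "\<lambda>j. v $ j"]) auto
  next
    assume "\<exists>v. (\<exists>j<N. v j \<noteq> 0) \<and> (\<forall>i<N. (\<Sum>j<N. f i j * v j) = 0)"
    then obtain v j where v: "j < N" "v j \<noteq> 0" "\<forall>i<N. (\<Sum>j<N. f i j * v j) = 0" by blast
    have "vec N v \<noteq> 0\<^sub>v N" using v(1,2) by (metis index_vec index_zero_vec(1))
    moreover have "A *\<^sub>v vec N v = 0\<^sub>v N"
      using v(3) by (intro eq_vecI) (auto simp: A_def scalar_prod_def lessThan_atLeast0)
    ultimately show "\<exists>v. v \<in> carrier_vec N \<and> v \<noteq> 0\<^sub>v N \<and> A *\<^sub>v v = 0\<^sub>v N"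
      by (intro exI[of _ "vec N v"]) auto
  qed
  then show ?thesis using det_0_iff_vec_prod_zero_field[OF A] by (simp add: dt_def A_def)
qed

section \<open>Regular local rings of dimension three\<close>

lemma sum_lessThan_add:
  fixes n t :: nat
  shows "(\<Sum>i<n + t. f i) = (\<Sum>i<n. f i) + (\<Sum>i<t. f (i + n) :: 'a::comm_monoid_add)"
  by (induction t) (simp_all add: add.assoc add.commute[of n])

section \<open>Submodules of free modules of finite rank\<close>

locale noetherian_subring = csubring S for S :: "'a::comm_ring_1 set" +
  assumes noetherian: "noetherian_of S"
begin

text \<open>Vectors are functions on all natural numbers of which only the first \<open>N\<close>
  values count; hence the comparison of entries below \<open>N\<close>, and inclusions in
  \<open>vspan\<close> rather than equations.\<close>

definition vspan :: "nat \<Rightarrow> (nat \<Rightarrow> nat \<Rightarrow> 'a) \<Rightarrow> nat \<Rightarrow> (nat \<Rightarrow> 'a) set"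
  where "vspan n g N = {v. \<exists>c. (\<forall>i<n. c i \<in> S) \<and> (\<forall>j<N. v j = (\<Sum>i<n. c i * g i j))}"

definition submodule :: "nat \<Rightarrow> (nat \<Rightarrow> 'a) set \<Rightarrow> bool"
  where "submodule N K \<longleftrightarrow> (\<forall>v\<in>K. \<forall>j<N. v j \<in> S) \<and> (\<lambda>_. 0) \<in> K \<and>
    (\<forall>v\<in>K. \<forall>w\<in>K. (\<lambda>j. v j + w j) \<in> K) \<and> (\<forall>a\<in>S. \<forall>v\<in>K. (\<lambda>j. a * v j) \<in> K)"

lemma submoduleD:
  assumes "submodule N K"
  shows "v \<in> K \<Longrightarrow> j < N \<Longrightarrow> v j \<in> S" "(\<lambda>_. 0) \<in> K"
    "v \<in> K \<Longrightarrow> w \<in> K \<Longrightarrow> (\<lambda>j. v j + w j) \<in> K"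
    "a \<in> S \<Longrightarrow> v \<in> K \<Longrightarrow> (\<lambda>j. a * v j) \<in> K"
  using assms unfolding submodule_def by auto

lemma submodule_sum:
  assumes "submodule N K" "finite Y" "\<And>i. i \<in> Y \<Longrightarrow> c i \<in> S" "\<And>i. i \<in> Y \<Longrightarrow> g i \<in> K"
  shows "(\<lambda>j. \<Sum>i\<in>Y. c i * g i j) \<in> K"
  using assms(2-4)
proof (induction Y)
  case (insert i Y)
  then have "(\<lambda>j. c i * g i j) \<in> K" "(\<lambda>j. \<Sum>i\<in>Y. c i * g i j) \<in> K"
    using submoduleD(4)[OF assms(1)] by auto
  then show ?case using insert submoduleD(3)[OF assms(1)] by fastforce
qed (use submoduleD(2)[OF assms(1)] in simp)

lemma submodule_diff_sum:
  assumes "submodule N K" "finite Y" "\<And>i. i \<in> Y \<Longrightarrow> c i \<in> S" "\<And>i. i \<in> Y \<Longrightarrow> g i \<in> K" "v \<in> K"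
  shows "(\<lambda>j. v j - (\<Sum>i\<in>Y. c i * g i j)) \<in> K"
proof -
  have "(\<lambda>j. (- 1) * (\<Sum>i\<in>Y. c i * g i j)) \<in> K"
    by (intro submoduleD(4)[OF assms(1)] submodule_sum[OF assms(1)]) (use assms in auto)
  then show ?thesis using submoduleD(3)[OF assms(1,5)] by fastforce
qed

text \<open>Induction on the rank: the last entries form a finitely generated ideal, and the vectors
  whose last entry vanishes form a submodule of smaller rank.\<close>

lemma submodule_finitely_generated:
  assumes "submodule N K"
  shows "\<exists>n g. (\<forall>i<n. g i \<in> K) \<and> K \<subseteq> vspan n g N"
  using assms
proof (induction N arbitrary: K)
  case 0
  then show ?case by (intro exI[of _ 0]) (auto simp: vspan_def)
next
  case (Suc N)
  define K' where "K' = {v\<in>K. v N = 0}"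
  have "submodule N K'"
    using Suc.prems unfolding submodule_def K'_def by auto
  from Suc.IH[OF this] obtain n g where g: "\<forall>i<n. g i \<in> K'" "K' \<subseteq> vspan n g N" by blast
  have "ideal_of S ((\<lambda>v. v N) ` K)"
    unfolding ideal_of_def
  proof (intro conjI ballI)
    show "(\<lambda>v. v N) ` K \<subseteq> S" using submoduleD(1)[OF Suc.prems] by auto
    show "0 \<in> (\<lambda>v. v N) ` K" using submoduleD(2)[OF Suc.prems] by force
    show "a + b \<in> (\<lambda>v. v N) ` K" if "a \<in> (\<lambda>v. v N) ` K" "b \<in> (\<lambda>v. v N) ` K" for a b
      using that submoduleD(3)[OF Suc.prems] by force
    show "s * a \<in> (\<lambda>v. v N) ` K" if "s \<in> S" "a \<in> (\<lambda>v. v N) ` K" for s a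
      using that submoduleD(4)[OF Suc.prems] by force
  qed
  then obtain t e where e: "\<forall>i<t. e i \<in> (\<lambda>v. v N) ` K" "(\<lambda>v. v N) ` K = lin_span S t e"
    using noetherian unfolding noetherian_of_def by blast
  have "\<forall>i. \<exists>v. i < t \<longrightarrow> v \<in> K \<and> v N = e i" using e(1) by (metis imageE)
  then obtain w where w: "\<And>i. i < t \<Longrightarrow> w i \<in> K \<and> w i N = e i" by metis
  define h where "h i = (if i < n then g i else w (i - n))" for i
  have split: "(\<Sum>i<n + t. a i * h i j) = (\<Sum>i<n. a i * g i j) + (\<Sum>i<t. a (i + n) * w i j)" for a j
    by (simp add: sum_lessThan_add h_def del: sum.lessThan_Suc)
  have "v \<in> vspan (n + t) h (Suc N)" if "v \<in> K" for v
  proof -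
    from that e(2) have "v N \<in> lin_span S t e" by blast
    then obtain c where c: "\<And>i. i < t \<Longrightarrow> c i \<in> S" "v N = (\<Sum>i<t. c i * e i)"
      by (metis lin_spanE)
    define v' where "v' j = v j - (\<Sum>i<t. c i * w i j)" for j
    have "v' \<in> K"
      unfolding v'_def by (rule submodule_diff_sum[OF Suc.prems]) (use c w that in auto)
    moreover have "v' N = 0" using c w by (simp add: v'_def)
    ultimately have "v' \<in> vspan n g N" using g(2) by (auto simp: K'_def)
    then obtain b where b: "\<forall>i<n. b i \<in> S" "\<forall>j<N. v' j = (\<Sum>i<n. b i * g i j)"
      unfolding vspan_def by blast
    have "v' j = (\<Sum>i<n. b i * g i j)" if "j < Suc N" for j
    proof (cases "j = N")
      case True
      then show ?thesis using \<open>v' N = 0\<close> g(1) by (simp add: K'_def)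
    qed (use that b in auto)
    then have "v j = (\<Sum>i<n + t. (if i < n then b i else c (i - n)) * h i j)" if "j < Suc N" for j
      unfolding split using that by (simp add: v'_def diff_eq_eq)
    then show ?thesis
      unfolding vspan_def
      using b(1) c(1) by (intro CollectI exI[of _ "\<lambda>i. if i < n then b i else c (i - n)"]) auto
  qed
  moreover have "\<forall>i<n + t. h i \<in> K" using g(1) w by (auto simp: h_def K'_def)
  ultimately show ?case by blast
qed

end

section \<open>Nakayama's lemma over a local domain inside its fraction field\<close>

locale local_domain = noetherian_subring A for A :: "'f::field set" +
  fixes M :: "'f set"
  assumes M_ideal: "ideal_of A M"
    and one_notin_M: "1 \<notin> M"
    and inverse_mem: "a \<in> A \<Longrightarrow> a \<notin> M \<Longrightarrow> inverse a \<in> A"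
    and fractions: "\<And>v. \<exists>s\<in>A. s \<noteq> 0 \<and> s * v \<in> A"
begin

lemma M_sub: "a \<in> M \<Longrightarrow> a \<in> A"
  using ideal_ofD(6)[OF M_ideal] .

lemma one_minus_inverse:
  assumes "b \<in> M"
  shows "1 - b \<noteq> 0" "inverse (1 - b) \<in> A"
proof -
  have "1 - b \<notin> M"
    using ideal_ofD(3)[OF M_ideal, of "1 - b" b] assms one_notin_M by auto
  then show "1 - b \<noteq> 0" "inverse (1 - b) \<in> A"
    using inverse_mem[of "1 - b"] M_sub[OF assms] ideal_ofD(2)[OF M_ideal] by auto
qed

text \<open>Elimination of the generators of \<open>K\<close> one by one: in the expression of the
  last one its own coefficient \<open>b n\<close> lies in \<open>M\<close>, so
  \<open>1 - b n\<close> is a unit and the generator can be solved for.\<close>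

lemma nakayama_generators:
  fixes n m N :: nat
  assumes "\<And>i. i < n \<Longrightarrow> g i \<in> K"
    and "\<And>v. v \<in> K \<Longrightarrow> \<exists>a b. (\<forall>i<m. a i \<in> A) \<and> (\<forall>i<n. b i \<in> M) \<and>
      (\<forall>j<N. v j = (\<Sum>i<m. a i * h i j) + (\<Sum>i<n. b i * g i j))"
  shows "K \<subseteq> vspan m h N"
  using assms
proof (induction n)
  case 0
  then show ?case unfolding vspan_def by fastforce
next
  case (Suc n)
  obtain a b where ab: "\<forall>i<m. a i \<in> A" "\<forall>i<Suc n. b i \<in> M"
    "\<forall>j<N. g n j = (\<Sum>i<m. a i * h i j) + (\<Sum>i<Suc n. b i * g i j)"
    using Suc.prems(2)[of "g n"] Suc.prems(1) by blast
  define u where "u = inverse (1 - b n)"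
  have u: "u \<in> A" "u * (1 - b n) = 1"
    using one_minus_inverse[of "b n"] ab(2) by (auto simp: u_def)
  have gn: "g n j = (\<Sum>i<m. u * a i * h i j) + (\<Sum>i<n. u * b i * g i j)" if "j < N" for j
  proof -
    have "(1 - b n) * g n j = (\<Sum>i<m. a i * h i j) + (\<Sum>i<n. b i * g i j)"
      using ab(3) that by (simp add: algebra_simps)
    then have "u * ((1 - b n) * g n j) = u * ((\<Sum>i<m. a i * h i j) + (\<Sum>i<n. b i * g i j))"
      by simp
    then have "(u * (1 - b n)) * g n j = (\<Sum>i<m. u * a i * h i j) + (\<Sum>i<n. u * b i * g i j)"
      by (simp add: sum_distrib_left algebra_simps)
    then show ?thesis by (simp add: u(2))
  qed
  show ?case
  proof (rule Suc.IH)
    show "g i \<in> K" if "i < n" for i using that Suc.prems(1) by auto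
    fix v assume "v \<in> K"
    then obtain a' b' where ab': "\<forall>i<m. a' i \<in> A" "\<forall>i<Suc n. b' i \<in> M"
      "\<forall>j<N. v j = (\<Sum>i<m. a' i * h i j) + (\<Sum>i<Suc n. b' i * g i j)"
      using Suc.prems(2) by blast
    have "v j = (\<Sum>i<m. (a' i + b' n * (u * a i)) * h i j) + (\<Sum>i<n. (b' i + b' n * (u * b i)) * g i j)"
      if "j < N" for j
      using ab'(3) that by (simp add: gn algebra_simps sum.distrib sum_distrib_left)
    moreover have "a' i + b' n * (u * a i) \<in> A" if "i < m" for i
      using ab(1) ab'(1,2) u(1) that by (intro add mult) (auto intro: M_sub)
    moreover have "b' i + b' n * (u * b i) \<in> M" if "i < n" for i
      using ab(2) ab'(2) u(1) that
      by (intro ideal_ofD(3)[OF M_ideal] ideal_ofD(4)[OF M_ideal]) (auto intro: M_sub)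
    ultimately show "\<exists>a b. (\<forall>i<m. a i \<in> A) \<and> (\<forall>i<n. b i \<in> M) \<and>
      (\<forall>j<N. v j = (\<Sum>i<m. a i * h i j) + (\<Sum>i<n. b i * g i j))"
      by (intro exI[of _ "\<lambda>i. a' i + b' n * (u * a i)"] exI[of _ "\<lambda>i. b' i + b' n * (u * b i)"]) auto
  qed
qed

lemma nakayama:
  assumes K: "submodule N K"
    and dec: "\<And>v. v \<in> K \<Longrightarrow> \<exists>a t b k. (\<forall>i<m. a i \<in> A) \<and> (\<forall>i<t. b i \<in> M \<and> k i \<in> K) \<and>
      (\<forall>j<N. v j = (\<Sum>i<m. a i * h i j) + (\<Sum>i<(t::nat). b i * k i j))"
  shows "K \<subseteq> vspan m h N"
proof -
  obtain n g where g: "\<forall>i<n. g i \<in> K" "K \<subseteq> vspan n g N"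
    using submodule_finitely_generated[OF K] by blast
  show ?thesis
  proof (rule nakayama_generators[of n g])
    show "g i \<in> K" if "i < n" for i using g that by blast
    fix v assume "v \<in> K"
    from dec[OF this] obtain a t b k where *: "\<forall>i<m. a i \<in> A" "\<forall>i<t. b i \<in> M \<and> k i \<in> K"
      "\<forall>j<N. v j = (\<Sum>i<m. a i * h i j) + (\<Sum>i<(t::nat). b i * k i j)" by blast
    have "\<forall>i. \<exists>c. i < t \<longrightarrow> (\<forall>l<n. c l \<in> A) \<and> (\<forall>j<N. k i j = (\<Sum>l<n. c l * g l j))"
      using *(2) g(2) unfolding vspan_def by blast
    then obtain c where c: "\<And>i. i < t \<Longrightarrow> (\<forall>l<n. c i l \<in> A) \<and> (\<forall>j<N. k i j = (\<Sum>l<n. c i l * g l j))"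
      by metis
    have "(\<Sum>i<t. b i * k i j) = (\<Sum>l<n. (\<Sum>i<t. b i * c i l) * g l j)" if "j < N" for j
    proof -
      have "(\<Sum>i<t. b i * k i j) = (\<Sum>i<t. \<Sum>l<n. b i * c i l * g l j)"
        using c that by (intro sum.cong) (auto simp: sum_distrib_left mult.assoc)
      also have "\<dots> = (\<Sum>l<n. (\<Sum>i<t. b i * c i l) * g l j)"
        by (subst sum.swap) (simp add: sum_distrib_right)
      finally show ?thesis .
    qed
    moreover have "(\<Sum>i<t. b i * c i l) \<in> M" if "l < n" for l
      using * c that by (intro ideal_of_sum[OF M_ideal] ideal_ofD(5)[OF M_ideal]) auto
    ultimately show "\<exists>a b. (\<forall>i<m. a i \<in> A) \<and> (\<forall>i<n. b i \<in> M) \<and>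
      (\<forall>j<N. v j = (\<Sum>i<m. a i * h i j) + (\<Sum>i<n. b i * g i j))"
      using * by (intro exI[of _ a] exI[of _ "\<lambda>l. \<Sum>i<t. b i * c i l"]) auto
  qed
qed

text \<open>Rank one with a single multiplier \<open>t\<close>. It yields both the Krull
  intersection argument and the liftings modulo one parameter. An ideal is encoded as the set of
  vectors whose entry 0 lies in it.\<close>

lemma nakayama_ideal:
  assumes C: "ideal_of A C" and B: "ideal_of A B" and t: "t \<in> M"
    and dec: "\<And>c. c \<in> C \<Longrightarrow> \<exists>b\<in>B. \<exists>c'\<in>C. c = b + t * c'"
  shows "C \<subseteq> B"
proof -
  obtain m h where h: "\<forall>i<m. h i \<in> B" "B = lin_span A m h"
    using noetherian B unfolding noetherian_of_def by blast
  define K where "K = {v :: nat \<Rightarrow> 'f. v 0 \<in> C}"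
  have "K \<subseteq> vspan m (\<lambda>i _. h i) 1"
  proof (rule nakayama)
    show "submodule 1 K"
      using ideal_ofD[OF C] unfolding submodule_def K_def by auto
    fix v assume "v \<in> K"
    then obtain b c' where b: "b \<in> B" "c' \<in> C" "v 0 = b + t * c'" using dec K_def by blast
    then obtain a where "\<And>i. i < m \<Longrightarrow> a i \<in> A" "b = (\<Sum>i<m. a i * h i)"
      using h(2) lin_spanE by metis
    then show "\<exists>a n b k. (\<forall>i<m. a i \<in> A) \<and> (\<forall>i<n. b i \<in> M \<and> k i \<in> K) \<and>
      (\<forall>j<1. v j = (\<Sum>i<m. a i * h i) + (\<Sum>i<(n::nat). b i * k i j))"
      using b t
      by (intro exI[of _ a] exI[of _ "1::nat"] exI[of _ "\<lambda>_. t"] exI[of _ "\<lambda>_ _. c'"]) (auto simp: K_def)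
  qed
  show ?thesis
  proof
    fix c assume "c \<in> C"
    then have "(\<lambda>_. c) \<in> vspan m (\<lambda>i _. h i) 1" using \<open>K \<subseteq> _\<close> by (auto simp: K_def)
    then show "c \<in> B" unfolding vspan_def h(2) lin_span_def by auto
  qed
qed

end

text \<open>The last four assumptions make \<open>y\<close>, \<open>z\<close>, \<open>x\<close> a
  regular sequence of which the first two members generate a prime. The quotient by (y, z) is
  therefore a discrete valuation ring with uniformizer \<open>x\<close>.\<close>

locale regular_local_3 = local_domain A M for A M :: "'f::field set" +
  fixes y z x :: 'f
  assumes y: "y \<in> M" and z: "z \<in> M" and x: "x \<in> M"
    and M_generated: "a \<in> M \<Longrightarrow> \<exists>b\<in>A. \<exists>c\<in>A. \<exists>d\<in>A. a = b * y + c * z + d * x"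
    and y_nonzero: "y \<noteq> 0"
    and z_regular: "a \<in> A \<Longrightarrow> b \<in> A \<Longrightarrow> z * a = y * b \<Longrightarrow> \<exists>c\<in>A. a = y * c"
    and yz_prime: "prime_of A {b * y + c * z |b c. b \<in> A \<and> c \<in> A}"
    and x_notin: "x \<notin> {b * y + c * z |b c. b \<in> A \<and> c \<in> A}"
begin

definition YZ where "YZ = {b * y + c * z |b c. b \<in> A \<and> c \<in> A}"

lemma yz_mem: "y \<in> A" "z \<in> A" "x \<in> A"
  using y z x M_sub by auto

lemma YZ_prime: "prime_of A YZ"
  using yz_prime by (simp add: YZ_def)

lemmas YZ_ideal = prime_ofD(1)[OF YZ_prime]

lemma x_notin_YZ: "x \<notin> YZ"
  using x_notin by (simp add: YZ_def)

lemma M_mod_YZ: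
  assumes "a \<in> M"
  obtains d where "d \<in> A" "a - d * x \<in> YZ"
proof -
  from M_generated[OF assms] obtain b c d where "b \<in> A" "c \<in> A" "d \<in> A" "a = b * y + c * z + d * x"
    by blast
  then show ?thesis using that[of d] by (auto simp: YZ_def)
qed

text \<open>\<open>C\<close> is the intersection of the ideals YZ + (x^e). As \<open>x\<close> is
  regular modulo the prime \<open>YZ\<close>, \<open>C\<close> lies in YZ + x C, and Nakayama's
  lemma puts it into \<open>YZ\<close>. So f is divisible by only finitely many powers of
  \<open>x\<close> modulo \<open>YZ\<close>, and the cofactor of the highest one is outside
  \<open>M\<close>, as otherwise another \<open>x\<close> would split off.\<close>

lemma order_mod_YZ:
  assumes f: "f \<in> A" "f \<notin> YZ"
  obtains e u where "u \<in> A" "inverse u \<in> A" "u \<noteq> 0" "f - u * x ^ e \<in> YZ"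
proof -
  define C where "C = {f\<in>A. \<forall>e. \<exists>a\<in>A. f - a * x ^ e \<in> YZ}"
  have "C \<subseteq> YZ"
  proof (rule nakayama_ideal[OF _ YZ_ideal x])
    show "ideal_of A C"
      unfolding ideal_of_def
    proof (intro conjI ballI)
      show "0 \<in> C" using ideal_ofD(2)[OF YZ_ideal] by (auto simp: C_def intro!: bexI[of _ 0])
      fix a b assume ab: "a \<in> C" "b \<in> C"
      have "\<exists>r\<in>A. a + b - r * x ^ e \<in> YZ" for e
      proof -
        have "\<exists>r\<in>A. a - r * x ^ e \<in> YZ" "\<exists>r\<in>A. b - r * x ^ e \<in> YZ" using ab by (auto simp: C_def)
        then obtain r s where rs: "r \<in> A" "a - r * x ^ e \<in> YZ" "s \<in> A" "b - s * x ^ e \<in> YZ"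
          by blast
        have "a + b - (r + s) * x ^ e = (a - r * x ^ e) + (b - s * x ^ e)" by (simp add: algebra_simps)
        then show ?thesis using rs ideal_ofD(3)[OF YZ_ideal] by (metis add)
      qed
      then show "a + b \<in> C" using ab by (auto simp: C_def)
    next
      fix s a assume sa: "s \<in> A" "a \<in> C"
      have "\<exists>r\<in>A. s * a - r * x ^ e \<in> YZ" for e
      proof -
        obtain r where r: "r \<in> A" "a - r * x ^ e \<in> YZ"
          using sa by (auto simp: C_def)
        have "s * a - (s * r) * x ^ e = s * (a - r * x ^ e)" by (simp add: algebra_simps)
        then show ?thesis using r sa(1) ideal_ofD(4)[OF YZ_ideal] by (metis mult)
      qed
      then show "s * a \<in> C" using sa by (auto simp: C_def)
    qed (auto simp: C_def)
    fix c assume c: "c \<in> C"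
    then have "\<exists>d\<in>A. c - d * x ^ 1 \<in> YZ" unfolding C_def by blast
    then obtain d where d: "d \<in> A" "c - d * x ^ 1 \<in> YZ" by blast
    have "\<exists>a\<in>A. d - a * x ^ e \<in> YZ" for e
    proof -
      obtain a where a: "a \<in> A" "c - a * x ^ Suc e \<in> YZ" using c unfolding C_def by blast
      have "(c - a * x ^ Suc e) - (c - d * x ^ 1) = x * (d - a * x ^ e)" by (simp add: algebra_simps)
      then have "x * (d - a * x ^ e) \<in> YZ" using ideal_diff[OF YZ_ideal a(2) d(2)] by simp
      moreover have "d - a * x ^ e \<in> A" using a(1) d(1) yz_mem by blast
      ultimately show ?thesis
        using prime_ofD(3)[OF YZ_prime yz_mem(3)] a(1) x_notin_YZ by blast
    qed
    then have "d \<in> C" using d by (auto simp: C_def)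
    then show "\<exists>b\<in>YZ. \<exists>c'\<in>C. c = b + x * c'"
      using d by (intro bexI[of _ "c - d * x ^ 1"] bexI[of _ d]) (auto simp: algebra_simps)
  qed
  then have ex: "\<exists>e. \<not> (\<exists>a\<in>A. f - a * x ^ e \<in> YZ)" using f by (auto simp: C_def)
  \<comment> \<open>This is the first exponent that fails, so the order of f is its predecessor
    \<open>d\<close>.\<close>
  define e where "e = (LEAST e. \<not> (\<exists>a\<in>A. f - a * x ^ e \<in> YZ))"
  have e: "\<not> (\<exists>a\<in>A. f - a * x ^ e \<in> YZ)" unfolding e_def using LeastI_ex[OF ex] .
  have "e \<noteq> 0"
  proof
    assume "e = 0"
    with e have "\<not> (f - f * x ^ 0 \<in> YZ)" using f by auto
    then show False using ideal_ofD(2)[OF YZ_ideal] by simp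
  qed
  then obtain d where d: "e = Suc d" by (cases e) auto
  have "\<exists>a\<in>A. f - a * x ^ d \<in> YZ"
    using not_less_Least[of d "\<lambda>e. \<not> (\<exists>a\<in>A. f - a * x ^ e \<in> YZ)"] d e_def by auto
  then obtain u where u: "u \<in> A" "f - u * x ^ d \<in> YZ" by blast
  have "u \<notin> M"
  proof
    assume "u \<in> M"
    then obtain a where a: "a \<in> A" "u - a * x \<in> YZ" by (rule M_mod_YZ)
    have "f - a * x ^ e = (f - u * x ^ d) + (u - a * x) * x ^ d" by (simp add: d algebra_simps)
    moreover have "(u - a * x) * x ^ d \<in> YZ"
      using a ideal_ofD(5)[OF YZ_ideal] yz_mem by auto
    ultimately show False using e a(1) u(2) ideal_ofD(3)[OF YZ_ideal] by metis
  qed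
  then show ?thesis using that[of u d] u inverse_mem ideal_ofD(2)[OF M_ideal] by auto
qed

end

lemma dt_one: "dt N unit_row = 1"
proof -
  have "mat N N (\<lambda>(i, j). unit_row i j) = (1\<^sub>m N :: 'a mat)"
    by (intro eq_matI) (auto simp: unit_row_def)
  then show ?thesis by (simp add: dt_def)
qed

lemma dt_swap_rows:
  assumes "i < N" "j < N" "i \<noteq> j"
  shows "dt N (f(i := f j, j := f i)) = - dt N f"
proof -
  have eq: "mat N N (\<lambda>(k, l). (f(i := f j, j := f i)) k l) = swaprows i j (mat N N (\<lambda>(k, l). f k l))"
    using assms by (intro eq_matI) auto
  then show ?thesis
    unfolding dt_def eq using det_swaprows[OF assms, of "mat N N (\<lambda>(k, l). f k l)"] by simp
qed

text \<open>By \<open>y_notin_J\<close> the quotient by \<open>J\<close> has positive depth, so that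
  over a regular local ring of dimension three the syzygies of \<open>J\<close> are free. The lemmas
  up to \<open>generates\<close> construct an explicit basis.\<close>

locale height_two_prime = regular_local_3 A M y z x for A M :: "'f::field set" and y z x +
  fixes J :: "'f set" and N :: nat and D :: "nat \<Rightarrow> 'f"
  assumes J_prime: "prime_of A J"
    and y_notin_J: "y \<notin> J"
    and J_generated: "J = lin_span A N D"
    and J_minimal: "n < N \<Longrightarrow> J \<noteq> lin_span A n g"
    and N_ge_2: "N \<ge> 2"
begin

lemmas J_ideal = prime_ofD(1)[OF J_prime]

lemma D_mem: "j < N \<Longrightarrow> D j \<in> J"
  using lin_span_gen[of j N D] J_generated by auto

lemma D_A: "j < N \<Longrightarrow> D j \<in> A"
  using D_mem ideal_ofD(6)[OF J_ideal] by auto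

definition Syz where "Syz = {v. (\<forall>j<N. v j \<in> A) \<and> (\<Sum>j<N. v j * D j) = 0}"

lemma Syz_submodule: "submodule N Syz"
  unfolding submodule_def Syz_def
  by (auto simp: distrib_right sum.distrib mult.assoc simp flip: sum_distrib_left)

text \<open>A coefficient outside \<open>M\<close> is a unit and would make the generator
  \<open>D j\<close> redundant, against \<open>J_minimal\<close>.\<close>

lemma Syz_M:
  assumes v: "v \<in> Syz" and j: "j < N"
  shows "v j \<in> M"
proof (rule ccontr)
  assume vj: "v j \<notin> M"
  obtain n where N: "N = Suc n" using N_ge_2 by (cases N) auto
  \<comment> \<open>The transposition of \<open>j\<close> with the last index enumerates the
    generators other than \<open>D j\<close> as \<open>D (s i)\<close> with i below
    \<open>n\<close>.\<close>
  define s where "s = transpose j n"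
  define I where "I = lin_span A n (\<lambda>i. D (s i))"
  have s_lt: "s i < N" if "i < N" for i using that j N by (auto simp: s_def transpose_def)
  have I: "ideal_of A I"
    unfolding I_def by (rule lin_span_ideal) (use D_A s_lt N in auto)
  have other: "D i \<in> I" if "i < N" "i \<noteq> j" for i
  proof -
    have "s i < n" "s (s i) = i" using that N j by (auto simp: s_def transpose_def)
    then show ?thesis using lin_span_gen[of "s i" n "\<lambda>i. D (s i)"] by (simp add: I_def)
  qed
  have "v j * D j = - (\<Sum>i\<in>{..<N} - {j}. v i * D i)"
    using v j by (simp add: Syz_def sum.remove[of "{..<N}" j] eq_neg_iff_add_eq_0)
  moreover have "(\<Sum>i\<in>{..<N} - {j}. v i * D i) \<in> I"
    using v other by (intro ideal_of_sum[OF I] ideal_ofD(4)[OF I]) (auto simp: Syz_def)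
  ultimately have "v j * D j \<in> I" using ideal_uminus[OF I] by simp
  moreover have "inverse (v j) \<in> A" "v j \<noteq> 0"
    using inverse_mem vj v j ideal_ofD(2)[OF M_ideal] by (auto simp: Syz_def)
  ultimately have "D j \<in> I" using ideal_ofD(4)[OF I, of "inverse (v j)" "v j * D j"] by (simp flip: mult.assoc)
  then have "lin_span A N D \<subseteq> I" using other lin_span_least[OF I] by blast
  moreover have "I \<subseteq> J"
    unfolding I_def by (rule lin_span_least[OF J_ideal]) (use D_mem s_lt N in auto)
  ultimately show False using J_minimal[of n "\<lambda>i. D (s i)"] J_generated N by (auto simp: I_def)
qed

text \<open>The parts \<open>a\<close> and \<open>b\<close> of any decomposition of \<open>v\<close>
  are syzygies only up to defects with \<open>y * sa + z * sb = 0\<close>. Regularity of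
  \<open>y\<close>, \<open>z\<close> gives \<open>sb = y * e\<close>, and \<open>e\<close> is in
  \<open>J\<close> because \<open>y\<close> is not. A representation of \<open>e\<close> by the
  generators then corrects both parts by a Koszul term. Hence the syzygies modulo (y, z) embed into
  a free module over the valuation ring.\<close>

lemma Syz_YZ:
  assumes v: "v \<in> Syz" and YZ: "\<And>j. j < N \<Longrightarrow> v j \<in> YZ"
  shows "\<exists>a\<in>Syz. \<exists>b\<in>Syz. \<forall>j<N. v j = y * a j + z * b j"
proof -
  have "\<forall>j. \<exists>a b. j < N \<longrightarrow> a \<in> A \<and> b \<in> A \<and> v j = a * y + b * z"
    using YZ unfolding YZ_def by blast
  then obtain a b where ab: "\<And>j. j < N \<Longrightarrow> a j \<in> A \<and> b j \<in> A \<and> v j = a j * y + b j * z" by metis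
  define sa sb where "sa = (\<Sum>j<N. a j * D j)" and "sb = (\<Sum>j<N. b j * D j)"
  have sab: "sa \<in> A" "sb \<in> A" using ab D_A by (auto simp: sa_def sb_def)
  have "y * sa + z * sb = (\<Sum>j<N. v j * D j)"
    unfolding sa_def sb_def sum_distrib_left sum.distrib[symmetric]
    by (intro sum.cong) (auto simp: ab algebra_simps)
  then have rel: "y * sa + z * sb = 0" using v by (simp add: Syz_def)
  then have "z * sb = y * (- sa)" by (simp add: eq_neg_iff_add_eq_0 add.commute)
  then obtain e where e: "e \<in> A" "sb = y * e" using z_regular[of sb "- sa"] sab by auto
  have "sb \<in> J" unfolding sb_def J_generated by (rule lin_spanI) (use ab in auto)
  then have "e \<in> J" using prime_ofD(3)[OF J_prime] e yz_mem y_notin_J by auto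
  then obtain c where c: "\<And>j. j < N \<Longrightarrow> c j \<in> A" "e = (\<Sum>j<N. c j * D j)"
    unfolding J_generated by (metis lin_spanE)
  have "(\<Sum>j<N. (b j - y * c j) * D j) = sb - y * e"
    by (simp add: sb_def c left_diff_distrib sum_subtractf sum_distrib_left mult.assoc)
  then have 1: "(\<lambda>j. b j - y * c j) \<in> Syz"
    using ab c yz_mem e by (auto simp: Syz_def)
  have "(\<Sum>j<N. (a j + z * c j) * D j) = sa + z * e"
    by (simp add: sa_def c distrib_right sum.distrib sum_distrib_left mult.assoc)
  moreover have "y * (sa + z * e) = 0" using rel e(2) by (simp add: algebra_simps)
  ultimately have "(\<Sum>j<N. (a j + z * c j) * D j) = 0" using y_nonzero by simp
  then have 2: "(\<lambda>j. a j + z * c j) \<in> Syz"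
    using ab c yz_mem by (auto simp: Syz_def)
  have "\<forall>j<N. v j = y * (a j + z * c j) + z * (b j - y * c j)"
    by (auto simp: ab algebra_simps)
  with 1 2 show ?thesis by (intro bexI[of _ "\<lambda>j. a j + z * c j"] bexI[of _ "\<lambda>j. b j - y * c j"]) auto
qed

lemma koszul_Syz:
  assumes "i < N" "j < N"
  shows "(\<lambda>l. D i * unit_row j l - D j * unit_row i l) \<in> Syz"
proof -
  have "(\<Sum>l<N. (D i * unit_row j l - D j * unit_row i l) * D l)
      = D i * (\<Sum>l<N. unit_row j l * D l) - D j * (\<Sum>l<N. unit_row i l * D l)"
    by (simp add: left_diff_distrib sum_subtractf sum_distrib_left mult.assoc)
  also have "\<dots> = 0"
    using assms by (simp add: unit_row_def if_distrib[of "\<lambda>x. x * _"] cong: if_cong)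
  finally show ?thesis using D_A assms by (auto simp: Syz_def unit_row_def)
qed

section \<open>Echelon form of the syzygies over the valuation ring modulo (y, z)\<close>

definition Lead where "Lead j = {v j |v. v \<in> Syz \<and> (\<forall>i<j. v i \<in> YZ)}"

lemma Lead_ideal:
  assumes "j < N"
  shows "ideal_of A (Lead j)"
  unfolding ideal_of_def
proof (intro conjI ballI subsetI)
  show "a \<in> A" if "a \<in> Lead j" for a
    using that assms by (auto simp: Lead_def Syz_def)
  show "0 \<in> Lead j"
    using submoduleD(2)[OF Syz_submodule] ideal_ofD(2)[OF YZ_ideal]
    by (auto simp: Lead_def intro!: exI[of _ "\<lambda>_. 0"])
  show "a + b \<in> Lead j" if ab: "a \<in> Lead j" "b \<in> Lead j" for a b
  proof -
    obtain v w where "v \<in> Syz" "w \<in> Syz" "\<forall>i<j. v i \<in> YZ" "\<forall>i<j. w i \<in> YZ" "a = v j" "b = w j"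
      using ab unfolding Lead_def by blast
    then show ?thesis
      unfolding Lead_def using submoduleD(3)[OF Syz_submodule] ideal_ofD(3)[OF YZ_ideal]
      by (intro CollectI exI[of _ "\<lambda>i. v i + w i"]) simp
  qed
  show "s * a \<in> Lead j" if sa: "s \<in> A" "a \<in> Lead j" for s a
  proof -
    obtain v where "v \<in> Syz" "\<forall>i<j. v i \<in> YZ" "a = v j"
      using sa unfolding Lead_def by blast
    then show ?thesis
      unfolding Lead_def using sa(1) submoduleD(4)[OF Syz_submodule] ideal_ofD(4)[OF YZ_ideal]
      by (intro CollectI exI[of _ "\<lambda>i. s * v i"]) simp
  qed
qed

text \<open>In a discrete valuation ring an element of least order divides all others.\<close>

lemma pivot_exists:
  assumes j: "j < N" and L: "\<not> Lead j \<subseteq> YZ"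
  shows "\<exists>p\<in>Lead j - YZ. \<forall>f\<in>Lead j. \<exists>c\<in>A. f - c * p \<in> YZ"
proof -
  define Q where "Q e \<longleftrightarrow> (\<exists>f u. f \<in> Lead j - YZ \<and> u \<in> A \<and> inverse u \<in> A \<and> u \<noteq> 0 \<and> f - u * x ^ e \<in> YZ)" for e
  have Lead_A: "f \<in> A" if "f \<in> Lead j" for f using that ideal_ofD(6)[OF Lead_ideal[OF j]] by blast
  obtain f0 where "f0 \<in> Lead j - YZ" using L by blast
  then have exQ: "\<exists>e. Q e" unfolding Q_def using order_mod_YZ[of f0] Lead_A by (metis DiffE)
  define e where "e = (LEAST e. Q e)"
  have "Q e" unfolding e_def using LeastI_ex[OF exQ] .
  then obtain p u where pu: "p \<in> Lead j - YZ" "u \<in> A" "inverse u \<in> A" "u \<noteq> 0" "p - u * x ^ e \<in> YZ"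
    unfolding Q_def by (elim exE conjE)
  have "\<exists>c\<in>A. f - c * p \<in> YZ" if f: "f \<in> Lead j" for f
  proof (cases "f \<in> YZ")
    case True
    then show ?thesis by (intro bexI[of _ 0]) auto
  next
    case False
    obtain e' u' where u': "u' \<in> A" "inverse u' \<in> A" "u' \<noteq> 0" "f - u' * x ^ e' \<in> YZ"
      using order_mod_YZ[OF Lead_A[OF f] False] .
    have "f \<in> Lead j - YZ" using f False by blast
    with u' have "Q e'" unfolding Q_def by (intro exI[of _ f] exI[of _ u'] conjI)
    then have "e \<le> e'" unfolding e_def by (rule Least_le)
    then have xe: "x ^ e' = x ^ (e' - e) * x ^ e" by (simp flip: power_add)
    \<comment> \<open>Modulo \<open>YZ\<close>, \<open>p\<close> is \<open>u * x ^ e\<close> and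
      \<open>f\<close> is \<open>u' * x ^ e'\<close>; this is their quotient.\<close>
    define c where "c = u' * inverse u * x ^ (e' - e)"
    have c: "c \<in> A" using u' pu yz_mem by (auto simp: c_def)
    have "f - c * p = (f - u' * x ^ e') - c * (p - u * x ^ e)"
      using pu(4) by (simp add: c_def xe algebra_simps)
    then have "f - c * p \<in> YZ"
      using ideal_diff[OF YZ_ideal u'(4) ideal_ofD(4)[OF YZ_ideal c pu(5)]] by metis
    then show ?thesis using c by blast
  qed
  with pu(1) show ?thesis by blast
qed

text \<open>The pivot columns. Echelon vectors are indexed by their pivots rather than
  consecutively, so that they can fill the rows of an N by N array as they stand.\<close>

definition E where "E = {j. j < N \<and> \<not> Lead j \<subseteq> YZ}"

lemma E_sub: "E \<subseteq> {..<N}" "finite E"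
  by (auto simp: E_def)

lemma echelon_exists:
  "\<exists>f. \<forall>j\<in>E. f j \<in> Syz \<and> (\<forall>i<j. f j i \<in> YZ) \<and> f j j \<notin> YZ \<and> (\<forall>g\<in>Lead j. \<exists>c\<in>A. g - c * f j j \<in> YZ)"
proof -
  have "\<forall>j\<in>E. \<exists>v. v \<in> Syz \<and> (\<forall>i<j. v i \<in> YZ) \<and> v j \<notin> YZ \<and> (\<forall>g\<in>Lead j. \<exists>c\<in>A. g - c * v j \<in> YZ)"
  proof
    fix j assume "j \<in> E"
    then obtain p where p: "p \<in> Lead j" "p \<notin> YZ" "\<forall>g\<in>Lead j. \<exists>c\<in>A. g - c * p \<in> YZ"
      using pivot_exists unfolding E_def by blast
    from p(1) obtain v where "v \<in> Syz" "\<forall>i<j. v i \<in> YZ" "p = v j" unfolding Lead_def by blast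
    with p(2,3) show "\<exists>v. v \<in> Syz \<and> (\<forall>i<j. v i \<in> YZ) \<and> v j \<notin> YZ \<and> (\<forall>g\<in>Lead j. \<exists>c\<in>A. g - c * v j \<in> YZ)"
      by blast
  qed
  then show ?thesis by (rule bchoice)
qed

definition ech where "ech = (SOME f. \<forall>j\<in>E. f j \<in> Syz \<and> (\<forall>i<j. f j i \<in> YZ) \<and> f j j \<notin> YZ \<and>
  (\<forall>g\<in>Lead j. \<exists>c\<in>A. g - c * f j j \<in> YZ))"

lemma ech:
  assumes "j \<in> E"
  shows "ech j \<in> Syz" "i < j \<Longrightarrow> ech j i \<in> YZ" "ech j j \<notin> YZ"
    "g \<in> Lead j \<Longrightarrow> \<exists>c\<in>A. g - c * ech j j \<in> YZ"
  using someI_ex[OF echelon_exists] assms unfolding ech_def[symmetric] by blast+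

lemma ech_A: "j \<in> E \<Longrightarrow> i < N \<Longrightarrow> ech j i \<in> A"
  using submoduleD(1)[OF Syz_submodule ech(1)] .

text \<open>Gaussian elimination from the left: subtracting a multiple of the vector with pivot
  \<open>n\<close> leaves the columns before \<open>n\<close> unchanged modulo
  \<open>YZ\<close>.\<close>

lemma reduce_mod_YZ:
  assumes "v \<in> Syz" "n \<le> N"
  shows "\<exists>c. (\<forall>l\<in>E. c l \<in> A) \<and> (\<forall>i<n. v i - (\<Sum>l\<in>E. c l * ech l i) \<in> YZ)"
  using assms(2)
proof (induction n)
  case 0
  then show ?case by (intro exI[of _ "\<lambda>_. 0"]) auto
next
  case (Suc n)
  then obtain c where c: "\<forall>l\<in>E. c l \<in> A" "\<forall>i<n. v i - (\<Sum>l\<in>E. c l * ech l i) \<in> YZ" by auto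
  define w where "w i = v i - (\<Sum>l\<in>E. c l * ech l i)" for i
  have "w \<in> Syz"
    unfolding w_def by (rule submodule_diff_sum[OF Syz_submodule E_sub(2)]) (use c ech assms in auto)
  moreover have "\<forall>i<n. w i \<in> YZ" using c(2) by (simp add: w_def)
  ultimately have wL: "w n \<in> Lead n" unfolding Lead_def by blast
  show ?case
  proof (cases "n \<in> E")
    case False
    then have "w n \<in> YZ" using wL Suc.prems by (auto simp: E_def)
    then show ?thesis using c by (intro exI[of _ c]) (auto simp: less_Suc_eq w_def)
  next
    case True
    then obtain d where d: "d \<in> A" "w n - d * ech n n \<in> YZ" using ech(4) wL by blast
    define c' where "c' l = c l + (if l = n then d else 0)" for l
    have "v i - (\<Sum>l\<in>E. c' l * ech l i) = w i - d * ech n i" for i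
    proof -
      have "(\<Sum>l\<in>E. c' l * ech l i) = (\<Sum>l\<in>E. c l * ech l i) + (\<Sum>l\<in>E. if l = n then d * ech n i else 0)"
        unfolding sum.distrib[symmetric] by (intro sum.cong) (auto simp: c'_def algebra_simps)
      then show ?thesis using True E_sub by (simp add: w_def)
    qed
    moreover have "w i - d * ech n i \<in> YZ" if "i < Suc n" for i
    proof (cases "i = n")
      case False
      then have "w i \<in> YZ" "ech n i \<in> YZ" using that c(2) ech(2)[OF True, of i] by (auto simp: w_def)
      then show ?thesis using d(1) ideal_diff[OF YZ_ideal] ideal_ofD(4)[OF YZ_ideal] by blast
    qed (use d in simp)
    ultimately show ?thesis using c(1) d(1) by (intro exI[of _ c']) (auto simp: c'_def)
  qed
qed

text \<open>In column \<open>l\<close> the vectors with later pivots vanish modulo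
  \<open>YZ\<close>, and those with earlier pivots have coefficients in \<open>YZ\<close> by
  induction. Only \<open>c l * ech l l\<close> remains, with a pivot outside the prime.\<close>

lemma independent_mod_YZ:
  assumes c: "\<And>l. l \<in> E \<Longrightarrow> c l \<in> A" and rel: "\<And>i. i < N \<Longrightarrow> (\<Sum>l\<in>E. c l * ech l i) \<in> YZ"
  shows "l \<in> E \<Longrightarrow> c l \<in> YZ"
proof (induction l rule: less_induct)
  case (less l)
  then have l: "l < N" using E_sub by auto
  have "(\<Sum>k\<in>E - {l}. c k * ech k l) \<in> YZ"
  proof (rule ideal_of_sum[OF YZ_ideal])
    fix k assume k: "k \<in> E - {l}"
    then consider "k < l" | "l < k" by fastforce
    then show "c k * ech k l \<in> YZ"
      by cases (use k less.IH c ech_A l ech(2)[of k l] ideal_ofD(4,5)[OF YZ_ideal] in auto)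
  qed
  moreover have "(\<Sum>k\<in>E. c k * ech k l) = c l * ech l l + (\<Sum>k\<in>E - {l}. c k * ech k l)"
    using less.prems E_sub(2) by (simp add: sum.remove)
  ultimately have "c l * ech l l \<in> YZ"
    using rel[OF l] ideal_add_cancel[OF YZ_ideal] by metis
  then show ?case
    using prime_ofD(3)[OF YZ_prime c[OF less.prems] ech_A[OF less.prems l]] ech(3)[OF less.prems] by blast
qed

text \<open>Being a syzygy basis modulo \<open>(y, z)\<close> lifts first to \<open>A/(y)\<close> and then to \<open>A\<close>, each time by
  applying Nakayama's lemma to the ideal of all \<open>l\<close>-th coefficients of relations.\<close>

lemma relation_ideal:
  assumes B: "ideal_of A B" and l: "l \<in> E"
  shows "ideal_of A {c l |c. (\<forall>k\<in>E. c k \<in> A) \<and> (\<forall>i<N. (\<Sum>k\<in>E. c k * ech k i) \<in> B)}" (is "ideal_of A ?C")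
  unfolding ideal_of_def
proof (intro conjI ballI subsetI)
  show "a \<in> A" if "a \<in> ?C" for a using that l by auto
  show "0 \<in> ?C" using ideal_ofD(2)[OF B] by (auto intro!: exI[of _ "\<lambda>_. 0"])
  fix a b assume "a \<in> ?C" "b \<in> ?C"
  then obtain c d where "\<forall>k\<in>E. c k \<in> A" "\<forall>k\<in>E. d k \<in> A" "a = c l" "b = d l"
    "\<forall>i<N. (\<Sum>k\<in>E. c k * ech k i) \<in> B" "\<forall>i<N. (\<Sum>k\<in>E. d k * ech k i) \<in> B" by blast
  then show "a + b \<in> ?C"
    by (auto intro!: exI[of _ "\<lambda>k. c k + d k"] ideal_ofD(3)[OF B] simp: distrib_right sum.distrib)
next
  fix s a assume "s \<in> A" "a \<in> ?C"
  then obtain c where "\<forall>k\<in>E. c k \<in> A" "a = c l" "\<forall>i<N. (\<Sum>k\<in>E. c k * ech k i) \<in> B" by blast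
  then show "s * a \<in> ?C"
    using \<open>s \<in> A\<close>
    by (auto intro!: exI[of _ "\<lambda>k. s * c k"] ideal_ofD(4)[OF B] simp: mult.assoc simp flip: sum_distrib_left)
qed

lemma y_ideal: "ideal_of A {y * a |a. a \<in> A}"
  unfolding ideal_of_def
proof (intro conjI ballI subsetI)
  show "a + b \<in> {y * a |a. a \<in> A}" if "a \<in> {y * a |a. a \<in> A}" "b \<in> {y * a |a. a \<in> A}" for a b
    using that by (auto simp flip: distrib_left)
  show "s * a \<in> {y * a |a. a \<in> A}" if "s \<in> A" "a \<in> {y * a |a. a \<in> A}" for s a
  proof -
    from that obtain b where "b \<in> A" "a = y * b" by blast
    then show ?thesis using that(1) by (auto intro!: exI[of _ "s * b"] simp: algebra_simps)
  qed
qed (use yz_mem in \<open>auto intro: exI[of _ 0]\<close>)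

lemma independent_mod_y:
  assumes "\<And>l. l \<in> E \<Longrightarrow> c l \<in> A" and "\<And>i. i < N \<Longrightarrow> (\<Sum>l\<in>E. c l * ech l i) \<in> {y * a |a. a \<in> A}"
    and l: "l \<in> E"
  shows "c l \<in> {y * a |a. a \<in> A}"
proof -
  define B where "B = {y * a |a. a \<in> A}"
  define C where "C = {c l |c. (\<forall>k\<in>E. c k \<in> A) \<and> (\<forall>i<N. (\<Sum>k\<in>E. c k * ech k i) \<in> B)}"
  have B: "ideal_of A B" using y_ideal by (simp add: B_def)
  have "B \<subseteq> YZ"
  proof
    fix b assume "b \<in> B"
    then obtain a where "a \<in> A" "b = y * a" by (auto simp: B_def)
    then have "b = a * y + 0 * z" by simp
    then show "b \<in> YZ" unfolding YZ_def using \<open>a \<in> A\<close> by blast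
  qed
  have "C \<subseteq> B"
  proof (rule nakayama_ideal[OF _ B z])
    show "ideal_of A C" unfolding C_def by (rule relation_ideal[OF B l])
    fix e assume "e \<in> C"
    then obtain c where c: "\<forall>k\<in>E. c k \<in> A" "\<forall>i<N. (\<Sum>k\<in>E. c k * ech k i) \<in> B" "e = c l"
      unfolding C_def by blast
    have "\<forall>k\<in>E. c k \<in> YZ" using independent_mod_YZ[of c] c \<open>B \<subseteq> YZ\<close> by blast
    then have "\<forall>k. \<exists>a b. k \<in> E \<longrightarrow> a \<in> A \<and> b \<in> A \<and> c k = a * y + b * z" unfolding YZ_def by blast
    then obtain a b where ab: "\<And>k. k \<in> E \<Longrightarrow> a k \<in> A \<and> b k \<in> A \<and> c k = a k * y + b k * z" by metis
    \<comment> \<open>Modulo \<open>y\<close> only the \<open>z\<close> part of the relation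
      survives, and \<open>z\<close> cancels by regularity. So the \<open>b k\<close> are again
      coefficients of a relation modulo \<open>y\<close>.\<close>
    have "(\<Sum>k\<in>E. b k * ech k i) \<in> B" if i: "i < N" for i
    proof -
      have m: "(\<Sum>k\<in>E. a k * ech k i) \<in> A" "(\<Sum>k\<in>E. b k * ech k i) \<in> A"
        using ab ech_A i by (simp_all add: sum mult)
      have "(\<Sum>k\<in>E. c k * ech k i) = y * (\<Sum>k\<in>E. a k * ech k i) + z * (\<Sum>k\<in>E. b k * ech k i)"
        unfolding sum_distrib_left sum.distrib[symmetric]
        by (intro sum.cong) (auto simp: ab algebra_simps)
      moreover obtain r where "r \<in> A" "(\<Sum>k\<in>E. c k * ech k i) = y * r" using c(2) i by (auto simp: B_def)
      ultimately have "z * (\<Sum>k\<in>E. b k * ech k i) = y * (r - (\<Sum>k\<in>E. a k * ech k i))"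
        by (simp add: algebra_simps)
      from z_regular[OF m(2) _ this] show ?thesis using \<open>r \<in> A\<close> m(1) by (auto simp: B_def)
    qed
    then have "b l \<in> C" using ab unfolding C_def by blast
    moreover have "a l * y \<in> B" using ab[OF l] by (auto simp: B_def mult.commute)
    ultimately show "\<exists>b\<in>B. \<exists>c'\<in>C. e = b + z * c'"
      using ab[OF l] c(3) by (intro bexI[of _ "a l * y"] bexI[of _ "b l"]) (auto simp: mult.commute)
  qed
  moreover have "c l \<in> C" using assms unfolding C_def B_def by blast
  ultimately show ?thesis unfolding B_def by blast
qed

lemma independent:
  assumes "\<And>l. l \<in> E \<Longrightarrow> c l \<in> A" and "\<And>i. i < N \<Longrightarrow> (\<Sum>l\<in>E. c l * ech l i) = 0" and l: "l \<in> E"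
  shows "c l = 0"
proof -
  define C where "C = {c l |c. (\<forall>k\<in>E. c k \<in> A) \<and> (\<forall>i<N. (\<Sum>k\<in>E. c k * ech k i) \<in> {0})}"
  have Z: "ideal_of A {0}" by (auto simp: ideal_of_def)
  have "C \<subseteq> {0}"
  proof (rule nakayama_ideal[OF _ Z y])
    show "ideal_of A C" unfolding C_def by (rule relation_ideal[OF Z l])
    fix e assume "e \<in> C"
    then obtain c where c: "\<forall>k\<in>E. c k \<in> A" "\<forall>i<N. (\<Sum>k\<in>E. c k * ech k i) = 0" "e = c l"
      unfolding C_def by blast
    have "0 \<in> {y * a |a. a \<in> A}" using ideal_ofD(2)[OF y_ideal] .
    then have "\<forall>k\<in>E. c k \<in> {y * a |a. a \<in> A}"
      using independent_mod_y[of c] c by simp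
    then have "\<forall>k. \<exists>a. k \<in> E \<longrightarrow> a \<in> A \<and> c k = y * a" by blast
    then obtain a where a: "\<And>k. k \<in> E \<Longrightarrow> a k \<in> A \<and> c k = y * a k" by metis
    have "(\<Sum>k\<in>E. a k * ech k i) = 0" if "i < N" for i
    proof -
      have "y * (\<Sum>k\<in>E. a k * ech k i) = (\<Sum>k\<in>E. c k * ech k i)"
        unfolding sum_distrib_left by (intro sum.cong) (auto simp: a algebra_simps)
      then show ?thesis using c(2) that y_nonzero by simp
    qed
    then have "a l \<in> C" using a unfolding C_def by blast
    then show "\<exists>b\<in>{0}. \<exists>c'\<in>C. e = b + y * c'" using a[OF l] c(3) by auto
  qed
  moreover have "c l \<in> C" using assms unfolding C_def by blast
  ultimately show ?thesis by blast
qed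

text \<open>Elimination modulo \<open>YZ\<close> leaves a syzygy with entries in \<open>YZ\<close>,
  which by \<open>Syz_YZ\<close> is a combination of syzygies with the coefficients \<open>y\<close>
  and \<open>z\<close> from \<open>M\<close>. Nakayama's lemma applies, and together with
  \<open>independent\<close> the echelon vectors form a basis.\<close>

lemma generates:
  assumes "v \<in> Syz"
  shows "\<exists>c. (\<forall>l\<in>E. c l \<in> A) \<and> (\<forall>i<N. v i = (\<Sum>l\<in>E. c l * ech l i))"
proof -
  \<comment> \<open>Zero vectors at the indices outside \<open>E\<close> make the generators a
    family over an initial segment.\<close>
  define h where "h l = (if l \<in> E then ech l else (\<lambda>_. 0))" for l
  have hsum: "(\<Sum>l<N. c l * h l i) = (\<Sum>l\<in>E. c l * ech l i)" for c i
    by (rule sum.mono_neutral_cong_right) (use E_sub in \<open>auto simp: h_def\<close>)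
  have "Syz \<subseteq> vspan N h N"
  proof (rule nakayama[OF Syz_submodule])
    fix v assume v: "v \<in> Syz"
    then obtain c where c: "\<forall>l\<in>E. c l \<in> A" "\<forall>i<N. v i - (\<Sum>l\<in>E. c l * ech l i) \<in> YZ"
      using reduce_mod_YZ by blast
    define w where "w i = v i - (\<Sum>l\<in>E. c l * ech l i)" for i
    have "w \<in> Syz"
      unfolding w_def by (rule submodule_diff_sum[OF Syz_submodule E_sub(2)]) (use c ech v in auto)
    then obtain a b where ab: "a \<in> Syz" "b \<in> Syz" "\<forall>j<N. w j = y * a j + z * b j"
      using Syz_YZ[of w] c(2) by (auto simp: w_def)
    define c' b' k where "c' = (\<lambda>l. if l \<in> E then c l else 0)"
      and "b' = (\<lambda>i::nat. if i = 0 then y else z)" and "k = (\<lambda>i::nat. if i = 0 then a else b)"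
    have "(\<Sum>l\<in>E. c' l * ech l j) = (\<Sum>l\<in>E. c l * ech l j)" for j by (auto simp: c'_def)
    moreover have "(\<Sum>i<2. b' i * k i j) = y * a j + z * b j" for j
      by (simp add: b'_def k_def numeral_2_eq_2)
    ultimately have "v j = (\<Sum>i<N. c' i * h i j) + (\<Sum>i<2. b' i * k i j)" if "j < N" for j
      using ab(3) that by (simp add: hsum w_def diff_eq_eq add.commute)
    moreover have "\<forall>i<N. c' i \<in> A" "\<forall>i<2. b' i \<in> M \<and> k i \<in> Syz"
      using c(1) ab(1,2) y z by (auto simp: c'_def b'_def k_def)
    ultimately show "\<exists>a t b k. (\<forall>i<N. a i \<in> A) \<and> (\<forall>i<t. b i \<in> M \<and> k i \<in> Syz) \<and>
      (\<forall>j<N. v j = (\<Sum>i<N. a i * h i j) + (\<Sum>i<(t::nat). b i * k i j))"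
      by (intro exI[of _ c'] exI[of _ 2] exI[of _ b'] exI[of _ k]) auto
  qed
  then obtain c where "\<forall>i<N. c i \<in> A" "\<forall>j<N. v j = (\<Sum>i<N. c i * h i j)"
    using assms unfolding vspan_def by blast
  then show ?thesis using E_sub by (intro exI[of _ c]) (auto simp: hsum)
qed

end

lemma sum_combination_pairing:
  "(\<Sum>i\<in>I. (\<Sum>l\<in>B. c l * k l i) * w i) = (\<Sum>l\<in>B. c l * (\<Sum>i\<in>I. k l i * w i :: 'a::comm_ring_1))"
proof -
  have "(\<Sum>i\<in>I. (\<Sum>l\<in>B. c l * k l i) * w i) = (\<Sum>i\<in>I. \<Sum>l\<in>B. c l * (k l i * w i))"
    by (simp add: sum_distrib_right mult.assoc)
  also have "\<dots> = (\<Sum>l\<in>B. c l * (\<Sum>i\<in>I. k l i * w i))"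
    by (subst sum.swap) (simp add: sum_distrib_left)
  finally show ?thesis .
qed

context local_domain
begin

text \<open>Kernel vectors of singular matrices are found over the field and have to be moved into
  the ring. The assumption \<open>fractions\<close> serves this purpose.\<close>

lemma common_denominator: "\<exists>s\<in>A. s \<noteq> 0 \<and> (\<forall>j<(n::nat). s * v j \<in> A)"
proof (induction n)
  case (Suc n)
  then obtain s where s: "s \<in> A" "s \<noteq> 0" "\<forall>j<n. s * v j \<in> A" by blast
  obtain t where t: "t \<in> A" "t \<noteq> 0" "t * v n \<in> A" using fractions by blast
  have "t * s * v j \<in> A" if "j < Suc n" for j
  proof (cases "j = n")
    case True
    then show ?thesis using mult[OF s(1) t(3)] by (simp add: ac_simps)
  next
    case False
    then show ?thesis using mult[OF t(1), of "s * v j"] s(3) that by (simp add: mult.assoc)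
  qed
  then show ?case using s t by (intro bexI[of _ "t * s"]) auto
qed (auto intro!: bexI[of _ 1])

end

section \<open>Rank of the syzygies and the Hilbert-Burch theorem\<close>

context height_two_prime
begin

lemma D_nonzero: "\<exists>i<N. D i \<noteq> 0"
proof (rule ccontr)
  assume "\<not> ?thesis"
  then have "J = lin_span A 0 D"
    unfolding J_generated lin_span_def by (auto intro!: exI[of _ "\<lambda>_. 0"])
  then show False using J_minimal[of 0] N_ge_2 by auto
qed

text \<open>The syzygies have rank N - 1. There cannot be N independent ones because all are
  orthogonal to the nonzero vector \<open>D\<close>; with two pivots missing, too many vectors would
  be orthogonal to all syzygies, which the Koszul syzygies forbid.\<close>

lemma E_complement: "\<exists>e. {..<N} - E = {e}"
proof -
  obtain i0 where i0: "i0 < N" "D i0 \<noteq> 0" using D_nonzero by blast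
  have "E \<noteq> {..<N}"
  proof
    assume E: "E = {..<N}"
    have "(\<Sum>j<N. ech i j * D j) = 0" if "i < N" for i using ech(1)[of i] E that by (auto simp: Syz_def)
    moreover have "\<exists>j<N. D j \<noteq> 0" using i0 by blast
    ultimately have "dt N ech = 0" unfolding dt_zero_iff_kernel by (intro exI[of _ D] conjI allI impI)
    then have "dt N (\<lambda>i j. ech j i) = 0" using dt_transpose[of N ech] by simp
    then obtain v j where v: "j < N" "v j \<noteq> 0" "\<forall>i<N. (\<Sum>j<N. ech j i * v j) = 0"
      using dt_zero_iff_kernel[of N "\<lambda>i j. ech j i"] by blast
    obtain s where s: "s \<in> A" "s \<noteq> 0" "\<forall>j<N. s * v j \<in> A" using common_denominator by blast
    have "s * v j = 0"
    proof (rule independent[of "\<lambda>j. s * v j"])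
      show "(\<Sum>l\<in>E. s * v l * ech l i) = 0" if "i < N" for i
      proof -
        have "(\<Sum>l\<in>E. s * v l * ech l i) = s * (\<Sum>j<N. ech j i * v j)"
          unfolding sum_distrib_left E by (intro sum.cong) (auto simp: ac_simps)
        then show ?thesis using v(3) that by simp
      qed
    qed (use s v E in auto)
    then show False using s v by simp
  qed
  moreover have "e1 = e2" if e: "e1 \<in> {..<N} - E" "e2 \<in> {..<N} - E" for e1 e2
  proof (rule ccontr)
    assume ne: "e1 \<noteq> e2"
    \<comment> \<open>Row \<open>e2\<close> is zero, so the array is singular, and row
      \<open>e1\<close> forces entry \<open>i0\<close> of a kernel vector \<open>w\<close> to
      vanish. The Koszul syzygy of \<open>i0\<close> and \<open>j\<close> then gives
      \<open>D i0 * w j = 0\<close>.\<close>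
    define f where "f l = (if l = e1 then unit_row i0 else if l \<in> E then ech l else (\<lambda>_. 0))" for l
    have "f(e2 := (\<lambda>_. 0)) = f" using e ne by (auto simp: f_def fun_eq_iff)
    then have "dt N f = 0" using dt_expand_row[of e2 N f "\<lambda>_. 0"] e by simp
    then obtain w j where w: "j < N" "w j \<noteq> 0" "\<And>i. i < N \<Longrightarrow> (\<Sum>j<N. f i j * w j) = 0"
      using dt_zero_iff_kernel[of N f] by blast
    have wi0: "w i0 = 0"
      using w(3)[of e1] e i0 by (simp add: f_def unit_row_def if_distrib[of "\<lambda>x. x * _"] cong: if_cong)
    have orth: "(\<Sum>i<N. v i * w i) = 0" if "v \<in> Syz" for v
    proof -
      from generates[OF that] obtain c
        where c: "\<forall>i<N. v i = (\<Sum>l\<in>E. c l * ech l i)" by (elim exE conjE)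
      have "(\<Sum>i<N. v i * w i) = (\<Sum>l\<in>E. c l * (\<Sum>i<N. ech l i * w i))"
        unfolding sum_combination_pairing[symmetric] using c by (intro sum.cong) auto
      also have "\<dots> = 0"
      proof (intro sum.neutral ballI)
        fix l assume l: "l \<in> E"
        then have "l < N" "l \<noteq> e1" using E_sub e by auto
        with l show "c l * (\<Sum>i<N. ech l i * w i) = 0" using w(3)[of l] by (simp add: f_def)
      qed
      finally show ?thesis .
    qed
    have "(\<Sum>l<N. (D i0 * unit_row j l - D j * unit_row i0 l) * w l) = D i0 * w j - D j * w i0"
      using w(1) i0(1)
      by (simp add: left_diff_distrib sum_subtractf mult.assoc unit_row_def if_distrib[of "\<lambda>x. x * _"]
          cong: if_cong flip: sum_distrib_left)
    then show False using orth[OF koszul_Syz[OF i0(1) w(1)]] wi0 i0 w by simp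
  qed
  ultimately show ?thesis using E_sub(1) by (metis Diff_eq_empty_iff is_singletonI' is_singleton_def subset_antisym)
qed

text \<open>Moves the one index without basis vector to a prescribed place \<open>r\<close>, the row
  into which unit vectors are inserted to form the minors.\<close>

lemma syzygy_basis:
  assumes r: "r < N"
  defines "B \<equiv> {..<N} - {r}"
  shows "\<exists>k. (\<forall>l\<in>B. k l \<in> Syz) \<and>
    (\<forall>v\<in>Syz. \<exists>c. (\<forall>l\<in>B. c l \<in> A) \<and> (\<forall>i<N. v i = (\<Sum>l\<in>B. c l * k l i))) \<and>
    (\<forall>c. (\<forall>l\<in>B. c l \<in> A) \<longrightarrow> (\<forall>i<N. (\<Sum>l\<in>B. c l * k l i) = 0) \<longrightarrow> (\<forall>l\<in>B. c l = 0))"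
proof -
  obtain e where e: "{..<N} - E = {e}" using E_complement by blast
  define s where "s = transpose e r"
  have ss: "s (s l) = l" for l by (simp add: s_def)
  have eN: "e < N" "e \<notin> E" and E_eq: "E = {..<N} - {e}" using e E_sub by auto
  have B_E: "s l \<in> E" if "l \<in> B" for l
    using that r eN unfolding B_def E_eq s_def by (auto simp: transpose_def)
  have E_B: "s l \<in> B" if "l \<in> E" for l
    using that r eN unfolding B_def E_eq s_def by (auto simp: transpose_def)
  have bij: "bij_betw s B E"
    by (rule bij_betw_byWitness[of _ s]) (use ss B_E E_B in auto)
  have sum_B: "(\<Sum>l\<in>B. c l * ech (s l) i) = (\<Sum>l\<in>E. c (s l) * ech l i)" for c i
    using sum.reindex_bij_betw[OF bij, of "\<lambda>l. c (s l) * ech l i"] by (simp add: ss)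
  show ?thesis
  proof (intro exI[of _ "\<lambda>l. ech (s l)"] conjI ballI allI impI)
    show "ech (s l) \<in> Syz" if "l \<in> B" for l using ech(1) B_E that by blast
    show "\<exists>c. (\<forall>l\<in>B. c l \<in> A) \<and> (\<forall>i<N. v i = (\<Sum>l\<in>B. c l * ech (s l) i))" if "v \<in> Syz" for v
    proof -
      from generates[OF that] obtain c
        where c: "\<forall>l\<in>E. c l \<in> A" "\<forall>i<N. v i = (\<Sum>l\<in>E. c l * ech l i)" by (elim exE conjE)
      then show ?thesis using B_E
        by (intro exI[of _ "\<lambda>l. c (s l)"]) (auto simp: sum_B[of "\<lambda>l. c (s l)"] ss)
    qed
    show "c l = 0" if "\<forall>l\<in>B. c l \<in> A" "\<forall>i<N. (\<Sum>l\<in>B. c l * ech (s l) i) = 0" "l \<in> B" for c l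
      using independent[of "\<lambda>l. c (s l)" "s l"] that E_B B_E by (simp add: sum_B ss)
  qed
qed

text \<open>McCoy's theorem for a basis of the syzygies. The basis vectors among the rows are traded one by
  one for arbitrary vectors: by Cramer's rule the determinant times the removed basis vector is a
  combination of the rows, and the syzygy module is saturated.\<close>

lemma minors_divisible:
  assumes r: "r < N"
  defines "B \<equiv> {..<N} - {r}"
  assumes k0: "\<forall>l\<in>B. k l \<in> Syz"
    and gen0: "\<forall>v\<in>Syz. \<exists>c. (\<forall>l\<in>B. c l \<in> A) \<and> (\<forall>i<N. v i = (\<Sum>l\<in>B. c l * k l i))"
    and indep: "\<forall>c. (\<forall>l\<in>B. c l \<in> A) \<longrightarrow> (\<forall>i<N. (\<Sum>l\<in>B. c l * k l i) = 0) \<longrightarrow> (\<forall>l\<in>B. c l = 0)"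
    and t: "t \<in> A" and q: "q \<in> A" "q \<noteq> 0"
    and div: "\<And>i. i < N \<Longrightarrow> \<exists>a\<in>A. t * dt N (k(r := unit_row i)) = q * a"
  shows "\<exists>a\<in>A. t = q * a"
proof -
  note k = bspec[OF k0] and gen = bspec[OF gen0]
  have kA: "k l j \<in> A" if "l \<in> B" "j < N" for l j
    using submoduleD(1)[OF Syz_submodule k[OF that(1)] that(2)] .
  \<comment> \<open>\<open>C\<close> is the set of basis rows already traded for arbitrary vectors.
    For empty \<open>C\<close> the hypothesis is expanded along row \<open>r\<close>; for
    \<open>C = B\<close> with unit vectors the determinant is 1.\<close>
  have "\<exists>a\<in>A. t * dt N (\<lambda>l. if l \<in> B - C then k l else u l) = q * a"
    if "finite C" "C \<subseteq> B" "\<And>l j. l < N \<Longrightarrow> j < N \<Longrightarrow> u l j \<in> A" for C u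
    using that
  proof (induction C arbitrary: u rule: finite_induct)
    case empty
    from div have "\<forall>i. \<exists>a. i < N \<longrightarrow> a \<in> A \<and> t * dt N (k(r := unit_row i)) = q * a" by blast
    then obtain a where a: "\<And>i. i < N \<Longrightarrow> a i \<in> A \<and> t * dt N (k(r := unit_row i)) = q * a i" by metis
    have "dt N (\<lambda>l. if l \<in> B - {} then k l else u l) = dt N (k(r := u r))"
      by (rule dt_cong) (auto simp: B_def)
    also have "\<dots> = (\<Sum>j<N. u r j * dt N (k(r := unit_row j)))" by (rule dt_expand_row[OF r])
    finally have "t * dt N (\<lambda>l. if l \<in> B - {} then k l else u l)
        = (\<Sum>j<N. u r j * (t * dt N (k(r := unit_row j))))"
      by (simp add: sum_distrib_left ac_simps)
    also have "\<dots> = q * (\<Sum>j<N. u r j * a j)"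
      unfolding sum_distrib_left by (intro sum.cong) (auto simp: a)
    finally show ?case
      using a empty.prems(2)[OF r] by (intro bexI[of _ "\<Sum>j<N. u r j * a j"]) (auto intro: sum mult)
  next
    case (insert \<rho> C)
    define R where "R = B - insert \<rho> C"
    have \<rho>: "\<rho> \<in> B" "\<rho> < N" "\<rho> \<notin> R" and BC: "B - C = insert \<rho> R"
      using insert by (auto simp: R_def B_def)
    define F where "F l = (if l \<in> R then k l else u l)" for l
    define g where "g i = dt N (F(i := k \<rho>))" for i
    have FA: "F l j \<in> A" if "l < N" "j < N" for l j
      using that kA insert.prems by (auto simp: F_def R_def)
    have gA: "g i \<in> A" for i
      unfolding g_def by (rule dt_mem) (use FA kA \<rho> in auto)
    have cr: "dt N F * k \<rho> j = (\<Sum>i<N. g i * F i j)" if "j < N" for j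
      unfolding g_def by (rule dt_cramer[OF that])
    \<comment> \<open>The row \<open>i\<close> outside \<open>R\<close> is arbitrary. If it holds
      \<open>k \<rho>\<close>, a swap returns \<open>k \<rho>\<close> to its own place, and the
      induction hypothesis applies with the vector \<open>u \<rho>\<close> in row
      \<open>i\<close>.\<close>
    have "\<exists>a\<in>A. t * g i = q * a" if i: "i < N" "i \<notin> R" for i
    proof (cases "i = \<rho>")
      case True
      have "F(i := k \<rho>) = (\<lambda>l. if l \<in> B - C then k l else u l)"
        unfolding BC True by (auto simp: F_def)
      then show ?thesis unfolding g_def using insert.IH[of u] insert.prems by simp
    next
      case False
      define G where "G l = (if l \<in> B - C then k l else (u(i := u \<rho>)) l)" for l
      have "F(i := k \<rho>) = G(i := G \<rho>, \<rho> := G i)"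
        unfolding G_def BC using False i(2) \<rho>(3) by (auto simp: F_def fun_eq_iff)
      then have "g i = - dt N G" unfolding g_def using dt_swap_rows[OF i(1) \<rho>(2) False] by metis
      moreover have "(u(i := u \<rho>)) l j \<in> A" if "l < N" "j < N" for l j
        using insert.prems(2) \<rho>(2) that by auto
      then have "\<exists>a\<in>A. t * dt N G = q * a"
        unfolding G_def using insert.IH[of "u(i := u \<rho>)"] insert.prems(1) by blast
      then obtain a where "a \<in> A" "t * dt N G = q * a" by blast
      ultimately show ?thesis by (intro bexI[of _ "- a"]) auto
    qed
    then have "\<forall>i. \<exists>a. i < N \<and> i \<notin> R \<longrightarrow> a \<in> A \<and> t * g i = q * a" by blast
    then obtain a where a: "\<And>i. i < N \<Longrightarrow> i \<notin> R \<Longrightarrow> a i \<in> A \<and> t * g i = q * a i" by metis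
    define w where "w j = (\<Sum>i\<in>{..<N} - R. a i * F i j)" for j
    have R_sub: "R \<subseteq> {..<N}" "R \<subseteq> B" "finite R" "finite B" by (auto simp: R_def B_def)
    have qw: "q * w j = t * dt N F * k \<rho> j - (\<Sum>i\<in>R. t * g i * k i j)" if "j < N" for j
    proof -
      have "t * dt N F * k \<rho> j = (\<Sum>i<N. t * g i * F i j)"
        using cr[OF that] by (simp add: sum_distrib_left mult.assoc)
      also have "\<dots> = (\<Sum>i\<in>{..<N} - R. t * g i * F i j) + (\<Sum>i\<in>R. t * g i * F i j)"
        using R_sub by (intro sum.subset_diff) auto
      also have "(\<Sum>i\<in>{..<N} - R. t * g i * F i j) = q * w j"
        unfolding w_def sum_distrib_left by (intro sum.cong) (auto simp: a)
      also have "(\<Sum>i\<in>R. t * g i * F i j) = (\<Sum>i\<in>R. t * g i * k i j)"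
        by (intro sum.cong) (auto simp: F_def)
      finally show ?thesis by simp
    qed
    define qv where "qv j = t * dt N F * k \<rho> j - (\<Sum>i\<in>R. t * g i * k i j)" for j
    have dF: "dt N F \<in> A" by (rule dt_mem) (use FA in auto)
    have "qv \<in> Syz"
      unfolding qv_def
      by (rule submodule_diff_sum[OF Syz_submodule])
        (use R_sub k \<rho> t gA dF submoduleD(4)[OF Syz_submodule, of "t * dt N F" "k \<rho>"] in auto)
    then have "q * (\<Sum>j<N. w j * D j) = 0"
      using qw by (simp add: Syz_def qv_def sum_distrib_left mult.assoc flip: mult.assoc[of q])
    moreover have "w j \<in> A" if "j < N" for j
      unfolding w_def using a FA that by (intro sum mult) auto
    ultimately have "w \<in> Syz" using q by (simp add: Syz_def)
    from gen[OF this] obtain c where c: "\<forall>l\<in>B. c l \<in> A" "\<forall>i<N. w i = (\<Sum>l\<in>B. c l * k l i)"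
      by (elim exE conjE)
    \<comment> \<open>The coefficients of the difference of the two expressions for
      \<open>q * w\<close> in the basis. Independence at \<open>\<rho>\<close>, which is not in
      \<open>R\<close>, leaves \<open>t * dt N F = q * c \<rho>\<close>.\<close>
    define d where "d l = (if l = \<rho> then t * dt N F else 0) - (if l \<in> R then t * g l else 0) - q * c l" for l
    have "d \<rho> = 0"
    proof (rule indep[rule_format, OF _ _ \<rho>(1)])
      show "d l \<in> A" if "l \<in> B" for l using that t gA dF q c by (auto simp: d_def)
      fix i assume i: "i < N"
      have "(\<Sum>l\<in>B. d l * k l i) = (\<Sum>l\<in>B. if l = \<rho> then t * dt N F * k \<rho> i else 0)
          - (\<Sum>l\<in>B. if l \<in> R then t * g l * k l i else 0) - q * (\<Sum>l\<in>B. c l * k l i)"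
        unfolding sum_distrib_left sum_subtractf[symmetric]
        by (intro sum.cong) (auto simp: d_def algebra_simps)
      also have "(\<Sum>l\<in>B. if l = \<rho> then t * dt N F * k \<rho> i else 0) = t * dt N F * k \<rho> i"
        using \<rho> R_sub by simp
      also have "(\<Sum>l\<in>B. if l \<in> R then t * g l * k l i else 0) = (\<Sum>l\<in>R. t * g l * k l i)"
        using R_sub by (simp add: sum.inter_restrict[symmetric] Int_absorb1)
      also have "q * (\<Sum>l\<in>B. c l * k l i) = q * w i" using c i by simp
      finally show "(\<Sum>l\<in>B. d l * k l i) = 0" using qw[OF i] by simp
    qed
    then have "t * dt N F = q * c \<rho>" using \<rho> by (simp add: d_def)
    moreover have "F = (\<lambda>l. if l \<in> B - insert \<rho> C then k l else u l)" by (auto simp: F_def R_def)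
    ultimately show ?case using c \<rho> by auto
  qed
  from this[of B unit_row] have "\<exists>a\<in>A. t * dt N (\<lambda>l. if l \<in> B - B then k l else unit_row l) = q * a"
    by (auto simp: B_def unit_row_def)
  then show ?thesis by (simp add: dt_one)
qed

text \<open>The minors are orthogonal to all syzygies, and the Koszul syzygies make them
  proportional to the generators. \<open>minors_divisible\<close> shows that the factor
  \<open>c\<close> is in the ring. If \<open>c\<close> were in \<open>M\<close>, then either
  \<open>c\<close> is in \<open>J\<close> and generates it alone, or the minor
  \<open>\<delta> i0\<close> is in \<open>J\<close> and produces a syzygy with a unit entry; both
  contradict minimality.\<close>

theorem hilbert_burch:
  assumes r: "r < N"
  defines "B \<equiv> {..<N} - {r}"
  shows "\<exists>k. (\<forall>l\<in>B. \<forall>j<N. k l j \<in> M) \<and> J = lin_span A N (\<lambda>i. dt N (k(r := unit_row i))) \<and>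
    (\<forall>v. (\<forall>j<N. v j \<in> A) \<longrightarrow> (\<Sum>j<N. v j * dt N (k(r := unit_row j))) = 0 \<longrightarrow>
      (\<exists>c. (\<forall>l\<in>B. c l \<in> A) \<and> (\<forall>i<N. v i = (\<Sum>l\<in>B. c l * k l i))))"
proof -
  obtain k where k0: "\<forall>l\<in>B. k l \<in> Syz"
    "\<forall>v\<in>Syz. \<exists>c. (\<forall>l\<in>B. c l \<in> A) \<and> (\<forall>i<N. v i = (\<Sum>l\<in>B. c l * k l i))"
    "\<forall>c. (\<forall>l\<in>B. c l \<in> A) \<longrightarrow> (\<forall>i<N. (\<Sum>l\<in>B. c l * k l i) = 0) \<longrightarrow> (\<forall>l\<in>B. c l = 0)"
    using syzygy_basis[OF r, folded B_def] by (elim exE conjE)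
  have k: "\<And>l. l \<in> B \<Longrightarrow> k l \<in> Syz"
    "\<And>v. v \<in> Syz \<Longrightarrow> \<exists>c. (\<forall>l\<in>B. c l \<in> A) \<and> (\<forall>i<N. v i = (\<Sum>l\<in>B. c l * k l i))"
    "\<And>c l. (\<And>l. l \<in> B \<Longrightarrow> c l \<in> A) \<Longrightarrow> (\<And>i. i < N \<Longrightarrow> (\<Sum>l\<in>B. c l * k l i) = 0) \<Longrightarrow> l \<in> B \<Longrightarrow> c l = 0"
    using k0 by simp_all
  note div = minors_divisible[OF r k0[unfolded B_def]]
  define \<delta> where "\<delta> i = dt N (k(r := unit_row i))" for i
  have kM: "k l j \<in> M" if "l \<in> B" "j < N" for l j using Syz_M k(1) that by blast
  have \<delta>A: "\<delta> i \<in> A" for i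
    unfolding \<delta>_def by (rule dt_mem) (use kM M_sub in \<open>auto simp: unit_row_def B_def\<close>)
  have orth: "(\<Sum>m<N. v m * \<delta> m) = 0" if "v \<in> Syz" for v
  proof -
    from k(2)[OF that] obtain c where c: "\<forall>i<N. v i = (\<Sum>l\<in>B. c l * k l i)" by (elim exE conjE)
    have "(\<Sum>i<N. v i * \<delta> i) = (\<Sum>l\<in>B. c l * (\<Sum>i<N. k l i * \<delta> i))"
      unfolding sum_combination_pairing[symmetric] using c by (intro sum.cong) auto
    also have "\<dots> = 0"
      unfolding \<delta>_def using dt_cofactor_orthogonal[OF r] by (intro sum.neutral) (auto simp: B_def)
    finally show ?thesis .
  qed
  have propor: "D i * \<delta> j = D j * \<delta> i" if "i < N" "j < N" for i j
  proof -
    have "(\<Sum>l<N. (D i * unit_row j l - D j * unit_row i l) * \<delta> l) = D i * \<delta> j - D j * \<delta> i"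
      using that
      by (simp add: left_diff_distrib sum_subtractf mult.assoc unit_row_def if_distrib[of "\<lambda>x. x * _"]
          cong: if_cong flip: sum_distrib_left)
    then show ?thesis using orth[OF koszul_Syz[OF that]] by simp
  qed
  obtain i0 where i0: "i0 < N" "D i0 \<noteq> 0" using D_nonzero by blast
  have "\<delta> i0 \<noteq> 0"
  proof
    assume "\<delta> i0 = 0"
    then have "\<delta> i = 0" if "i < N" for i using propor[OF i0(1) that] i0 by simp
    \<comment> \<open>If all minors vanished, divisibility with t = 1 and q = y would make
      \<open>y\<close> a unit.\<close>
    then have "\<exists>a\<in>A. 1 = y * a"
      using div[of 1 y] yz_mem y_nonzero by (auto simp: \<delta>_def intro: bexI[of _ 0])
    then show False using ideal_ofD(5)[OF M_ideal _ y] one_notin_M by metis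
  qed
  have "\<exists>c\<in>A. D i0 = \<delta> i0 * c"
  proof (rule div)
    show "\<exists>a\<in>A. D i0 * dt N (k(r := unit_row i)) = \<delta> i0 * a" if "i < N" for i
      using propor[OF i0(1) that] D_A[OF that]
      by (intro bexI[of _ "D i"]) (simp_all add: \<delta>_def mult.commute)
  qed (use \<open>\<delta> i0 \<noteq> 0\<close> \<delta>A D_A i0 in auto)
  then obtain c where c: "c \<in> A" "D i0 = \<delta> i0 * c" by blast
  have Dc: "D i = c * \<delta> i" if "i < N" for i
    using propor[OF i0(1) that] c \<open>\<delta> i0 \<noteq> 0\<close> by (simp add: ac_simps)
  have "c \<notin> M"
  proof
    assume cM: "c \<in> M"
    show False
    proof (cases "c \<in> J")
      case True
      have "lin_span A 1 (\<lambda>_. c) \<subseteq> J" by (rule lin_span_least[OF J_ideal]) (use True in auto)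
      moreover have I: "ideal_of A (lin_span A 1 (\<lambda>_. c))" by (rule lin_span_ideal) (use c in auto)
      have "c \<in> lin_span A 1 (\<lambda>_. c)" using lin_span_gen[of 0 1 "\<lambda>_. c"] by simp
      then have "J \<subseteq> lin_span A 1 (\<lambda>_. c)"
        unfolding J_generated
        by (intro lin_span_least[OF I]) (use Dc \<delta>A ideal_ofD(5)[OF I] in auto)
      ultimately show False using J_minimal[of 1 "\<lambda>_. c"] N_ge_2 by auto
    next
      case False
      then have "\<delta> i0 \<in> J"
        using prime_ofD(3)[OF J_prime c(1) \<delta>A] Dc[OF i0(1)] D_mem[OF i0(1)] by auto
      then obtain e where e: "\<And>i. i < N \<Longrightarrow> e i \<in> A" "\<delta> i0 = (\<Sum>i<N. e i * D i)"
        unfolding J_generated by (metis lin_spanE)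
      \<comment> \<open>From \<open>D i0 = c * \<delta> i0\<close> and the expression of
        \<open>\<delta> i0\<close> by the generators. Entry \<open>i0\<close> is
        \<open>1 - c * e i0\<close>, a unit if \<open>c\<close> is in \<open>M\<close>.\<close>
      define v where "v j = unit_row i0 j - c * e j" for j
      have "(\<Sum>j<N. v j * D j) = D i0 - c * (\<Sum>i<N. e i * D i)"
        using i0(1)
        by (simp add: v_def left_diff_distrib sum_subtractf mult.assoc unit_row_def if_distrib[of "\<lambda>x. x * _"]
          cong: if_cong flip: sum_distrib_left)
      also have "\<dots> = 0" using e(2) Dc[OF i0(1)] by simp
      finally have "v \<in> Syz" using e c by (auto simp: Syz_def v_def unit_row_def)
      from Syz_M[OF this i0(1)] have "1 - c * e i0 \<in> M" by (simp add: v_def unit_row_def)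
      moreover have "c * e i0 \<in> M" using cM e(1) i0 ideal_ofD(5)[OF M_ideal] by auto
      ultimately show False using ideal_ofD(3)[OF M_ideal, of "1 - c * e i0" "c * e i0"] one_notin_M by simp
    qed
  qed
  then have ci: "inverse c \<in> A" "c \<noteq> 0" using inverse_mem c ideal_ofD(2)[OF M_ideal] by auto
  have \<delta>D: "\<delta> i = inverse c * D i" if "i < N" for i using Dc[OF that] ci by simp
  have \<delta>I: "ideal_of A (lin_span A N \<delta>)" by (rule lin_span_ideal) (use \<delta>A in auto)
  have "J = lin_span A N \<delta>"
  proof
    show "lin_span A N \<delta> \<subseteq> J"
      by (rule lin_span_least[OF J_ideal]) (use \<delta>D ci D_mem ideal_ofD(4)[OF J_ideal] in auto)
    show "J \<subseteq> lin_span A N \<delta>"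
      unfolding J_generated
      by (rule lin_span_least[OF \<delta>I]) (use Dc c lin_span_gen ideal_ofD(4)[OF \<delta>I] in auto)
  qed
  moreover have "\<exists>c. (\<forall>l\<in>B. c l \<in> A) \<and> (\<forall>i<N. v i = (\<Sum>l\<in>B. c l * k l i))"
    if "\<forall>j<N. v j \<in> A" "(\<Sum>j<N. v j * \<delta> j) = 0" for v
  proof (rule k(2))
    have "(\<Sum>j<N. v j * D j) = c * (\<Sum>j<N. v j * \<delta> j)"
      unfolding sum_distrib_left by (intro sum.cong) (auto simp: Dc)
    then show "v \<in> Syz" using that by (simp add: Syz_def)
  qed
  ultimately show ?thesis using kM unfolding \<delta>_def by (intro exI[of _ k]) simp
qed

end

section \<open>Deforming the Hilbert-Burch matrix\<close>

text \<open>The degrees are only bounds. Top coefficients that happen to vanish therefore need no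
  separate case.\<close>

lemma coeff_mult_top:
  assumes "degree f \<le> m" "degree g \<le> n"
  shows "coeff (f * g) (m + n) = coeff f m * (coeff g n :: 'a::comm_ring_1)"
proof -
  have "(\<Sum>i\<in>{..m + n} - {m}. coeff f i * coeff g (m + n - i)) = 0"
  proof (intro sum.neutral ballI)
    fix i assume "i \<in> {..m + n} - {m}"
    then consider "i > m" | "m + n - i > n" by fastforce
    then show "coeff f i * coeff g (m + n - i) = 0"
      by cases (use assms in \<open>auto simp: coeff_eq_0\<close>)
  qed
  then show ?thesis unfolding coeff_mult by (subst sum.remove[of _ m]) auto
qed

lemma coeff_prod_top:
  assumes "finite I" "\<And>i. i \<in> I \<Longrightarrow> degree (f i) \<le> d i"
  shows "coeff (\<Prod>i\<in>I. f i) (\<Sum>i\<in>I. d i) = (\<Prod>i\<in>I. coeff (f i) (d i) :: 'a::comm_ring_1)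
    \<and> degree (\<Prod>i\<in>I. f i) \<le> (\<Sum>i\<in>I. d i)"
  using assms
proof (induction I rule: finite_induct)
  case (insert i I)
  then have "degree (f i * (\<Prod>i\<in>I. f i)) \<le> d i + (\<Sum>i\<in>I. d i)"
    by (intro order.trans[OF degree_mult_le] add_mono) auto
  then show ?case using insert by (simp add: coeff_mult_top)
qed auto

lemma coeff_power_top:
  assumes "degree f \<le> d"
  shows "coeff (f ^ n) (n * d) = (coeff f d :: 'a::comm_ring_1) ^ n" "degree (f ^ n) \<le> n * d"
  using coeff_prod_top[of "{..<n}" "\<lambda>_. f" "\<lambda>_. d"] assms by auto

lemma dt_diagonal: "dt N (\<lambda>i j. u i * unit_row i j) = (\<Prod>i<N. u i)"
proof -
  have "(\<Sum>p | p permutes {0..<N}. signof p * (\<Prod>i<N. u i * unit_row i (p i)))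
      = (\<Sum>p\<in>{id}. signof p * (\<Prod>i<N. u i * unit_row i (p i)))"
  proof (rule sum.mono_neutral_right)
    show "\<forall>p\<in>{p. p permutes {0..<N}} - {id}. signof p * (\<Prod>i<N. u i * unit_row i (p i)) = 0"
    proof
      fix p assume p: "p \<in> {p. p permutes {0..<N}} - {id}"
      then obtain i where "p i \<noteq> i" by (auto simp: fun_eq_iff)
      moreover from this have "i < N" using p permutes_not_in[of p "{0..<N}" i] by (cases "i < N") auto
      ultimately have "\<exists>i\<in>{..<N}. u i * unit_row i (p i) = 0" by (auto simp: unit_row_def)
      then show "signof p * (\<Prod>i<N. u i * unit_row i (p i)) = 0" by (simp add: prod_zero)
    qed
  qed (auto simp: finite_permutations permutes_id)
  then show ?thesis by (simp add: dt_leibniz unit_row_def)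
qed

text \<open>The cofactors of column \<open>j\<close> pair to the determinant with column
  \<open>j\<close> and to zero with the other columns. The array is transposed so that the row
  lemmas apply.\<close>

lemma dt_adjugate:
  assumes b: "\<And>i. i < N \<Longrightarrow> b i = (\<Sum>l<N. f i l * w l)" and j: "j < N"
  shows "dt N f * w j = (\<Sum>i<N. b i * dt N ((\<lambda>a b. f b a)(j := unit_row i)))"
proof -
  define g where "g = (\<lambda>a b. f b a)"
  define c where "c i = dt N (g(j := unit_row i))" for i
  have row: "(\<Sum>i<N. g l i * c i) = (if l = j then dt N f else 0)" if "l < N" for l
  proof (cases "l = j")
    case True
    then have "(\<Sum>i<N. g l i * c i) = dt N (g(j := g j))"
      unfolding c_def using dt_expand_row[OF j, of g "g j"] by simp
    also have "\<dots> = dt N f" unfolding fun_upd_triv unfolding g_def by (rule dt_transpose)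
    finally show ?thesis using True by simp
  next
    case False
    then show ?thesis using dt_cofactor_orthogonal[OF j that, of g] by (simp add: c_def)
  qed
  have "(\<Sum>i<N. b i * c i) = (\<Sum>i<N. (\<Sum>l<N. w l * g l i) * c i)"
    by (intro sum.cong) (auto simp: b g_def mult.commute)
  also have "\<dots> = (\<Sum>l<N. w l * (\<Sum>i<N. g l i * c i))"
    by (rule sum_combination_pairing)
  also have "\<dots> = (\<Sum>l<N. w l * (if l = j then dt N f else 0))"
    by (intro sum.cong) (auto simp: row)
  also have "\<dots> = dt N f * w j" using j by (simp add: if_distrib mult.commute cong: if_cong)
  finally show ?thesis by (simp add: c_def g_def)
qed

lemma (in csubring) polys_mult_idprod:
  assumes "ideal_of S I" "ideal_of S K" "f \<in> polys I" "g \<in> polys K"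
  shows "f * g \<in> polys (idprod I K)"
  unfolding polys_def mem_Collect_eq coeff_mult
  using assms(3,4)
  by (intro allI ideal_of_sum[OF idprod_ideal[OF assms(1,2)]] idprod.prod) (auto dest: polysD)

text \<open>The assumptions on \<open>\<psi>1\<close> and \<open>\<psi>2\<close> say that
  \<open>\<psi>2\<close>, \<open>\<psi>1\<close> is a regular sequence generating the maximal ideal
  of the localization at \<open>J\<close>. Multipliers outside \<open>J\<close> replace that second
  localization. The failure of the complete intersection property enters as
  \<open>N_ge_3\<close>.\<close>

locale generic_complete_intersection = height_two_prime A M y z x J N D
  for A M :: "'f::field set" and y z x J N D +
  fixes \<psi>1 \<psi>2 :: 'f
  assumes \<psi>1_mem: "\<psi>1 \<in> J" and \<psi>2_mem: "\<psi>2 \<in> J" and \<psi>2_nonzero: "\<psi>2 \<noteq> 0"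
    and \<psi>_generate: "f \<in> J \<Longrightarrow> \<exists>u\<in>A - J. \<exists>a\<in>A. \<exists>b\<in>A. u * f = a * \<psi>1 + b * \<psi>2"
    and \<psi>_regular: "r \<in> A \<Longrightarrow> r' \<in> A \<Longrightarrow> r * \<psi>1 = r' * \<psi>2 \<Longrightarrow> \<exists>u\<in>A - J. \<exists>c\<in>A. u * r = c * \<psi>2"
    and N_ge_3: "N \<ge> 3"
begin

lemma \<psi>_A: "\<psi>1 \<in> A" "\<psi>2 \<in> A"
  using \<psi>1_mem \<psi>2_mem ideal_ofD(6)[OF J_ideal] by auto

lemma J_compl_mult: "u \<in> A - J \<Longrightarrow> v \<in> A - J \<Longrightarrow> u * v \<in> A - J"
  using prime_ofD(3)[OF J_prime] by blast

lemma \<psi>_regular_power: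
  "r \<in> A \<Longrightarrow> r' \<in> A \<Longrightarrow> r * \<psi>1 ^ n = r' * \<psi>2 \<Longrightarrow> \<exists>u\<in>A - J. \<exists>c\<in>A. u * r = c * \<psi>2"
proof (induction n arbitrary: r r')
  case 0
  then show ?case using prime_ofD(2)[OF J_prime] by (intro bexI[of _ 1] bexI[of _ r']) auto
next
  case (Suc n)
  have "(r * \<psi>1 ^ n) * \<psi>1 = r' * \<psi>2" using Suc.prems by (simp add: ac_simps)
  then obtain u c where u: "u \<in> A - J" "c \<in> A" "u * (r * \<psi>1 ^ n) = c * \<psi>2"
    using \<psi>_regular[of "r * \<psi>1 ^ n" r'] Suc.prems \<psi>_A by blast
  then obtain v d where v: "v \<in> A - J" "d \<in> A" "v * (u * r) = d * \<psi>2"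
    using Suc.IH[of "u * r" c] Suc.prems by (auto simp: mult.assoc)
  then show ?case using u J_compl_mult[of v u] by (intro bexI[of _ "v * u"] bexI[of _ d]) (auto simp: mult.assoc)
qed

end

text \<open>Index 2 is reserved for the unit vectors that single out the minors; it is the first
  index after the two rows with the special deformation.\<close>

locale deformation = generic_complete_intersection A M y z x J N D \<psi>1 \<psi>2
  for A M :: "'f::field set" and y z x J N D \<psi>1 \<psi>2 +
  fixes k :: "nat \<Rightarrow> nat \<Rightarrow> 'f"
  assumes k_M: "l < N \<Longrightarrow> l \<noteq> 2 \<Longrightarrow> j < N \<Longrightarrow> k l j \<in> M"
    and J_minors: "J = lin_span A N (\<lambda>i. dt N (k(2 := unit_row i)))"
    and k_generate: "\<forall>v. (\<forall>j<N. v j \<in> A) \<longrightarrow> (\<Sum>j<N. v j * dt N (k(2 := unit_row j))) = 0 \<longrightarrow>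
      (\<exists>c. (\<forall>l\<in>{..<N} - {2}. c l \<in> A) \<and> (\<forall>i<N. v i = (\<Sum>l\<in>{..<N} - {2}. c l * k l i)))"
begin

text \<open>The direction of the deformation: two rows with entries in \<open>(y, z, x)\<close> whose \<open>2\<times>2\<close> minors
  have \<open>x\<^sup>2\<close> among them, an identity block, and the row 2 that the unit vectors replace.\<close>

definition shift :: "nat \<Rightarrow> nat \<Rightarrow> 'f"
  where "shift l j =
    (if l = 0 then (if j = 0 then x else if j = 1 then y else if j = 2 then z else 0)
     else if l = 1 then (if j = 1 then x else if j = 2 then y else 0)
     else unit_row l j)"

definition Xm where "Xm l j = [:k l j, shift l j:]"

definition \<Delta> where "\<Delta> i = dt N (Xm(2 := unit_row i))"

definition \<delta> where "\<delta> i = dt N (k(2 := unit_row i))"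

sublocale P: csubring "polys A"
  by (rule csubring_polys)

definition Jt where "Jt = lin_span (polys A) N \<Delta>"

definition s :: "'f poly" where "s = [:0, 1:]"

lemma s_mem: "s \<in> polys A"
  by (auto simp: s_def pCons_in_polys)

lemma const_mem: "[:a:] \<in> polys A \<longleftrightarrow> a \<in> A"
  by (auto simp: pCons_in_polys)

lemma k_A: "l < N \<Longrightarrow> l \<noteq> 2 \<Longrightarrow> j < N \<Longrightarrow> k l j \<in> A"
  using k_M M_sub by auto

lemma shift_A: "shift l j \<in> A"
  using yz_mem by (auto simp: shift_def unit_row_def)

lemma Xm_mem: "l < N \<Longrightarrow> l \<noteq> 2 \<Longrightarrow> j < N \<Longrightarrow> Xm l j \<in> polys A"
  using k_A shift_A by (auto simp: Xm_def pCons_in_polys const_mem)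

lemma unit_row_mem: "unit_row i j \<in> polys A"
  by (auto simp: unit_row_def)

lemma \<Delta>_mem: "\<Delta> i \<in> polys A"
  unfolding \<Delta>_def by (rule P.dt_mem) (use Xm_mem unit_row_mem in auto)

lemma \<Delta>_at_0: "poly (\<Delta> i) 0 = \<delta> i"
  unfolding \<Delta>_def \<delta>_def poly_dt
  by (rule dt_cong) (auto simp: Xm_def unit_row_def)

lemma J_eq: "J = lin_span A N \<delta>"
  using J_minors by (simp add: \<delta>_def[abs_def])

lemma Jt_ideal: "ideal_of (polys A) Jt"
  unfolding Jt_def by (rule P.lin_span_ideal) (rule \<Delta>_mem)

lemma \<Delta>_Jt: "i < N \<Longrightarrow> \<Delta> i \<in> Jt"
  unfolding Jt_def by (rule P.lin_span_gen)

lemma Xm_M: "l < 2 \<Longrightarrow> j < N \<Longrightarrow> Xm l j \<in> polys M"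
  using k_M[of l j] N_ge_3 y z x ideal_ofD(2)[OF M_ideal]
  by (auto simp: Xm_def pCons_in_polys shift_def less_2_cases_iff) (auto simp: polys_def)

lemma \<Delta>_M2: "\<Delta> i \<in> polys (ipow A M 2)"
proof -
  have I: "ideal_of (polys A) (polys (ipow A M 2))" by (intro polys_ideal ipow_ideal M_ideal)
  have M2: "polys (idprod M M) \<subseteq> polys (ipow A M 2)"
    using ipow_1[OF M_ideal] by (simp add: numeral_2_eq_2)
  show ?thesis
    unfolding \<Delta>_def dt_leibniz
  proof (intro ideal_of_sum[OF I] ideal_ofD(4)[OF I] P.signof_mem)
    fix p assume "p \<in> {p. p permutes {0..<N}}"
    then have p: "p l < N" if "l < N" for l using permutes_in_image[of p "{0..<N}" l] that by auto
    define F where "F = Xm(2 := unit_row i)"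
    have FA: "F l (p l) \<in> polys A" if "l < N" for l
      using Xm_mem[of l "p l"] p[OF that] that unit_row_mem by (auto simp: F_def)
    have "{..<N} = insert 0 (insert 1 ({..<N} - {0, 1}))" using N_ge_3 by auto
    then have "(\<Prod>l<N. F l (p l)) = prod (\<lambda>l. F l (p l)) (insert 0 (insert 1 ({..<N} - {0, 1})))"
      by (rule arg_cong)
    also have "\<dots> = F 0 (p 0) * F 1 (p 1) * (\<Prod>l\<in>{..<N} - {0, 1}. F l (p l))"
      by (simp add: mult.assoc)
    finally have eq: "(\<Prod>l<N. F l (p l)) = F 0 (p 0) * F 1 (p 1) * (\<Prod>l\<in>{..<N} - {0, 1}. F l (p l))" .
    have "F 0 (p 0) * F 1 (p 1) \<in> polys (ipow A M 2)"
      using polys_mult_idprod[OF M_ideal M_ideal Xm_M[of 0 "p 0"] Xm_M[of 1 "p 1"]] p N_ge_3 M2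
      by (auto simp: F_def)
    moreover have "(\<Prod>l\<in>{..<N} - {0, 1}. F l (p l)) \<in> polys A" using FA by (intro P.prod) auto
    ultimately show "(\<Prod>l<N. (Xm(2 := unit_row i)) l (p l)) \<in> polys (ipow A M 2)"
      unfolding F_def[symmetric] eq using ideal_ofD(5)[OF I] by blast
  qed
qed

lemma degree_Xm: "degree (Xm l j) \<le> 1"
  by (simp add: Xm_def)

lemma degree_unit_row: "degree (unit_row i j :: 'f poly) = 0"
  by (simp add: unit_row_def)

text \<open>The coefficient of s^(N-1) in \<open>\<Delta> 2\<close> is the determinant of
  \<open>shift\<close> with row 2 equal to the second unit vector. This array is upper triangular
  with diagonal x, x, 1, ..., 1.\<close>

lemma \<Delta>_top: "degree (\<Delta> i) \<le> N - 1" "coeff (\<Delta> 2) (N - 1) = x\<^sup>2"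
proof -
  \<comment> \<open>Degree bounds for the rows: row 2 is constant in s, all others are
    linear.\<close>
  define d :: "nat \<Rightarrow> nat" where "d l = (if l = 2 then 0 else 1)" for l
  have "(\<Sum>l<N. d l) = (\<Sum>l\<in>{..<N} - {2}. d l)" using N_ge_3 by (intro sum.mono_neutral_right) (auto simp: d_def)
  also have "\<dots> = N - 1" using N_ge_3 by (simp add: d_def)
  finally have sum_d: "(\<Sum>l<N. d l) = N - 1" .
  define F where "F i = Xm(2 := unit_row i)" for i
  have deg: "degree (F i l (p l)) \<le> d l" for i l and p :: "nat \<Rightarrow> nat"
    using degree_Xm degree_unit_row by (auto simp: F_def d_def)
  have top: "coeff (\<Prod>l<N. F i l (p l)) (N - 1) = (\<Prod>l<N. coeff (F i l (p l)) (d l))"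
    "degree (\<Prod>l<N. F i l (p l)) \<le> N - 1" for i and p :: "nat \<Rightarrow> nat"
    using coeff_prod_top[of "{..<N}" "\<lambda>l. F i l (p l)" d] deg by (auto simp: sum_d)
  have signof_deg: "degree (signof p * f) \<le> degree f" for p :: "nat \<Rightarrow> nat" and f :: "'f poly"
    by (cases p rule: sign_cases) auto
  show "degree (\<Delta> i) \<le> N - 1"
    unfolding \<Delta>_def dt_leibniz F_def[symmetric]
    by (intro degree_sum_le finite_permutations) (simp_all only: order.trans[OF signof_deg top(2)] finite_atLeastLessThan)
  have sgn: "coeff (signof p * f) n = signof p * coeff f n" for p :: "nat \<Rightarrow> nat" and f :: "'f poly" and n
    by (cases p rule: sign_cases) auto
  have "coeff (\<Delta> 2) (N - 1)
      = (\<Sum>p | p permutes {0..<N}. signof p * (\<Prod>l<N. coeff (F 2 l (p l)) (d l)))"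
    unfolding \<Delta>_def dt_leibniz F_def[symmetric] coeff_sum sgn top(1) ..
  also have "\<dots> = (\<Sum>p\<in>{id}. signof p * (\<Prod>l<N. coeff (F 2 l (p l)) (d l)))"
  proof (rule sum.mono_neutral_right)
    show "\<forall>p\<in>{p. p permutes {0..<N}} - {id}. signof p * (\<Prod>l<N. coeff (F 2 l (p l)) (d l)) = 0"
    proof
      fix p assume p: "p \<in> {p. p permutes {0..<N}} - {id}"
      \<comment> \<open>A permutation other than the identity meets an entry below the diagonal,
        where the top coefficient vanishes.\<close>
      have "\<exists>l. p l < l"
      proof (rule ccontr)
        assume "\<nexists>l. p l < l"
        then have "\<forall>l\<in>{0..<N}. l \<le> p l" by (auto simp: not_less)
        then have "p = id" using p permutes_natset_ge[of p "{0..<N}"] by auto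
        then show False using p by simp
      qed
      then obtain l where l: "p l < l" by blast
      have "l < N" using l p permutes_not_in[of p "{0..<N}" l] by (cases "l < N") auto
      moreover have "coeff (F 2 l (p l)) (d l) = 0"
        using l by (auto simp: F_def d_def Xm_def shift_def unit_row_def)
      ultimately have "\<exists>l\<in>{..<N}. coeff (F 2 l (p l)) (d l) = 0" by blast
      then show "signof p * (\<Prod>l<N. coeff (F 2 l (p l)) (d l)) = 0" by (simp add: prod_zero)
    qed
  qed (auto simp: finite_permutations permutes_id)
  also have "\<dots> = (\<Prod>l<N. coeff (F 2 l l) (d l))" by simp
  also have "\<dots> = (\<Prod>l<N. if l < 2 then x else 1)"
    by (intro prod.cong) (auto simp: F_def d_def Xm_def shift_def unit_row_def)
  also have "\<dots> = (\<Prod>l\<in>{0, 1 :: nat}. x)"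
    using N_ge_3 by (intro prod.mono_neutral_cong_right) auto
  finally show "coeff (\<Delta> 2) (N - 1) = x\<^sup>2" by (simp add: power2_eq_square)
qed

lemma Xm_\<Delta>: "l < N \<Longrightarrow> l \<noteq> 2 \<Longrightarrow> (\<Sum>j<N. Xm l j * \<Delta> j) = 0"
  unfolding \<Delta>_def using N_ge_3 by (intro dt_cofactor_orthogonal) auto

lemma Jt_power_M: "ipow (polys A) Jt m \<subseteq> polys (ipow A M (2 * m))"
proof (induction m)
  case (Suc m)
  have I: "ideal_of (polys A) (polys (ipow A M (2 * Suc m)))" by (intro polys_ideal ipow_ideal M_ideal)
  have Jt_M2: "Jt \<subseteq> polys (ipow A M 2)"
    unfolding Jt_def by (rule lin_span_least) (use \<Delta>_M2 polys_ideal ipow_ideal M_ideal in auto)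
  have le: "idprod (ipow A M (2 * m)) (ipow A M 2) \<subseteq> ipow A M (2 * Suc m)"
    by (rule idprod_least[OF ipow_ideal[OF M_ideal]])
      (use ipow_mult[OF M_ideal, of _ "2 * m" _ 2] in auto)
  show ?case
    unfolding ipow.simps
  proof (rule idprod_least[OF I[unfolded ipow.simps]])
    fix a b assume "a \<in> ipow (polys A) Jt m" "b \<in> Jt"
    then have "a * b \<in> polys (idprod (ipow A M (2 * m)) (ipow A M 2))"
      using Suc Jt_M2 by (intro polys_mult_idprod ipow_ideal M_ideal) auto
    then show "a * b \<in> polys (ipow A M (2 * Suc m))" using polys_mono[OF le] by blast
  qed
qed simp

lemma poly_0_ipow: "f \<in> ipow (polys A) Jt m \<Longrightarrow> poly f 0 \<in> ipow A J m"
proof (rule ipow_hom[of "\<lambda>f. poly f 0"])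
  show "poly f 0 \<in> A" if "f \<in> polys A" for f using that polys_poly[OF csubring_axioms] by auto
  show "poly f 0 \<in> J" if "f \<in> Jt" for f
  proof -
    from that obtain c where c: "\<And>i. i < N \<Longrightarrow> c i \<in> polys A" "f = (\<Sum>i<N. c i * \<Delta> i)"
      unfolding Jt_def by (metis lin_spanE)
    then have "poly f 0 = (\<Sum>i<N. poly (c i) 0 * \<delta> i)" by (simp add: poly_sum \<Delta>_at_0)
    then show ?thesis
      unfolding J_eq using c(1) polys_poly[OF csubring_axioms] lin_spanI[of N "\<lambda>i. poly (c i) 0" A \<delta>] by auto
  qed
qed auto

lemma lift_J: "e \<in> J \<Longrightarrow> \<exists>f\<in>Jt. poly f 0 = e"
proof -
  assume "e \<in> J"
  then obtain c where c: "\<And>i. i < N \<Longrightarrow> c i \<in> A" "e = (\<Sum>i<N. c i * \<delta> i)"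
    unfolding J_eq by (metis lin_spanE)
  have "(\<Sum>i<N. [:c i:] * \<Delta> i) \<in> Jt"
    unfolding Jt_def by (rule lin_spanI) (use c const_mem in auto)
  moreover have "poly (\<Sum>i<N. [:c i:] * \<Delta> i) 0 = e" by (simp add: poly_sum \<Delta>_at_0 c)
  ultimately show ?thesis by blast
qed

lemma lift_J_power:
  assumes "e \<in> ipow A J m"
  obtains f where "f \<in> ipow (polys A) Jt m" "poly f 0 = e"
proof -
  have "e \<in> (\<lambda>f. poly f 0) ` ipow (polys A) Jt m"
  proof (rule ipow_lift[OF _ _ _ _ assms])
    show "A \<subseteq> (\<lambda>f. poly f 0) ` polys A" using const_mem by (force intro: image_eqI[of _ _ "[:_:]"])
    show "J \<subseteq> (\<lambda>f. poly f 0) ` Jt" using lift_J by blast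
  qed auto
  then show ?thesis using that by blast
qed

lemma s_divides:
  assumes "f \<in> polys A" "poly f 0 = 0"
  obtains g where "g \<in> polys A" "f = s * g" "\<And>i. coeff g i = coeff f (Suc i)"
proof -
  obtain g where g: "f = [:0, 1:] * g" "\<And>i. coeff g i = coeff f (Suc i)"
    using poly_eq_0_imp_X[OF assms(2)] by blast
  have "coeff g i \<in> A" for i using g(2)[of i] polysD[OF assms(1), of "Suc i"] by simp
  then have "g \<in> polys A" by (simp add: polys_def)
  then show ?thesis using that g by (simp add: s_def)
qed

end

context deformation
begin

section \<open>Lifting relations and generators to the deformed ideal\<close>

definition \<gamma> where "\<gamma> e = (SOME c. (\<forall>i<N. c i \<in> A) \<and> e = (\<Sum>i<N. c i * \<delta> i))"

lemma \<gamma>: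
  assumes "e \<in> J"
  shows "i < N \<Longrightarrow> \<gamma> e i \<in> A" "(\<Sum>i<N. \<gamma> e i * \<delta> i) = e"
proof -
  have "\<exists>c. (\<forall>i<N. c i \<in> A) \<and> e = (\<Sum>i<N. c i * \<delta> i)"
    using assms unfolding J_eq lin_span_def by blast
  from someI_ex[OF this] show "i < N \<Longrightarrow> \<gamma> e i \<in> A" "(\<Sum>i<N. \<gamma> e i * \<delta> i) = e"
    by (simp_all add: \<gamma>_def)
qed

definition lift where "lift e = (\<Sum>i<N. [:\<gamma> e i:] * \<Delta> i)"

lemma lift_Jt: "e \<in> J \<Longrightarrow> lift e \<in> Jt"
  unfolding lift_def Jt_def by (rule lin_spanI) (use \<gamma> const_mem in auto)

lemma lift_at_0: "e \<in> J \<Longrightarrow> poly (lift e) 0 = e"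
  by (simp add: lift_def poly_sum \<Delta>_at_0 \<gamma>)

lemma lift_mem: "e \<in> J \<Longrightarrow> lift e \<in> polys A"
  using lift_Jt ideal_ofD(6)[OF Jt_ideal] by blast

abbreviation "\<Psi>1 \<equiv> lift \<psi>1"
abbreviation "\<Psi>2 \<equiv> lift \<psi>2"

lemmas \<Psi>_mem = lift_mem[OF \<psi>1_mem] lift_mem[OF \<psi>2_mem]

text \<open>The flatness of the deformation. By \<open>k_generate\<close>, \<open>v\<close> is a
  combination of rows of \<open>k\<close>. The same combination of deformed rows annihilates the
  minors \<open>\<Delta>\<close>, and it differs from \<open>v\<close> by a multiple of s.\<close>

lemma deform_relation:
  assumes v: "\<And>j. j < N \<Longrightarrow> v j \<in> A" and rel: "(\<Sum>j<N. v j * \<delta> j) = 0"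
  obtains p where "\<And>j. p j \<in> A" "(\<Sum>j<N. [:v j:] * \<Delta> j) = (\<Sum>j<N. [:0, p j:] * \<Delta> j)"
proof -
  define B where "B = {..<N} - {2}"
  have "\<exists>c. (\<forall>l\<in>B. c l \<in> A) \<and> (\<forall>i<N. v i = (\<Sum>l\<in>B. c l * k l i))"
    unfolding B_def by (rule k_generate[rule_format]) (use v rel in \<open>simp_all add: \<delta>_def\<close>)
  then obtain c where c: "\<forall>l\<in>B. c l \<in> A" "\<forall>i<N. v i = (\<Sum>l\<in>B. c l * k l i)"
    by (elim exE conjE)
  define p where "p j = - (\<Sum>l\<in>B. c l * shift l j)" for j
  have "(\<Sum>j<N. [:v j:] * \<Delta> j) - (\<Sum>j<N. [:0, p j:] * \<Delta> j)
      = (\<Sum>j<N. (\<Sum>l\<in>B. [:c l:] * Xm l j) * \<Delta> j)"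
  proof -
    have "[:v j:] - [:0, p j:] = (\<Sum>l\<in>B. [:c l:] * Xm l j)" if "j < N" for j
    proof -
      have "(\<Sum>l\<in>B. [:c l:] * Xm l j) = (\<Sum>l\<in>B. [:c l * k l j, c l * shift l j:])"
        by (simp add: Xm_def mult.commute)
      also have "\<dots> = [:\<Sum>l\<in>B. c l * k l j, \<Sum>l\<in>B. c l * shift l j:]"
        by (induction B rule: infinite_finite_induct) auto
      finally show ?thesis using c(2) that by (simp add: p_def)
    qed
    then show ?thesis
      unfolding sum_subtractf[symmetric] left_diff_distrib[symmetric] by (intro sum.cong) auto
  qed
  also have "\<dots> = (\<Sum>l\<in>B. [:c l:] * (\<Sum>j<N. Xm l j * \<Delta> j))" by (rule sum_combination_pairing)
  also have "\<dots> = 0" using Xm_\<Delta> by (intro sum.neutral) (auto simp: B_def)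
  finally have "(\<Sum>j<N. [:v j:] * \<Delta> j) = (\<Sum>j<N. [:0, p j:] * \<Delta> j)" by simp
  moreover have "p j \<in> A" for j unfolding p_def using c shift_A by (intro uminus sum mult) auto
  ultimately show ?thesis using that by blast
qed

text \<open>The determinant trick. Lifting
  \<open>u i * \<delta> i = a i * \<psi>1 + b i * \<psi>2\<close> costs an error that is s times a
  combination of the minors. Moved to the left, it gives a matrix \<open>H\<close> that equals
  diag(u) at s = 0 and maps the vector of minors into the ideal of \<open>\<Psi>1\<close> and
  \<open>\<Psi>2\<close>. Its determinant multiplies every minor into that ideal, and its value at 0
  is the product of the \<open>u i\<close>.\<close>

lemma two_generators:
  obtains h where "h \<in> polys A" "poly h 0 \<in> A - J"
    "\<And>f. f \<in> Jt \<Longrightarrow> \<exists>a\<in>polys A. \<exists>b\<in>polys A. h * f = a * \<Psi>1 + b * \<Psi>2"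
proof -
  have \<delta>J: "\<delta> i \<in> J" if "i < N" for i unfolding J_eq using lin_span_gen[OF that] .
  define R where "R i u a b p \<longleftrightarrow> u \<in> A - J \<and> a \<in> A \<and> b \<in> A \<and> (\<forall>j. p j \<in> A) \<and>
    [:u:] * \<Delta> i = [:a:] * \<Psi>1 + [:b:] * \<Psi>2 + (\<Sum>j<N. [:0, p j:] * \<Delta> j)" for i u a b p
  have "\<forall>i. \<exists>u a b p. i < N \<longrightarrow> R i u a b p"
  proof
    fix i
    show "\<exists>u a b p. i < N \<longrightarrow> R i u a b p"
    proof (cases "i < N")
      case i: True
      obtain u a b where u: "u \<in> A - J" "a \<in> A" "b \<in> A" "u * \<delta> i = a * \<psi>1 + b * \<psi>2"
        using \<psi>_generate[OF \<delta>J[OF i]] by blast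
      define v where "v j = u * unit_row i j - a * \<gamma> \<psi>1 j - b * \<gamma> \<psi>2 j" for j
      have sum_unit: "(\<Sum>j<N. unit_row i j * w j) = w i" for w :: "nat \<Rightarrow> 'b::comm_ring_1"
        using i by (simp add: unit_row_def if_distrib[of "\<lambda>x. x * _"] cong: if_cong)
      have "(\<Sum>j<N. v j * \<delta> j)
          = u * (\<Sum>j<N. unit_row i j * \<delta> j) - a * (\<Sum>j<N. \<gamma> \<psi>1 j * \<delta> j) - b * (\<Sum>j<N. \<gamma> \<psi>2 j * \<delta> j)"
        by (simp add: v_def left_diff_distrib sum_subtractf sum_distrib_left mult.assoc)
      also have "\<dots> = 0" by (simp add: sum_unit u \<gamma>[OF \<psi>1_mem] \<gamma>[OF \<psi>2_mem])
      finally have "(\<Sum>j<N. v j * \<delta> j) = 0" .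
      moreover have "v j \<in> A" if "j < N" for j
        using u \<gamma>(1)[OF \<psi>1_mem that] \<gamma>(1)[OF \<psi>2_mem that] by (auto simp: v_def unit_row_def)
      ultimately obtain p where p: "\<And>j. p j \<in> A" "(\<Sum>j<N. [:v j:] * \<Delta> j) = (\<Sum>j<N. [:0, p j:] * \<Delta> j)"
        using deform_relation by blast
      have "[:v j:] = [:u:] * unit_row i j - [:a:] * [:\<gamma> \<psi>1 j:] - [:b:] * [:\<gamma> \<psi>2 j:]" for j
        by (simp add: v_def unit_row_def)
      then have "(\<Sum>j<N. [:v j:] * \<Delta> j)
          = [:u:] * (\<Sum>j<N. unit_row i j * \<Delta> j) - [:a:] * \<Psi>1 - [:b:] * \<Psi>2"
        unfolding lift_def by (simp only: left_diff_distrib sum_subtractf sum_distrib_left mult.assoc)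
      then have "[:u:] * \<Delta> i = [:a:] * \<Psi>1 + [:b:] * \<Psi>2 + (\<Sum>j<N. [:0, p j:] * \<Delta> j)"
        unfolding sum_unit p(2) by (simp add: algebra_simps)
      then have "R i u a b p" using u(1-3) p(1) by (simp add: R_def)
      then show ?thesis by blast
    qed blast
  qed
  then obtain u a b p where "\<And>i. i < N \<Longrightarrow> R i (u i) (a i) (b i) (p i)" by metis
  then have *: "\<And>i. i < N \<Longrightarrow> u i \<in> A - J \<and> a i \<in> A \<and> b i \<in> A \<and> (\<forall>j. p i j \<in> A) \<and>
    [:u i:] * \<Delta> i = [:a i:] * \<Psi>1 + [:b i:] * \<Psi>2 + (\<Sum>j<N. [:0, p i j:] * \<Delta> j)" for i
    unfolding R_def by blast
  define H where "H i j = [:u i * unit_row i j, - p i j:]" for i j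
  define h where "h = dt N H"
  have H_mem: "H i j \<in> polys A" if "i < N" for i j
    using *[OF that] by (auto simp: H_def pCons_in_polys const_mem unit_row_def)
  have h_mem: "h \<in> polys A" unfolding h_def by (rule P.dt_mem) (use H_mem in auto)
  have "poly h 0 = (\<Prod>i<N. u i)"
    unfolding h_def poly_dt H_def by (simp add: dt_diagonal)
  then have h0: "poly h 0 \<in> A - J" using prime_prod[OF J_prime, of "{..<N}" u] * by simp
  define g where "g j i = dt N ((\<lambda>a b. H b a)(j := unit_row i))" for j i
  have g_mem: "g j i \<in> polys A" for j i
    unfolding g_def by (rule P.dt_mem) (use H_mem unit_row_mem in auto)
  have row: "[:a i:] * \<Psi>1 + [:b i:] * \<Psi>2 = (\<Sum>j<N. H i j * \<Delta> j)" if i: "i < N" for i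
  proof -
    have "H i j = [:u i:] * unit_row i j - [:0, p i j:]" for j by (simp add: H_def unit_row_def)
    then have "(\<Sum>j<N. H i j * \<Delta> j) = [:u i:] * (\<Sum>j<N. unit_row i j * \<Delta> j) - (\<Sum>j<N. [:0, p i j:] * \<Delta> j)"
      by (simp only: left_diff_distrib sum_subtractf sum_distrib_left mult.assoc)
    also have "(\<Sum>j<N. unit_row i j * \<Delta> j) = \<Delta> i"
      using i by (simp add: unit_row_def if_distrib[of "\<lambda>x. x * _"] cong: if_cong)
    finally show ?thesis using *[OF i] by simp
  qed
  have gen: "h * \<Delta> j = (\<Sum>i<N. [:a i:] * g j i) * \<Psi>1 + (\<Sum>i<N. [:b i:] * g j i) * \<Psi>2" if "j < N" for j
  proof -
    have "h * \<Delta> j = (\<Sum>i<N. ([:a i:] * \<Psi>1 + [:b i:] * \<Psi>2) * g j i)"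
      unfolding h_def g_def by (rule dt_adjugate[OF row that])
    also have "\<dots> = (\<Sum>i<N. [:a i:] * g j i * \<Psi>1 + [:b i:] * g j i * \<Psi>2)"
      by (intro sum.cong) (simp_all only: distrib_right distrib_left ac_simps)
    finally show ?thesis by (simp only: sum.distrib sum_distrib_right)
  qed
  show ?thesis
  proof (rule that[OF h_mem h0])
    fix f assume "f \<in> Jt"
    then obtain c where c: "\<And>j. j < N \<Longrightarrow> c j \<in> polys A" "f = (\<Sum>j<N. c j * \<Delta> j)"
      unfolding Jt_def by (metis lin_spanE)
    define \<alpha> \<beta> where "\<alpha> = (\<Sum>j<N. c j * (\<Sum>i<N. [:a i:] * g j i))"
      and "\<beta> = (\<Sum>j<N. c j * (\<Sum>i<N. [:b i:] * g j i))"
    have "h * f = (\<Sum>j<N. c j * (h * \<Delta> j))" by (simp add: c(2) sum_distrib_left ac_simps)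
    also have "\<dots> = (\<Sum>j<N. c j * ((\<Sum>i<N. [:a i:] * g j i) * \<Psi>1 + (\<Sum>i<N. [:b i:] * g j i) * \<Psi>2))"
      by (intro sum.cong) (auto simp: gen)
    also have "\<dots> = \<alpha> * \<Psi>1 + \<beta> * \<Psi>2"
      unfolding \<alpha>_def \<beta>_def by (simp only: distrib_left sum.distrib sum_distrib_right mult.assoc)
    finally have "h * f = \<alpha> * \<Psi>1 + \<beta> * \<Psi>2" .
    moreover have "\<alpha> \<in> polys A" "\<beta> \<in> polys A"
      unfolding \<alpha>_def \<beta>_def using c(1) g_mem *
      by (auto intro!: P.sum P.mult[OF c(1)] P.mult[OF const_mem[THEN iffD2]] simp del: mult_pCons_left)
    ultimately show "\<exists>a\<in>polys A. \<exists>b\<in>polys A. h * f = a * \<Psi>1 + b * \<Psi>2" by blast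
  qed
qed

text \<open>The m-th power of the ideal generated by \<open>\<Psi>1\<close> and
  \<open>\<Psi>2\<close>. The pure power of \<open>\<Psi>1\<close> is split off from the multiples
  of \<open>\<Psi>2\<close>, because \<open>forms_cancel\<close> treats the two parts
  differently.\<close>

primrec forms :: "nat \<Rightarrow> 'f poly set"
  where "forms 0 = polys A"
  | "forms (Suc m) = {c * \<Psi>1 ^ Suc m + \<Psi>2 * e |c e. c \<in> polys A \<and> e \<in> forms m}"

lemma formsI: "c \<in> polys A \<Longrightarrow> e \<in> forms m \<Longrightarrow> c * \<Psi>1 ^ Suc m + \<Psi>2 * e \<in> forms (Suc m)"
  unfolding forms.simps by blast

declare forms.simps(2) [simp del]

lemma formsE:
  assumes "f \<in> forms (Suc m)"
  obtains c e where "c \<in> polys A" "e \<in> forms m" "f = c * \<Psi>1 ^ Suc m + \<Psi>2 * e"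
  using assms unfolding forms.simps by blast

lemma forms_ideal: "ideal_of (polys A) (forms m)"
proof (induction m)
  case (Suc m)
  note I = Suc
  show ?case
    unfolding ideal_of_def
  proof (intro conjI ballI subsetI)
    show "f \<in> polys A" if "f \<in> forms (Suc m)" for f
      using that \<Psi>_mem ideal_ofD(6)[OF I] by (auto elim!: formsE simp del: power_Suc)
    show "0 \<in> forms (Suc m)" using formsI[of 0 0 m] ideal_ofD(2)[OF I] by simp
  next
    fix f g assume "f \<in> forms (Suc m)" "g \<in> forms (Suc m)"
    then obtain c e c' e' where "c \<in> polys A" "e \<in> forms m" "c' \<in> polys A" "e' \<in> forms m"
      "f = c * \<Psi>1 ^ Suc m + \<Psi>2 * e" "g = c' * \<Psi>1 ^ Suc m + \<Psi>2 * e'" by (metis formsE)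
    moreover from this have "f + g = (c + c') * \<Psi>1 ^ Suc m + \<Psi>2 * (e + e')" by (simp add: algebra_simps)
    ultimately show "f + g \<in> forms (Suc m)"
      using formsI[of "c + c'" "e + e'" m] ideal_ofD(3)[OF I] by (metis P.add)
  next
    fix r f assume "r \<in> polys A" "f \<in> forms (Suc m)"
    then obtain c e where "c \<in> polys A" "e \<in> forms m" "f = c * \<Psi>1 ^ Suc m + \<Psi>2 * e" by (metis formsE)
    moreover from this have "r * f = (r * c) * \<Psi>1 ^ Suc m + \<Psi>2 * (r * e)" by (simp add: algebra_simps)
    ultimately show "r * f \<in> forms (Suc m)"
      using formsI[of "r * c" "r * e" m] ideal_ofD(4)[OF I] \<open>r \<in> polys A\<close> by (metis P.mult)
  qed
qed (simp add: P.ideal_S)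

lemma forms_power: "\<Psi>1 ^ m \<in> forms m"
proof (cases m)
  case (Suc n)
  then show ?thesis using formsI[of 1 0 n] ideal_ofD(2)[OF forms_ideal[of n]] by auto
qed auto

lemma forms_\<Psi>2: "e \<in> forms m \<Longrightarrow> \<Psi>2 * e \<in> forms (Suc m)"
  using formsI[of 0 e m] by simp

lemma forms_\<Psi>1: "e \<in> forms m \<Longrightarrow> \<Psi>1 * e \<in> forms (Suc m)"
proof (induction m arbitrary: e)
  case 0
  then show ?case using formsI[of e 0 0] by (simp add: mult.commute)
next
  case (Suc m)
  obtain c e' where ce: "c \<in> polys A" "e' \<in> forms m" "e = c * \<Psi>1 ^ Suc m + \<Psi>2 * e'"
    using formsE[OF Suc.prems] .
  have "\<Psi>1 * e = c * \<Psi>1 ^ Suc (Suc m) + \<Psi>2 * (\<Psi>1 * e')" by (simp add: ce algebra_simps)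
  then show ?case using formsI[OF ce(1) Suc.IH[OF ce(2)]] by simp
qed

lemma forms_Jt: "forms m \<subseteq> ipow (polys A) Jt m"
proof (induction m)
  case (Suc m)
  note I = P.ipow_ideal[OF Jt_ideal]
  show ?case
  proof
    fix f assume "f \<in> forms (Suc m)"
    then obtain c e where ce: "c \<in> polys A" "e \<in> forms m" "f = c * \<Psi>1 ^ Suc m + \<Psi>2 * e" by (rule formsE)
    have "c * \<Psi>1 ^ Suc m \<in> ipow (polys A) Jt (Suc m)"
      using ideal_ofD(4)[OF I ce(1)] P.ipow_power[OF Jt_ideal lift_Jt[OF \<psi>1_mem]] by blast
    moreover have "e * \<Psi>2 \<in> ipow (polys A) Jt (Suc m)"
      using idprod.prod[of e _ \<Psi>2 Jt] lift_Jt[OF \<psi>2_mem] ce(2) Suc by auto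
    ultimately show "f \<in> ipow (polys A) Jt (Suc m)"
      using ideal_ofD(3)[OF I] by (simp add: ce(3) mult.commute[of \<Psi>2] del: ipow.simps power_Suc)
  qed
qed simp

text \<open>Quasi-regularity of \<open>\<psi>1, \<psi>2\<close> in \<open>A\<^sub>J\<close> in the form needed: \<open>s\<close> is regular modulo the forms.\<close>

lemma forms_cancel:
  "f \<in> polys A \<Longrightarrow> s * f \<in> forms m \<Longrightarrow> \<exists>u\<in>A - J. [:u:] * f \<in> forms m"
proof (induction m arbitrary: f)
  case 0
  then show ?case using prime_ofD(2)[OF J_prime] by (intro bexI[of _ 1]) auto
next
  case (Suc m)
  obtain c e where ce: "c \<in> polys A" "e \<in> forms m" "s * f = c * \<Psi>1 ^ Suc m + \<Psi>2 * e"
    using formsE[OF Suc.prems(2)] .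
  have eP: "e \<in> polys A" using ce(2) ideal_ofD(6)[OF forms_ideal] by blast
  have at0: "poly c 0 \<in> A" "poly e 0 \<in> A" using ce(1) eP polys_poly[OF csubring_axioms] by auto
  \<comment> \<open>At s = 0 the value of \<open>c\<close> times a power of \<open>\<psi>1\<close>
    becomes a multiple of \<open>\<psi>2\<close>, so by regularity the value itself is one, up to a
    factor outside \<open>J\<close>.\<close>
  have "poly (s * f) 0 = 0" by (simp add: s_def)
  then have "poly c 0 * \<psi>1 ^ Suc m = (- poly e 0) * \<psi>2"
    unfolding ce(3) by (simp add: lift_at_0 \<psi>1_mem \<psi>2_mem eq_neg_iff_add_eq_0 mult.commute del: power_Suc)
  then obtain u b where u: "u \<in> A - J" "b \<in> A" "u * poly c 0 = b * \<psi>2"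
    using \<psi>_regular_power[of "poly c 0" "- poly e 0" "Suc m"] at0 by blast
  have "[:u:] * c - [:b:] * \<Psi>2 \<in> polys A" using ce(1) u \<Psi>_mem const_mem by (intro P.diff P.mult) auto
  moreover have "poly ([:u:] * c - [:b:] * \<Psi>2) 0 = 0" by (simp add: lift_at_0 \<psi>2_mem u(3))
  ultimately obtain c' where c': "c' \<in> polys A" "[:u:] * c - [:b:] * \<Psi>2 = s * c'" by (rule s_divides)
  \<comment> \<open>After replacing \<open>[:u:] * c\<close> by
    \<open>s * c' + [:b:] * \<Psi>2\<close>, this is everything that multiplies
    \<open>\<Psi>2\<close>.\<close>
  define e' where "e' = [:u:] * e + ([:b:] * \<Psi>1) * \<Psi>1 ^ m"
  have e': "e' \<in> forms m"
    unfolding e'_def using ce(2) u forms_power \<Psi>_mem const_mem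
    by (intro ideal_ofD(3)[OF forms_ideal] ideal_ofD(4)[OF forms_ideal] P.mult) auto
  have uc: "[:u:] * c = s * c' + [:b:] * \<Psi>2" using c'(2) by (simp add: diff_eq_eq)
  have "[:u:] * (s * f) = ([:u:] * c) * \<Psi>1 ^ Suc m + \<Psi>2 * ([:u:] * e)"
    by (simp only: ce(3) distrib_left ac_simps)
  also have "\<dots> = s * (c' * \<Psi>1 ^ Suc m) + \<Psi>2 * e'"
    unfolding uc e'_def by (simp add: algebra_simps)
  finally have eq: "s * ([:u:] * f - c' * \<Psi>1 ^ Suc m) = \<Psi>2 * e'"
    by (simp add: right_diff_distrib ac_simps)
  \<comment> \<open>Since \<open>\<Psi>2\<close> does not vanish at 0, s divides \<open>e'\<close>,
    and the induction hypothesis applies to the quotient.\<close>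
  then have "poly (\<Psi>2 * e') 0 = 0" by (metis poly_0_coeff_0 s_def poly_mult poly_pCons mult_zero_left add.right_neutral)
  then have "poly e' 0 = 0" using \<psi>2_nonzero by (simp add: lift_at_0 \<psi>2_mem)
  moreover have "e' \<in> polys A" using e' ideal_ofD(6)[OF forms_ideal] by blast
  ultimately obtain f' where f': "f' \<in> polys A" "e' = s * f'" using s_divides by blast
  obtain u' where u': "u' \<in> A - J" "[:u':] * f' \<in> forms m" using Suc.IH[OF f'(1)] e' f'(2) by blast
  have "s * ([:u:] * f - c' * \<Psi>1 ^ Suc m) = s * (\<Psi>2 * f')" unfolding eq f'(2) by (simp add: ac_simps)
  then have "[:u:] * f = c' * \<Psi>1 ^ Suc m + \<Psi>2 * f'" by (simp add: s_def diff_eq_eq add.commute)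
  then have "[:u' * u:] * f = ([:u':] * c') * \<Psi>1 ^ Suc m + \<Psi>2 * ([:u':] * f')"
    by (metis (no_types, lifting) distrib_left mult.assoc mult.left_commute mult_pCons_left mult_zero_left pCons_0_0 add_0_right smult_pCons smult_0_right)
  moreover have "([:u':] * c') * \<Psi>1 ^ Suc m + \<Psi>2 * ([:u':] * f') \<in> forms (Suc m)"
    by (rule formsI[OF P.mult u'(2)]) (use u' c' const_mem in auto)
  ultimately show ?case using J_compl_mult[OF u'(1) u(1)] by (intro bexI[of _ "u' * u"]) auto
qed

text \<open>Multiplication by the m-th power of the \<open>h\<close> from
  \<open>two_generators\<close> moves the power of \<open>Jt\<close> into \<open>forms m\<close>,
  where s cancels up to a factor outside \<open>J\<close>.\<close>

lemma cancel_s: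
  assumes G: "G \<in> polys A" "s * G \<in> ipow (polys A) Jt m"
  shows "\<exists>h\<in>polys A. poly h 0 \<in> A - J \<and> h * G \<in> ipow (polys A) Jt m"
proof -
  obtain h where h: "h \<in> polys A" "poly h 0 \<in> A - J"
    "\<And>f. f \<in> Jt \<Longrightarrow> \<exists>a\<in>polys A. \<exists>b\<in>polys A. h * f = a * \<Psi>1 + b * \<Psi>2"
    using two_generators by metis
  have "h ^ m * f \<in> forms m" if "f \<in> ipow (polys A) Jt m" for f m
    using that
  proof (induction m arbitrary: f)
    case (Suc m)
    from Suc.prems have "f \<in> idprod (ipow (polys A) Jt m) Jt" by simp
    then show ?case
    proof induction
      case (prod a b)
      obtain \<alpha> \<beta> where ab: "\<alpha> \<in> polys A" "\<beta> \<in> polys A" "h * b = \<alpha> * \<Psi>1 + \<beta> * \<Psi>2" using h(3)[OF prod(2)] by blast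
      have e: "h ^ m * a \<in> forms m" by (rule Suc.IH[OF prod(1)])
      have "h ^ Suc m * (a * b) = (h ^ m * a) * (h * b)" by (simp add: ac_simps)
      also have "\<dots> = \<alpha> * (\<Psi>1 * (h ^ m * a)) + \<beta> * (\<Psi>2 * (h ^ m * a))"
        unfolding ab(3) by (simp only: distrib_left ac_simps)
      finally have eq: "h ^ Suc m * (a * b) = \<alpha> * (\<Psi>1 * (h ^ m * a)) + \<beta> * (\<Psi>2 * (h ^ m * a))" .
      show ?case
        unfolding eq
        by (intro ideal_ofD(3)[OF forms_ideal] ideal_ofD(4)[OF forms_ideal ab(1)]
            ideal_ofD(4)[OF forms_ideal ab(2)] forms_\<Psi>1[OF e] forms_\<Psi>2[OF e])
    next
      case (sum f g)
      then show ?case using ideal_ofD(3)[OF forms_ideal] by (simp only: distrib_left)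
    qed
  qed simp
  from this[OF G(2)] have "s * (h ^ m * G) \<in> forms m" by (simp add: ac_simps)
  then obtain u where u: "u \<in> A - J" "[:u:] * (h ^ m * G) \<in> forms m"
    using forms_cancel[of "h ^ m * G"] G(1) h(1) by auto
  have "poly ([:u:] * h ^ m) 0 \<in> A - J"
  proof -
    have "(poly h 0) ^ m \<in> A - J" using h(2) prime_power[OF J_prime] by auto
    then show ?thesis using J_compl_mult[OF u(1)] by (simp add: poly_power)
  qed
  moreover have "([:u:] * h ^ m) * G \<in> ipow (polys A) Jt m" using u(2) forms_Jt by (auto simp: mult.assoc)
  moreover have "[:u:] * h ^ m \<in> polys A" using u(1) h(1) const_mem by (intro P.mult P.power) auto
  ultimately show ?thesis by blast
qed

text \<open>If \<open>J\<^sup>m\<close> had no embedded component, neither had the power of the deformed ideal; its order along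
  \<open>M\<close> would then bound the coefficients of all polynomials that it contains generically.\<close>

lemma coefficients_in_M_power:
  assumes cl: "\<And>a e. a \<in> A - J \<Longrightarrow> e \<in> A \<Longrightarrow> a * e \<in> ipow A J m \<Longrightarrow> e \<in> ipow A J m"
    and "G \<in> polys A" "h \<in> polys A" "poly h 0 \<in> A - J" "h * G \<in> ipow (polys A) Jt m"
  shows "coeff G i \<in> ipow A M (2 * m)"
  using assms(2-)
proof (induction i arbitrary: G h rule: less_induct)
  case (less i G h)
  note I = P.ipow_ideal[OF Jt_ideal]
  have "poly h 0 * poly G 0 \<in> ipow A J m" using poly_0_ipow[OF less.prems(4)] by simp
  then have "poly G 0 \<in> ipow A J m"
    using cl[OF less.prems(3)] polys_poly[OF csubring_axioms less.prems(1)] by auto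
  \<comment> \<open>\<open>F\<close> lies in the power itself and agrees with \<open>G\<close> at 0.
    The quotient \<open>G'\<close> of \<open>G - F\<close> by s satisfies the hypotheses again, with
    multiplier \<open>h' * h\<close> and with the coefficients shifted by one.\<close>
  then obtain F where F: "F \<in> ipow (polys A) Jt m" "poly F 0 = poly G 0" by (rule lift_J_power)
  have FP: "F \<in> polys A" using F(1) ideal_ofD(6)[OF I] by blast
  obtain G' where G': "G' \<in> polys A" "G - F = s * G'" "\<And>i. coeff G' i = coeff (G - F) (Suc i)"
    using s_divides[of "G - F"] less.prems(1) FP F(2) by (auto intro: P.diff)
  have Fi: "coeff F i \<in> ipow A M (2 * m)" using F(1) Jt_power_M polysD by blast
  show ?case
  proof (cases i)
    case 0
    then show ?thesis using F(2) Fi by (simp add: poly_0_coeff_0)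
  next
    case (Suc n)
    have "h * G - h * F \<in> ipow (polys A) Jt m"
      using P.ideal_diff[OF I less.prems(4)] ideal_ofD(4)[OF I less.prems(2) F(1)] by blast
    moreover have "h * G - h * F = s * (h * G')" by (metis G'(2) mult.left_commute right_diff_distrib)
    ultimately obtain h' where h': "h' \<in> polys A" "poly h' 0 \<in> A - J" "h' * (h * G') \<in> ipow (polys A) Jt m"
      using cancel_s[of "h * G'"] G'(1) less.prems(2) by auto
    have "coeff G' n \<in> ipow A M (2 * m)"
    proof (rule less.IH[of n G' "h' * h"])
      show "poly (h' * h) 0 \<in> A - J" using J_compl_mult[OF h'(2) less.prems(3)] by simp
    qed (use Suc G' h' less.prems in \<open>auto simp: mult.assoc\<close>)
    then show ?thesis
      using G'(3)[of n] Fi ideal_ofD(3)[OF ipow_ideal[OF M_ideal], of "coeff G' n" "2 * m" "coeff F i"] Suc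
      by simp
  qed
qed

text \<open>Modulo \<open>YZ\<close> the ideal \<open>M\<close> is generated by \<open>x\<close>, so
  \<open>ipow A M n\<close> lies in (x^n) + YZ. Membership of x^(n-1) would, up to the unit
  \<open>1 - a * x\<close>, put this power into the prime \<open>YZ\<close>.\<close>

lemma x_power_notin:
  assumes "n > 0"
  shows "x ^ (n - 1) \<notin> ipow A M n"
proof
  define U where "U n = {a * x ^ n + w |a w. a \<in> A \<and> w \<in> YZ}" for n
  have U_ideal: "ideal_of A (U n)" for n
    unfolding ideal_of_def
  proof (intro conjI ballI subsetI)
    show "a \<in> A" if "a \<in> U n" for a
      using that yz_mem ideal_ofD(6)[OF YZ_ideal] by (auto simp: U_def)
    show "0 \<in> U n" using ideal_ofD(2)[OF YZ_ideal] by (auto simp: U_def intro!: exI[of _ 0])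
    fix a b assume "a \<in> U n" "b \<in> U n"
    then obtain c d v w where "c \<in> A" "d \<in> A" "v \<in> YZ" "w \<in> YZ" "a = c * x ^ n + v" "b = d * x ^ n + w"
      unfolding U_def by blast
    then show "a + b \<in> U n"
      unfolding U_def using ideal_ofD(3)[OF YZ_ideal]
      by (intro CollectI exI[of _ "c + d"] exI[of _ "v + w"]) (auto simp: algebra_simps)
  next
    fix r a assume "r \<in> A" "a \<in> U n"
    then obtain c v where "c \<in> A" "v \<in> YZ" "a = c * x ^ n + v" unfolding U_def by blast
    then show "r * a \<in> U n"
      unfolding U_def using ideal_ofD(4)[OF YZ_ideal] \<open>r \<in> A\<close>
      by (intro CollectI exI[of _ "r * c"] exI[of _ "r * v"]) (auto simp: algebra_simps)
  qed
  have "ipow A M n \<subseteq> U n"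
  proof (induction n)
    case 0
    show ?case using ideal_ofD(2)[OF YZ_ideal] by (force simp: U_def)
  next
    case (Suc n)
    show ?case
      unfolding ipow.simps
    proof (rule idprod_least[OF U_ideal])
      fix a b assume "a \<in> ipow A M n" "b \<in> M"
      obtain c w where c: "c \<in> A" "w \<in> YZ" "a = c * x ^ n + w"
        using Suc \<open>a \<in> ipow A M n\<close> unfolding U_def by blast
      obtain d where d: "d \<in> A" "b - d * x \<in> YZ" using M_mod_YZ[OF \<open>b \<in> M\<close>] .
      have "a * b = (c * d) * x ^ Suc n + (c * x ^ n * (b - d * x) + w * b)"
        by (simp add: c(3) algebra_simps)
      moreover have "c * x ^ n * (b - d * x) + w * b \<in> YZ"
        using c d yz_mem \<open>b \<in> M\<close> M_sub
        by (intro ideal_ofD(3)[OF YZ_ideal] ideal_ofD(4)[OF YZ_ideal] ideal_ofD(5)[OF YZ_ideal]) auto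
      ultimately show "a * b \<in> U (Suc n)"
        unfolding U_def using c(1) d(1)
        by (intro CollectI exI[of _ "c * d"] exI[of _ "c * x ^ n * (b - d * x) + w * b"]) auto
    qed
  qed
  moreover assume "x ^ (n - 1) \<in> ipow A M n"
  ultimately obtain a w where aw: "a \<in> A" "w \<in> YZ" "x ^ (n - 1) = a * x ^ n + w" unfolding U_def by blast
  have "x ^ n = x * x ^ (n - 1)" using assms by (cases n) auto
  then have "x ^ (n - 1) * (1 - a * x) = w" using aw(3) by (simp add: algebra_simps)
  moreover have "inverse (1 - a * x) \<in> A" "1 - a * x \<noteq> 0"
    using one_minus_inverse[of "a * x"] aw(1) x ideal_ofD(4)[OF M_ideal] by auto
  ultimately have "x ^ (n - 1) = inverse (1 - a * x) * w" by (simp add: field_simps)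
  then have "x ^ (n - 1) \<in> YZ"
    using aw(2) \<open>inverse (1 - a * x) \<in> A\<close> ideal_ofD(4)[OF YZ_ideal] by simp
  then show False using prime_power[OF YZ_prime yz_mem(3)] x_notin_YZ by blast
qed

theorem power_has_embedded_component:
  assumes m: "m \<ge> 2"
  shows "\<exists>a\<in>A - J. \<exists>e\<in>A. a * e \<in> ipow A J m \<and> e \<notin> ipow A J m"
proof (rule ccontr)
  assume "\<not> ?thesis"
  then have cl: "\<And>a e. a \<in> A - J \<Longrightarrow> e \<in> A \<Longrightarrow> a * e \<in> ipow A J m \<Longrightarrow> e \<in> ipow A J m" by blast
  have "\<forall>l j. \<exists>b c d. l < 2 \<and> j < N \<longrightarrow> b \<in> A \<and> c \<in> A \<and> d \<in> A \<and> k l j = b * y + c * z + d * x"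
    using k_M N_ge_3 M_generated by (metis less_trans less_irrefl_nat less_le_trans numeral_2_eq_2 numeral_3_eq_3 lessI)
  then obtain ky kz kx where kk: "\<And>l j. l < 2 \<Longrightarrow> j < N \<Longrightarrow>
      ky l j \<in> A \<and> kz l j \<in> A \<and> kx l j \<in> A \<and> k l j = ky l j * y + kz l j * z + kx l j * x"
    by metis
  define L where "L w l j = (\<Sum>i<N. [:w l i:] * \<Delta> i) + s * j" for w :: "nat \<Rightarrow> nat \<Rightarrow> 'f" and l j
  \<comment> \<open>The relations of rows 0 and 1 among the minors, sorted by the parameters: P
    collects row 0 and Q row 1. The last argument of \<open>L\<close> is the contribution of the
    deformation: (x, y, z) contributes the minors 0, 1, 2, and (0, x, y) contributes the minors 1, 2
    and nothing for \<open>z\<close>.\<close>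
  define Px Py Pz Qx Qy Qz where "Px = L kx 0 (\<Delta> 0)" and "Py = L ky 0 (\<Delta> 1)" and "Pz = L kz 0 (\<Delta> 2)"
    and "Qx = L kx 1 (\<Delta> 1)" and "Qy = L ky 1 (\<Delta> 2)" and "Qz = L kz 1 0"
  have L_Jt: "L w l j \<in> Jt" if "\<And>i. i < N \<Longrightarrow> w l i \<in> A" "j \<in> Jt" for w l j
  proof -
    have "(\<Sum>i<N. [:w l i:] * \<Delta> i) \<in> Jt"
      unfolding Jt_def by (rule lin_spanI) (use that const_mem in auto)
    then show ?thesis
      unfolding L_def using ideal_ofD(3)[OF Jt_ideal] ideal_ofD(4)[OF Jt_ideal s_mem that(2)] by blast
  qed
  have PQ_Jt: "Px \<in> Jt" "Py \<in> Jt" "Pz \<in> Jt" "Qx \<in> Jt" "Qy \<in> Jt" "Qz \<in> Jt"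
    unfolding Px_def Py_def Pz_def Qx_def Qy_def Qz_def
    by (intro L_Jt; use kk \<Delta>_Jt N_ge_3 ideal_ofD(2)[OF Jt_ideal] in auto)+
  have shift_sum: "(\<Sum>j<N. [:shift 0 j:] * w j) = [:x:] * w 0 + [:y:] * w 1 + [:z:] * w 2"
    "(\<Sum>j<N. [:shift 1 j:] * w j) = [:x:] * w 1 + [:y:] * w 2" for w :: "nat \<Rightarrow> 'f poly"
  proof -
    have "(\<Sum>j<N. [:shift l j:] * w j) = (\<Sum>j\<in>{0, 1, 2}. [:shift l j:] * w j)" if "l < 2" for l
      using N_ge_3 that by (intro sum.mono_neutral_right) (auto simp: shift_def less_2_cases_iff)
    from this[of 0] this[of 1]
    show "(\<Sum>j<N. [:shift 0 j:] * w j) = [:x:] * w 0 + [:y:] * w 1 + [:z:] * w 2"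
      "(\<Sum>j<N. [:shift 1 j:] * w j) = [:x:] * w 1 + [:y:] * w 2"
      by (simp_all add: shift_def add.assoc)
  qed
  have rows: "(\<Sum>j<N. Xm l j * \<Delta> j) = [:y:] * (\<Sum>i<N. [:ky l i:] * \<Delta> i) + [:z:] * (\<Sum>i<N. [:kz l i:] * \<Delta> i)
    + [:x:] * (\<Sum>i<N. [:kx l i:] * \<Delta> i) + s * (\<Sum>j<N. [:shift l j:] * \<Delta> j)" if l: "l < 2" for l
  proof -
    have "Xm l j = [:y:] * [:ky l j:] + [:z:] * [:kz l j:] + [:x:] * [:kx l j:] + s * [:shift l j:]"
      if "j < N" for j
      using kk[OF l that] by (simp add: Xm_def s_def mult.commute)
    then have "(\<Sum>j<N. Xm l j * \<Delta> j) = (\<Sum>j<N. ([:y:] * [:ky l j:] + [:z:] * [:kz l j:] + [:x:] * [:kx l j:] + s * [:shift l j:]) * \<Delta> j)"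
      by (intro sum.cong) auto
    then show ?thesis by (simp only: distrib_right sum.distrib sum_distrib_left mult.assoc)
  qed
  have relP: "[:x:] * Px + [:y:] * Py + [:z:] * Pz = 0"
    using rows[of 0, unfolded shift_sum] Xm_\<Delta>[of 0] N_ge_3
    by (simp add: Px_def Py_def Pz_def L_def shift_sum algebra_simps del: mult_pCons_left mult_pCons_right)
  have relQ: "[:x:] * Qx + [:y:] * Qy + [:z:] * Qz = 0"
    using rows[of 1, unfolded shift_sum] Xm_\<Delta>[of 1] N_ge_3
    by (simp add: Qx_def Qy_def Qz_def L_def shift_sum algebra_simps del: mult_pCons_left mult_pCons_right)
  \<comment> \<open>The cross product of P and Q. Both are orthogonal to (x, y, z), so it is
    proportional to (x, y, z), and the factor of proportionality is \<open>F\<close> below.\<close>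
  define Dx Dy Dz where "Dx = Py * Qz - Pz * Qy" and "Dy = Pz * Qx - Px * Qz" and "Dz = Px * Qy - Py * Qx"
  have zDy: "[:z:] * Dy = [:y:] * Dz"
  proof -
    have "[:z:] * Dy - [:y:] * Dz
        = Qx * ([:x:] * Px + [:y:] * Py + [:z:] * Pz) - Px * ([:x:] * Qx + [:y:] * Qy + [:z:] * Qz)"
      by (simp add: Dy_def Dz_def algebra_simps del: mult_pCons_left mult_pCons_right)
    then show ?thesis by (simp only: relP relQ) simp
  qed
  have xDy: "[:x:] * Dy = [:y:] * Dx"
  proof -
    have "[:x:] * Dy - [:y:] * Dx
        = Pz * ([:x:] * Qx + [:y:] * Qy + [:z:] * Qz) - Qz * ([:x:] * Px + [:y:] * Py + [:z:] * Pz)"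
      by (simp add: Dy_def Dx_def algebra_simps del: mult_pCons_left mult_pCons_right)
    then show ?thesis by (simp only: relP relQ) simp
  qed
  note JtP = ideal_ofD(6)[OF Jt_ideal]
  have D_mem: "Dy \<in> polys A" "Dz \<in> polys A"
    unfolding Dy_def Dz_def using PQ_Jt JtP by (auto intro!: P.diff P.mult)
  define F where "F = smult (inverse y) Dy"
  have yF: "[:y:] * F = Dy" using y_nonzero by (simp add: F_def)
  have xF: "[:x:] * F = Dx"
  proof -
    have "[:y:] * ([:x:] * F) = [:y:] * Dx" using xDy yF by (simp only: mult.left_commute)
    then show ?thesis using y_nonzero mult_left_cancel[of "[:y:]"] by (metis pCons_eq_0_iff)
  qed
  \<comment> \<open>The division by \<open>y\<close> stays in the ring: \<open>z * Dy\<close> is a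
    multiple of \<open>y\<close> coefficientwise, and \<open>z\<close> is regular modulo
    \<open>y\<close>.\<close>
  have F_mem: "F \<in> polys A"
    unfolding polys_def
  proof (intro CollectI allI)
    fix i
    have "coeff ([:z:] * Dy) i = coeff ([:y:] * Dz) i" by (simp only: zDy)
    then have "z * coeff Dy i = y * coeff Dz i" by simp
    then obtain c where "c \<in> A" "coeff Dy i = y * c"
      using z_regular polysD[OF D_mem(1)] polysD[OF D_mem(2)] by blast
    then show "coeff F i \<in> A" using y_nonzero by (simp add: F_def flip: mult.assoc)
  qed
  define n where "n = N - 1"
  have N: "N = Suc n" using N_ge_3 by (simp add: n_def)
  have deg_\<Delta>: "degree (\<Delta> i) \<le> n" and top_\<Delta>: "coeff (\<Delta> 2) n = x\<^sup>2" for i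
    using \<Delta>_top by (auto simp: n_def)
  have s_top: "coeff (s * f) (Suc i) = coeff f i" for f i by (simp add: s_def)
  have deg_sum: "degree (\<Sum>i<N. [:w i:] * \<Delta> i) \<le> n" for w
    by (intro degree_sum_le) (auto intro: order.trans[OF degree_smult_le deg_\<Delta>] simp: deg_\<Delta>)
  have deg_L: "degree (L w l j) \<le> N" if "degree j \<le> n" for w l j
  proof -
    have "degree (s * j) \<le> N"
      using degree_mult_le[of s j] that N_ge_3 by (auto simp: s_def n_def split: if_splits)
    moreover have "degree (\<Sum>i<N. [:w l i:] * \<Delta> i) \<le> N"
      using deg_sum[of "w l"] unfolding n_def by linarith
    ultimately show ?thesis unfolding L_def by (rule degree_add_le[rotated])
  qed
  have top_L: "coeff (L w l j) N = coeff j n" for w l j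
  proof -
    have "degree (\<Sum>i<N. [:w l i:] * \<Delta> i) < N" using deg_sum[of "w l"] N by linarith
    then have "coeff (\<Sum>i<N. [:w l i:] * \<Delta> i) N = 0" by (rule coeff_eq_0)
    moreover have "coeff (s * j) N = coeff j n" using s_top[of j n] N by simp
    ultimately show ?thesis by (simp add: L_def)
  qed
  have deg_PQ: "degree Px \<le> N" "degree Py \<le> N" "degree Pz \<le> N" "degree Qx \<le> N" "degree Qy \<le> N" "degree Qz \<le> N"
    unfolding Px_def Py_def Pz_def Qx_def Qy_def Qz_def using deg_L deg_\<Delta> by auto
  \<comment> \<open>Only the product of \<open>Pz\<close> and \<open>Qy\<close> contributes: both
    have top coefficient x^2 from \<open>\<Delta> 2\<close>, while \<open>Qz\<close> has no term of
    degree \<open>N\<close>.\<close>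
  have "coeff Dx (N + N) = - (x\<^sup>2 * x\<^sup>2)"
    unfolding Dx_def coeff_diff
    using coeff_mult_top[OF deg_PQ(2,6)] coeff_mult_top[OF deg_PQ(3,5)]
    by (simp add: Pz_def Qy_def Qz_def top_L top_\<Delta>)
  then have "x * coeff F (N + N) = - (x\<^sup>2 * x\<^sup>2)" by (simp flip: xF)
  moreover have x0: "x \<noteq> 0" using x_notin_YZ ideal_ofD(2)[OF YZ_ideal] by auto
  moreover have "x * coeff F (N + N) = x * - (x ^ 3) \<longleftrightarrow> coeff F (N + N) = - (x ^ 3)"
    by (rule mult_left_cancel[OF x0])
  ultimately have topF: "coeff F (N + N) = - (x ^ 3)" by (simp add: power2_eq_square power3_eq_cube)
  have degF: "degree F \<le> N + N"
  proof -
    have "degree Dy \<le> N + N"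
      unfolding Dy_def using deg_PQ
      by (intro degree_diff_le) (auto intro!: order.trans[OF degree_mult_le] add_mono)
    then show ?thesis using degree_smult_le[of "inverse y" Dy] by (simp add: F_def)
  qed
  \<comment> \<open>The additional minors make \<open>[:y:] * G\<close> a member of the m-th power.
    The exponent of \<open>x\<close> on top is 3 + 2 (m - 2) = 2 m - 1, one less than membership in
    that power allows.\<close>
  define G where "G = F * \<Delta> 2 ^ (m - 2)"
  have "coeff G (N + N + (m - 2) * n) = - (x ^ 3) * (x\<^sup>2) ^ (m - 2)"
    unfolding G_def
    using coeff_mult_top[OF degF coeff_power_top(2)[OF deg_\<Delta>[of 2], of "m - 2"]]
      coeff_power_top(1)[OF deg_\<Delta>[of 2], of "m - 2"] topF top_\<Delta> by simp
  also have "\<dots> = - (x ^ (2 * m - 1))"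
  proof -
    obtain q where "m = q + 2" using m by (metis add.commute le_Suc_ex)
    then show ?thesis by (simp add: power_add power_mult[symmetric] power3_eq_cube)
  qed
  finally have top: "coeff G (N + N + (m - 2) * n) = - (x ^ (2 * m - 1))" .
  have "[:y:] * G = Dy * \<Delta> 2 ^ (m - 2)" unfolding G_def yF[symmetric] by (simp only: mult.assoc)
  moreover have "Dy * \<Delta> 2 ^ (m - 2) \<in> ipow (polys A) Jt (2 + (m - 2))"
  proof (rule P.ipow_mult[OF Jt_ideal _ P.ipow_power[OF Jt_ideal \<Delta>_Jt]])
    have "f * g \<in> ipow (polys A) Jt 2" if "f \<in> Jt" "g \<in> Jt" for f g
      using P.ipow_mult[OF Jt_ideal, of f 1 g 1] that P.ipow_1[OF Jt_ideal] by (simp add: numeral_2_eq_2)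
    then show "Dy \<in> ipow (polys A) Jt 2"
      unfolding Dy_def using PQ_Jt by (intro P.ideal_diff P.ipow_ideal Jt_ideal) auto
  qed (use N_ge_3 in auto)
  ultimately have "[:y:] * G \<in> ipow (polys A) Jt m" by (simp only: le_add_diff_inverse[OF m])
  moreover have "G \<in> polys A" unfolding G_def using F_mem \<Delta>_mem by auto
  ultimately have "coeff G (N + N + (m - 2) * n) \<in> ipow A M (2 * m)"
    using coefficients_in_M_power[where G = G and h = "[:y:]", OF cl] const_mem yz_mem(1) y_notin_J by auto
  then have "x ^ (2 * m - 1) \<in> ipow A M (2 * m)"
    using top ideal_uminus[OF ipow_ideal[OF M_ideal]] by fastforce
  then show False using x_power_notin[of "2 * m"] m by simp
qed

end

context generic_complete_intersection
begin

theorem power_embedded: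
  assumes "m \<ge> 2"
  shows "\<exists>a\<in>A - J. \<exists>e\<in>A. a * e \<in> ipow A J m \<and> e \<notin> ipow A J m"
proof -
  obtain k where k: "\<forall>l\<in>{..<N} - {2}. \<forall>j<N. k l j \<in> M"
    "J = lin_span A N (\<lambda>i. dt N (k(2 := unit_row i)))"
    "\<forall>v. (\<forall>j<N. v j \<in> A) \<longrightarrow> (\<Sum>j<N. v j * dt N (k(2 := unit_row j))) = 0 \<longrightarrow>
      (\<exists>c. (\<forall>l\<in>{..<N} - {2}. c l \<in> A) \<and> (\<forall>i<N. v i = (\<Sum>l\<in>{..<N} - {2}. c l * k l i)))"
    using hilbert_burch[of 2] N_ge_3 by (auto elim!: exE conjE)
  interpret deformation A M y z x J N D \<psi>1 \<psi>2 k
    by unfold_locales (use k in auto)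
  show ?thesis by (rule power_has_embedded_component[OF assms])
qed

end

section \<open>Polynomial extensions of subrings\<close>

lemma (in noetherian_subring) noetherian_image:
  assumes h: "\<And>a b. h (a + b) = h a + (h b :: 'b::comm_ring_1)" "\<And>a b. h (a * b) = h a * h b" "h 0 = 0"
  shows "noetherian_of (h ` S)"
  unfolding noetherian_of_def
proof (intro allI impI)
  fix I assume I: "ideal_of (h ` S) I"
  define K where "K = {a\<in>S. h a \<in> I}"
  have "ideal_of S K"
    using ideal_ofD[OF I] unfolding ideal_of_def K_def by (auto simp: h)
  then obtain n g where g: "\<forall>i<n. g i \<in> K" "K = lin_span S n g" using noetherian unfolding noetherian_of_def by blast
  have hsum: "h (sum f Y) = (\<Sum>i\<in>Y. h (f i))" for f and Y :: "nat set"
    by (induction Y rule: infinite_finite_induct) (auto simp: h)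
  have "I \<subseteq> lin_span (h ` S) n (\<lambda>i. h (g i))"
  proof
    fix b assume b: "b \<in> I"
    then obtain a where a: "a \<in> S" "b = h a" using ideal_ofD(1)[OF I] by blast
    then have "a \<in> lin_span S n g" using b g(2) by (auto simp: K_def)
    then obtain c where c: "\<And>i. i < n \<Longrightarrow> c i \<in> S" "a = (\<Sum>i<n. c i * g i)" by (metis lin_spanE)
    then have "b = (\<Sum>i<n. h (c i) * h (g i))" by (simp add: a hsum h)
    then show "b \<in> lin_span (h ` S) n (\<lambda>i. h (g i))"
      using lin_spanI[of n "\<lambda>i. h (c i)" "h ` S" "\<lambda>i. h (g i)"] c(1) by auto
  qed
  moreover have "lin_span (h ` S) n (\<lambda>i. h (g i)) \<subseteq> I"
    by (rule lin_span_least[OF I]) (use g in \<open>auto simp: K_def\<close>)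
  ultimately show "\<exists>n g. (\<forall>i<n. g i \<in> I) \<and> I = lin_span (h ` S) n g"
    using g(1) by (intro exI[of _ n] exI[of _ "\<lambda>i. h (g i)"]) (auto simp: K_def)
qed

lemma (in csubring) monom_mem: "a \<in> S \<Longrightarrow> monom a n \<in> polys S"
  unfolding polys_def by (auto simp: coeff_monom)

text \<open>Leading coefficients are reduced by finitely many generators of the ideal
  \<open>L\<close> down to degrees below \<open>d\<close>; below that bound the coefficient vectors
  form a submodule of finite rank.\<close>

theorem (in noetherian_subring) hilbert_basis: "noetherian_of (polys S)"
  unfolding noetherian_of_def
proof (intro allI impI)
  fix I assume I: "ideal_of (polys S) I"
  interpret P: csubring "polys S" by (rule csubring_polys)
  note I_mem = polysD[OF ideal_ofD(6)[OF I]]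
  \<comment> \<open>Bounding the degree instead of fixing it makes \<open>L\<close> closed under
    addition even when leading terms cancel.\<close>
  define L where "L = {coeff f n |f n. f \<in> I \<and> degree f \<le> n}"
  have "ideal_of S L"
    unfolding ideal_of_def
  proof (intro conjI ballI subsetI)
    show "a \<in> S" if "a \<in> L" for a using that I_mem by (auto simp: L_def)
    show "0 \<in> L" unfolding L_def using ideal_ofD(2)[OF I] by (intro CollectI exI[of _ 0] exI[of _ "0::nat"]) auto
    show "s * a \<in> L" if "s \<in> S" "a \<in> L" for s a
    proof -
      from that obtain f n where "f \<in> I" "degree f \<le> n" "a = coeff f n" by (auto simp: L_def)
      moreover have "[:s:] \<in> polys S" using that(1) monom_mem[of s 0] by (simp add: monom_0)
      ultimately show ?thesis
        unfolding L_def using ideal_ofD(4)[OF I, of "[:s:]" f] degree_smult_le[of s f]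
        by (intro CollectI exI[of _ "[:s:] * f"] exI[of _ n]) auto
    qed
    fix a b assume "a \<in> L" "b \<in> L"
    then obtain f m g n where fg: "f \<in> I" "degree f \<le> m" "a = coeff f m" "g \<in> I" "degree g \<le> n" "b = coeff g n"
      by (auto simp: L_def)
    define h where "h = monom 1 n * f + monom 1 m * g"
    have "h \<in> I" unfolding h_def using fg monom_mem[OF one] by (intro ideal_ofD(3)[OF I] ideal_ofD(4)[OF I]) auto
    moreover have "coeff h (m + n) = a + b" by (simp add: h_def coeff_monom_mult fg)
    moreover have "degree h \<le> m + n"
      unfolding h_def using fg degree_monom_le[of "1::'a" n] degree_monom_le[of "1::'a" m]
      by (intro degree_add_le order.trans[OF degree_mult_le]) auto
    ultimately show "a + b \<in> L" unfolding L_def by (intro CollectI exI[of _ h] exI[of _ "m + n"]) auto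
  qed
  then obtain t e where e: "\<forall>i<t. e i \<in> L" "L = lin_span S t e"
    using noetherian unfolding noetherian_of_def by blast
  have "\<exists>f n. f \<in> I \<and> degree f \<le> n \<and> coeff f n = e i" if "i < t" for i
  proof -
    from e(1) that have "e i \<in> L" by blast
    then show ?thesis unfolding L_def by force
  qed
  then obtain f df where f: "\<And>i. i < t \<Longrightarrow> f i \<in> I \<and> degree (f i) \<le> df i \<and> coeff (f i) (df i) = e i" by metis
  define d where "d = (\<Sum>i<t. df i)"
  have df: "df i \<le> d" if "i < t" for i unfolding d_def using that by (simp add: member_le_sum)
  define K where "K = {v. (\<forall>j<d. v j \<in> S) \<and> (\<Sum>j<d. monom (v j) j) \<in> I}"
  have "submodule d K"
  proof -
    have scale: "(\<Sum>j<d. monom (a * v j) j) = [:a:] * (\<Sum>j<d. monom (v j) j)" for a v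
      unfolding sum_distrib_left by (intro sum.cong) (auto simp: smult_monom)
    have "(\<Sum>j<d. monom (v j + w j) j) = (\<Sum>j<d. monom (v j) j) + (\<Sum>j<d. monom (w j) j)" for v w :: "nat \<Rightarrow> 'a"
      by (simp add: sum.distrib add_monom[symmetric])
    moreover have "(\<Sum>j<d. monom (a * v j) j) \<in> I" if "a \<in> S" "(\<Sum>j<d. monom (v j) j) \<in> I" for a v
      unfolding scale using that ideal_ofD(4)[OF I] monom_mem[of a 0] by (metis monom_0)
    ultimately show ?thesis
      unfolding submodule_def K_def using ideal_ofD(2,3)[OF I] by auto
  qed
  from submodule_finitely_generated[OF this] obtain n g where g: "\<forall>i<n. g i \<in> K" "K \<subseteq> vspan n g d" by blast
  define b where "b i = (if i < n then (\<Sum>j<d. monom (g i j) j) else f (i - n))" for i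
  have bI: "b i \<in> I" if "i < n + t" for i using that g(1) f by (auto simp: b_def K_def)
  have gens: "lin_span (polys S) (n + t) b \<subseteq> I" by (rule lin_span_least[OF I bI])
  have B: "ideal_of (polys S) (lin_span (polys S) (n + t) b)"
    by (rule P.lin_span_ideal) (use bI ideal_ofD(6)[OF I] in auto)
  have bgen: "b i \<in> lin_span (polys S) (n + t) b" if "i < n + t" for i using P.lin_span_gen[OF that] .
  have "h \<in> lin_span (polys S) (n + t) b" if "h \<in> I" for h
    using that
  proof (induction "degree h" arbitrary: h rule: less_induct)
    case less
    show ?case
    proof (cases "h = 0 \<or> degree h < d")
      case True
      have h: "h = (\<Sum>j<d. monom (coeff h j) j)"
        using True by (intro poly_eqI) (auto simp: coeff_sum coeff_monom coeff_eq_0)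
      then have "coeff h \<in> K" using less.prems I_mem by (auto simp: K_def)
      then obtain c where c: "\<forall>i<n. c i \<in> S" "\<forall>j<d. coeff h j = (\<Sum>i<n. c i * g i j)"
        using g(2) unfolding vspan_def by blast
      have "monom (sum f Y) j = (\<Sum>i\<in>Y. monom (f i) j)" for f :: "nat \<Rightarrow> 'a" and Y j
        by (induction Y rule: infinite_finite_induct) (auto simp: add_monom[symmetric])
      then have "(\<Sum>j<d. monom (coeff h j) j) = (\<Sum>j<d. \<Sum>i<n. [:c i:] * monom (g i j) j)"
        using c(2) by (intro sum.cong) (auto simp: smult_monom)
      then have "h = (\<Sum>j<d. \<Sum>i<n. [:c i:] * monom (g i j) j)" using h by simp
      also have "\<dots> = (\<Sum>i<n. [:c i:] * b i)"
        by (subst sum.swap) (auto simp: b_def sum_distrib_left intro!: sum.cong)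
      also have "\<dots> \<in> lin_span (polys S) (n + t) b"
        using c(1) bgen monom_mem[of _ 0] by (intro ideal_of_sum[OF B] ideal_ofD(4)[OF B]) (auto simp: monom_0)
      finally show ?thesis .
    next
      case False
      then have dh: "d \<le> degree h" "h \<noteq> 0" by auto
      have "coeff h (degree h) \<in> L" using less.prems by (auto simp: L_def)
      then obtain c where c: "\<And>i. i < t \<Longrightarrow> c i \<in> S" "coeff h (degree h) = (\<Sum>i<t. c i * e i)"
        unfolding e(2) by (metis lin_spanE)
      define k where "k = (\<Sum>i<t. monom (c i) (degree h - df i) * f i)"
      have le: "df i \<le> degree h" if "i < t" for i using df[OF that] dh by simp
      have kB: "k \<in> lin_span (polys S) (n + t) b"
        unfolding k_def
      proof (intro ideal_of_sum[OF B] ideal_ofD(4)[OF B] monom_mem)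
        fix i assume "i \<in> {..<t}"
        then show "f i \<in> lin_span (polys S) (n + t) b" using bgen[of "n + i"] by (auto simp: b_def)
      qed (use c in auto)
      have deg_k: "degree k \<le> degree h"
        unfolding k_def
      proof (intro degree_sum_le)
        fix i assume "i \<in> {..<t}"
        then show "degree (monom (c i) (degree h - df i) * f i) \<le> degree h"
          using f[of i] le[of i] degree_monom_le[of "c i" "degree h - df i"]
            degree_mult_le[of "monom (c i) (degree h - df i)" "f i"] by auto
      qed auto
      have "coeff k (degree h) = (\<Sum>i<t. c i * e i)"
        unfolding k_def coeff_sum by (intro sum.cong) (use f le in \<open>auto simp: coeff_monom_mult\<close>)
      then have top: "coeff (h - k) (degree h) = 0" using c by simp
      have hk: "h - k \<in> lin_span (polys S) (n + t) b"
      proof (cases "h - k = 0")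
        case True
        then show ?thesis using ideal_ofD(2)[OF B] by simp
      next
        case False
        have "degree (h - k) \<le> degree h" using deg_k by (intro degree_diff_le) auto
        moreover have "degree (h - k) \<noteq> degree h" using top False by (metis leading_coeff_0_iff)
        ultimately show ?thesis
          using less.hyps[of "h - k"] P.ideal_diff[OF I less.prems] kB gens by auto
      qed
      have "h = (h - k) + k" by simp
      then show ?thesis using ideal_ofD(3)[OF B hk kB] by metis
    qed
  qed
  then have "I = lin_span (polys S) (n + t) b" using gens by blast
  then show "\<exists>n g. (\<forall>i<n. g i \<in> I) \<and> I = lin_span (polys S) n g" using bI by blast
qed

text \<open>Each step multiplies by the leading coefficient instead of dividing by it. The number
  \<open>k\<close> of steps also bounds the quotient, which \<open>invertible_mod\<close>
  needs.\<close>

lemma (in csubring) pseudo_division: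
  assumes G: "G \<in> polys S" "degree G \<le> n"
    and F: "F \<in> polys S" "\<And>i. i \<ge> n + k \<Longrightarrow> coeff F i = 0"
  shows "\<exists>e q r. q \<in> polys S \<and> r \<in> polys S \<and> [:coeff G n ^ e:] * F = q * G + r \<and>
    (\<forall>i\<ge>k. coeff q i = 0) \<and> (\<forall>i\<ge>n. coeff r i = 0)"
  using F
proof (induction k arbitrary: F)
  case 0
  show ?case
    by (rule exI[of _ "0::nat"], rule exI[of _ 0], rule exI[of _ F]) (use 0 in \<open>auto simp: polys_def\<close>)
next
  case (Suc k)
  interpret P: csubring "polys S" by (rule csubring_polys)
  define l a where "l = coeff G n" and "a = coeff F (n + k)"
  have la: "l \<in> S" "a \<in> S" using polysD[OF G(1)] polysD[OF Suc.prems(1)] by (auto simp: l_def a_def)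
  have const: "[:c:] \<in> polys S" if "c \<in> S" for c using that monom_mem[of c 0] by (simp add: monom_0)
  define F' where "F' = [:l:] * F - monom a k * G"
  have "F' \<in> polys S"
    unfolding F'_def using const[OF la(1)] monom_mem[OF la(2)] Suc.prems(1) G(1) by (intro P.diff P.mult)
  moreover have "coeff F' i = 0" if "i \<ge> n + k" for i
  proof (cases "i = n + k")
    case True
    then show ?thesis by (simp add: F'_def coeff_monom_mult l_def a_def mult.commute[of "coeff G n"])
  next
    case False
    then show ?thesis using that Suc.prems(2) G(2) by (simp add: F'_def coeff_monom_mult coeff_eq_0)
  qed
  ultimately obtain e q r where *: "q \<in> polys S" "r \<in> polys S" "[:l ^ e:] * F' = q * G + r"
    "\<forall>i\<ge>k. coeff q i = 0" "\<forall>i\<ge>n. coeff r i = 0"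
    using Suc.IH[of F'] by (auto simp: l_def)
  define q' where "q' = q + [:l ^ e:] * monom a k"
  have "[:l ^ Suc e:] * F = [:l ^ e:] * ([:l:] * F)" by simp
  also have "[:l:] * F = F' + monom a k * G" by (simp add: F'_def)
  also have "[:l ^ e:] * (F' + monom a k * G) = q' * G + r"
    unfolding q'_def distrib_left *(3) by (simp add: algebra_simps)
  finally have "[:coeff G n ^ Suc e:] * F = q' * G + r" by (simp add: l_def)
  moreover have "q' \<in> polys S"
    unfolding q'_def using *(1) const[OF power[OF la(1)]] monom_mem[OF la(2)] by (intro P.add P.mult)
  moreover have "\<forall>i\<ge>Suc k. coeff q' i = 0" using *(4) by (auto simp: q'_def coeff_monom)
  ultimately show ?case using *(2,5) by blast
qed

section \<open>Adjoining one element to a subring\<close>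

definition adjoin :: "'a::comm_ring_1 \<Rightarrow> 'a set \<Rightarrow> 'a set"
  where "adjoin v S = (\<lambda>F. poly F v) ` polys S"

lemma adjoinI: "F \<in> polys S \<Longrightarrow> poly F v \<in> adjoin v S"
  by (auto simp: adjoin_def)

lemma adjoin_mono: "S \<subseteq> T \<Longrightarrow> adjoin v S \<subseteq> adjoin v T"
  unfolding adjoin_def by (intro image_mono polys_mono)

lemma (in csubring) const_polys: "a \<in> S \<Longrightarrow> [:a:] \<in> polys S"
  using monom_mem[of a 0] by (simp add: monom_0)

lemma (in csubring) adjoin_sub: "S \<subseteq> adjoin v S"
  using adjoinI[OF const_polys] by force

lemma (in csubring) adjoin_var: "v \<in> adjoin v S"
  using adjoinI[OF monom_mem[OF one, of 1], of v] by (simp add: poly_monom)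

lemma (in csubring) csubring_adjoin: "csubring (adjoin v S)"
proof -
  interpret P: csubring "polys S" by (rule csubring_polys)
  show ?thesis
  proof
    show "0 \<in> adjoin v S" "1 \<in> adjoin v S" using adjoin_sub by auto
    fix a b assume "a \<in> adjoin v S" "b \<in> adjoin v S"
    then obtain F G where FG: "F \<in> polys S" "G \<in> polys S" "a = poly F v" "b = poly G v" by (auto simp: adjoin_def)
    show "a + b \<in> adjoin v S" using adjoinI[OF P.add[OF FG(1,2)], of v] FG by simp
    show "a * b \<in> adjoin v S" using adjoinI[OF P.mult[OF FG(1,2)], of v] FG by simp
    show "- a \<in> adjoin v S" using adjoinI[OF P.uminus[OF FG(1)], of v] FG by simp
  qed
qed

lemma (in noetherian_subring) noetherian_adjoin: "noetherian_of (adjoin v S)"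
proof -
  interpret P: noetherian_subring "polys S"
    by (intro noetherian_subring.intro csubring_polys noetherian_subring_axioms.intro hilbert_basis)
  show ?thesis unfolding adjoin_def by (rule P.noetherian_image) auto
qed

locale polynomial_extension = csubring S for S :: "'a::idom set" +
  fixes v :: 'a
  assumes transcendental: "F \<in> polys S \<Longrightarrow> poly F v = 0 \<Longrightarrow> F = 0"
begin

sublocale P: csubring "polys S"
  by (rule csubring_polys)

lemma poly_eqD: "F \<in> polys S \<Longrightarrow> G \<in> polys S \<Longrightarrow> poly F v = poly G v \<Longrightarrow> F = G"
  using transcendental[of "F - G"] P.diff by auto

text \<open>Evaluation at a transcendental element is injective, so the claim is
  \<open>prime_polys\<close> transported along it.\<close>

lemma adjoin_prime:
  assumes Q: "prime_of S Q"
  shows "prime_of (adjoin v S) (adjoin v Q)"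
proof -
  note PQ = prime_polys[OF Q] and I = polys_ideal[OF prime_ofD(1)[OF Q]]
  show ?thesis
    unfolding prime_of_def ideal_of_def
  proof (intro conjI ballI impI subsetI)
    show "a \<in> adjoin v S" if "a \<in> adjoin v Q" for a
      using that adjoin_mono ideal_ofD(1)[OF prime_ofD(1)[OF Q]] by blast
    show "0 \<in> adjoin v Q" using adjoinI[OF ideal_ofD(2)[OF I], of v] by simp
    show "a + b \<in> adjoin v Q" if "a \<in> adjoin v Q" "b \<in> adjoin v Q" for a b
      using that adjoinI[OF ideal_ofD(3)[OF I], of _ _ v] by (auto simp: adjoin_def)
    show "a * b \<in> adjoin v Q" if "a \<in> adjoin v S" "b \<in> adjoin v Q" for a b
      using that adjoinI[OF ideal_ofD(4)[OF I], of _ _ v] by (auto simp: adjoin_def)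
    show "1 \<notin> adjoin v Q"
    proof
      assume "1 \<in> adjoin v Q"
      then obtain F where F: "F \<in> polys Q" "poly F v = poly 1 v" by (auto simp: adjoin_def)
      have "F \<in> polys S" using F(1) ideal_ofD(1)[OF I] by blast
      then have "F = 1" using poly_eqD[OF _ P.one F(2)] by blast
      then show False using F(1) prime_ofD(2)[OF PQ] by simp
    qed
    fix a b assume "a \<in> adjoin v S" "b \<in> adjoin v S" "a * b \<in> adjoin v Q"
    then obtain F G H where FG: "F \<in> polys S" "G \<in> polys S" "H \<in> polys Q" "a = poly F v" "b = poly G v"
      "poly F v * poly G v = poly H v" by (auto simp: adjoin_def)
    have "F * G = H" by (rule poly_eqD) (use FG ideal_ofD(1)[OF I] in auto)
    then show "a \<in> adjoin v Q \<or> b \<in> adjoin v Q"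
      using prime_ofD(3)[OF PQ FG(1,2)] FG adjoinI by metis
  qed
qed

lemma adjoin_contract:
  assumes "Q \<subseteq> S" "0 \<in> Q"
  shows "adjoin v Q \<inter> S = Q"
proof
  show "adjoin v Q \<inter> S \<subseteq> Q"
  proof
    fix a assume a: "a \<in> adjoin v Q \<inter> S"
    then obtain F where F: "F \<in> polys Q" "a = poly F v" by (auto simp: adjoin_def)
    have "F = [:a:]"
      by (rule poly_eqD) (use a F polys_mono[OF assms(1)] const_polys in auto)
    then show "a \<in> Q" using polysD[OF F(1), of 0] by simp
  qed
  have "[:a:] \<in> polys Q" if "a \<in> Q" for a using that assms(2) by (auto simp: polys_def coeff_pCons split: nat.splits)
  then show "Q \<subseteq> adjoin v Q \<inter> S" using assms(1) adjoinI[of "[:_:]" Q v] by force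
qed

end

text \<open>The element \<open>v\<close> is transcendental over \<open>S\<close> but algebraic over
  it modulo \<open>P\<close>. The prime is one of the whole ring, so a single \<open>P\<close>
  serves every step of a tower, and quotients appear only as membership in \<open>P\<close>.\<close>

locale algebraic_step = polynomial_extension S v for S :: "'a::idom set" and v +
  fixes P :: "'a set"
  assumes prime: "prime_of UNIV P"
    and algebraic: "\<exists>F\<in>polys S - polys P. poly F v \<in> P"
begin

lemmas P_ideal = prime_ofD(1)[OF prime]

lemma poly_in_P: "F \<in> polys P \<Longrightarrow> poly F v \<in> P"
  unfolding poly_altdef by (auto intro!: ideal_of_sum[OF P_ideal] ideal_ofD(5)[OF P_ideal] dest: polysD)

text \<open>Cutting off the highest coefficients in \<open>P\<close> changes the value only modulo
  \<open>P\<close> and leaves a leading coefficient outside \<open>P\<close>.\<close>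

lemma truncate:
  assumes F: "F \<in> polys S" "F \<notin> polys P" "\<And>i. i \<ge> k \<Longrightarrow> coeff F i = 0"
  obtains G n where "G \<in> polys S" "degree G \<le> n" "coeff G n \<notin> P" "poly F v - poly G v \<in> P" "n < k"
proof -
  have ex: "\<exists>i. coeff F i \<notin> P" using F(2) unfolding polys_def by blast
  define n where "n = (GREATEST i. coeff F i \<notin> P)"
  have bnd: "\<And>i. coeff F i \<notin> P \<Longrightarrow> i \<le> k"
    using F(3) ideal_ofD(2)[OF P_ideal] by (metis nat_le_linear)
  have n: "coeff F n \<notin> P"
    unfolding n_def using GreatestI_ex_nat[OF ex bnd] .
  have gt: "coeff F i \<in> P" if "i > n" for i
    using Greatest_le_nat[of "\<lambda>i. coeff F i \<notin> P" i k] bnd that unfolding n_def by fastforce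
  define G where "G = poly_cutoff (Suc n) F"
  have "coeff G i = (if i \<le> n then coeff F i else 0)" for i by (simp add: G_def coeff_poly_cutoff less_Suc_eq_le)
  moreover from this have "degree G \<le> n" by (intro degree_le) auto
  moreover have "F - G \<in> polys P" using gt ideal_ofD(2)[OF P_ideal] calculation(1) by (auto simp: polys_def)
  moreover have "n < k" using n F(3)[of n] ideal_ofD(2)[OF P_ideal] by (metis not_le)
  ultimately show ?thesis
    using that[of G n] n poly_in_P[of "F - G"] polysD[OF F(1)] by (auto simp: polys_def)
qed

text \<open>The degree of the minimal polynomial of \<open>v\<close> over the field of fractions of
  \<open>S\<close> modulo \<open>P\<close>.\<close>

definition N where "N = (LEAST n. \<exists>F\<in>polys S. degree F \<le> n \<and> coeff F n \<notin> P \<and> poly F v \<in> P)"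

lemma N_ex: "\<exists>F\<in>polys S. degree F \<le> N \<and> coeff F N \<notin> P \<and> poly F v \<in> P"
proof -
  obtain F where F: "F \<in> polys S" "F \<notin> polys P" "poly F v \<in> P" using algebraic by blast
  obtain G n where G: "G \<in> polys S" "degree G \<le> n" "coeff G n \<notin> P" "poly F v - poly G v \<in> P"
    using truncate[OF F(1,2), of "Suc (degree F)"] by (metis coeff_eq_0 Suc_le_eq)
  have "poly G v \<in> P" using csubring.ideal_diff[OF csubring_UNIV P_ideal F(3) G(4)] by simp
  then show ?thesis
    unfolding N_def using G by (intro LeastI[of "\<lambda>n. \<exists>F\<in>polys S. degree F \<le> n \<and> coeff F n \<notin> P \<and> poly F v \<in> P" n]) blast
qed

lemma N_least: "F \<in> polys S \<Longrightarrow> degree F \<le> n \<Longrightarrow> coeff F n \<notin> P \<Longrightarrow> poly F v \<in> P \<Longrightarrow> N \<le> n"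
  unfolding N_def by (rule Least_le) blast

lemma low_degree:
  assumes "F \<in> polys S" "poly F v \<in> P" "\<And>i. i \<ge> N \<Longrightarrow> coeff F i = 0"
  shows "F \<in> polys P"
proof (rule ccontr)
  assume "F \<notin> polys P"
  then obtain G n where G: "G \<in> polys S" "degree G \<le> n" "coeff G n \<notin> P" "poly F v - poly G v \<in> P" "n < N"
    using truncate[OF assms(1) _ assms(3)] by blast
  have "poly G v \<in> P" using csubring.ideal_diff[OF csubring_UNIV P_ideal assms(2) G(4)] by simp
  then show False using N_least[OF G(1,2,3)] G(5) by simp
qed

definition minpoly where "minpoly = (SOME F. F \<in> polys S \<and> degree F \<le> N \<and> coeff F N \<notin> P \<and> poly F v \<in> P)"

lemma minpoly: "minpoly \<in> polys S" "degree minpoly \<le> N" "coeff minpoly N \<notin> P" "poly minpoly v \<in> P"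
  using someI_ex[of "\<lambda>F. F \<in> polys S \<and> degree F \<le> N \<and> coeff F N \<notin> P \<and> poly F v \<in> P"] N_ex
  unfolding minpoly_def by auto

lemma minpoly_notin: "poly minpoly v \<notin> adjoin v (P \<inter> S)"
proof
  assume "poly minpoly v \<in> adjoin v (P \<inter> S)"
  then obtain F where F: "F \<in> polys (P \<inter> S)" "poly minpoly v = poly F v" by (auto simp: adjoin_def)
  have "minpoly = F" by (rule poly_eqD) (use F minpoly polys_mono[of "P \<inter> S" S] in auto)
  then show False using F(1) minpoly(3) polysD by blast
qed

lemma leading_power_notin: "F \<in> polys S \<Longrightarrow> coeff F n \<notin> P \<Longrightarrow> coeff F n ^ e \<in> S - P"
  using csubring.prime_power[OF csubring_UNIV prime] polysD[of F S n] by auto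

text \<open>The remainder of pseudo-division by \<open>minpoly\<close> has a value in
  \<open>P\<close> and degree below \<open>N\<close>, so by minimality all its coefficients are in
  \<open>P\<close>.\<close>

lemma generates_locally:
  assumes f: "f \<in> adjoin v S" "f \<in> P"
  shows "\<exists>l\<in>S - P. \<exists>q\<in>adjoin v S. \<exists>r\<in>adjoin v (P \<inter> S). l * f = q * poly minpoly v + r"
proof -
  obtain F where F: "F \<in> polys S" "f = poly F v" using f by (auto simp: adjoin_def)
  have "coeff F i = 0" if "i \<ge> N + Suc (degree F)" for i using that by (simp add: coeff_eq_0)
  then obtain e q r where qr: "q \<in> polys S" "r \<in> polys S" "[:coeff minpoly N ^ e:] * F = q * minpoly + r"
    "\<forall>i\<ge>N. coeff r i = 0"
    using pseudo_division[OF minpoly(1,2) F(1)] by metis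
  define l where "l = coeff minpoly N ^ e"
  have l: "l \<in> S - P" unfolding l_def using leading_power_notin minpoly by blast
  have eq: "l * f = poly q v * poly minpoly v + poly r v"
    using arg_cong[OF qr(3), of "\<lambda>F. poly F v"] F(2) by (simp add: l_def)
  then have "poly r v = l * f - poly q v * poly minpoly v" by simp
  then have "poly r v \<in> P"
    using f minpoly(4) by (simp add: csubring.ideal_diff[OF csubring_UNIV P_ideal] ideal_ofD(4)[OF P_ideal])
  then have "r \<in> polys P" using low_degree qr by blast
  then have "r \<in> polys (P \<inter> S)" using qr(2) by (auto simp: polys_def)
  then show ?thesis using l qr(1) eq adjoinI by blast
qed

text \<open>Among the multiples of \<open>f\<close> outside \<open>P\<close>, one is represented
  modulo \<open>P\<close> by a polynomial \<open>F\<close> of least degree \<open>m\<close>, which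
  has to be 0. For m at least \<open>N\<close>, division by \<open>minpoly\<close> lowers the
  degree. For m between 0 and \<open>N\<close>, division of \<open>minpoly\<close> by
  \<open>F\<close> leaves a remainder with value in \<open>P\<close>, so \<open>F\<close> would
  divide the minimal polynomial modulo \<open>P\<close>.\<close>

lemma invertible_mod:
  assumes f: "f \<in> adjoin v S" "f \<notin> P"
  shows "\<exists>g\<in>adjoin v S. \<exists>c\<in>S - P. g * f - c \<in> P"
proof -
  note U = csubring_UNIV[where 'a = 'a]
  define Z where "Z m \<longleftrightarrow> (\<exists>F\<in>polys S. \<exists>g\<in>adjoin v S. degree F \<le> m \<and> coeff F m \<notin> P \<and> poly F v \<notin> P \<and>
    g * f - poly F v \<in> P)" for m
  interpret S': csubring "adjoin v S" by (rule csubring_adjoin)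
  have ZI: "\<exists>m<k. Z m"
    if z: "F \<in> polys S" "g \<in> adjoin v S" "poly F v \<notin> P" "g * f - poly F v \<in> P" "\<And>i. i \<ge> k \<Longrightarrow> coeff F i = 0" for F g k
  proof -
    have "F \<notin> polys P" using z(3) poly_in_P by blast
    then obtain G n where G: "G \<in> polys S" "degree G \<le> n" "coeff G n \<notin> P" "poly F v - poly G v \<in> P" "n < k"
      using truncate[OF z(1) _ z(5)] by blast
    have "poly G v \<notin> P" using ideal_ofD(3)[OF P_ideal G(4), of "poly G v"] z(3) by auto
    moreover have "g * f - poly G v \<in> P" using ideal_ofD(3)[OF P_ideal z(4) G(4)] by simp
    ultimately show ?thesis using G z(2) unfolding Z_def by blast
  qed
  obtain F0 where F0: "F0 \<in> polys S" "f = poly F0 v" using f by (auto simp: adjoin_def)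
  have exZ: "\<exists>m. Z m"
    using ZI[of F0 1 "Suc (degree F0)"] F0 f ideal_ofD(2)[OF P_ideal] by (auto simp: coeff_eq_0)
  define m where "m = (LEAST m. Z m)"
  have "Z m" unfolding m_def using LeastI_ex[OF exZ] .
  have m_le: "m \<le> n" if "Z n" for n unfolding m_def using that by (rule Least_le)
  from \<open>Z m\<close> obtain F g where F: "F \<in> polys S" "g \<in> adjoin v S" "degree F \<le> m" "coeff F m \<notin> P" "poly F v \<notin> P"
    "g * f - poly F v \<in> P" unfolding Z_def by blast
  show ?thesis
  proof (cases "m = 0")
    case True
    then have "F = [:coeff F 0:]" using F(3) by (metis le_zero_eq degree_eq_zeroE coeff_pCons_0)
    then have "poly F v = coeff F 0" by (metis poly_pCons poly_0 mult_zero_right add.right_neutral)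
    then show ?thesis using F True polysD[OF F(1)] by (intro bexI[of _ g] bexI[of _ "coeff F 0"]) auto
  next
    case False
    have "m < N"
    proof (rule ccontr)
      assume "\<not> m < N"
      have "coeff F i = 0" if "i \<ge> N + Suc m" for i using that F(3) by (simp add: coeff_eq_0)
      then obtain e q r where qr: "q \<in> polys S" "r \<in> polys S" "[:coeff minpoly N ^ e:] * F = q * minpoly + r"
        "\<forall>i\<ge>N. coeff r i = 0"
        using pseudo_division[OF minpoly(1,2) F(1)] by metis
      define l where "l = coeff minpoly N ^ e"
      have l: "l \<in> S - P" unfolding l_def using leading_power_notin minpoly by blast
      have eq: "l * poly F v = poly q v * poly minpoly v + poly r v"
        using arg_cong[OF qr(3), of "\<lambda>F. poly F v"] by (simp add: l_def)
      have qm: "poly q v * poly minpoly v \<in> P" using minpoly(4) ideal_ofD(4)[OF P_ideal] by blast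
      have "poly r v \<notin> P"
        using eq ideal_ofD(3)[OF P_ideal qm, of "poly r v"] prime_ofD(3)[OF prime, of l "poly F v"] l F(5) by auto
      moreover have "(l * g) * f - poly r v = l * (g * f - poly F v) + poly q v * poly minpoly v"
        using eq by (simp add: algebra_simps)
      then have "(l * g) * f - poly r v \<in> P"
        using ideal_ofD(3)[OF P_ideal ideal_ofD(4)[OF P_ideal _ F(6)] qm] by simp
      moreover have "l * g \<in> adjoin v S" using l F(2) adjoin_sub by blast
      ultimately obtain n where "n < N" "Z n" using ZI[OF qr(2)] qr(4) by blast
      then show False using m_le[of n] \<open>\<not> m < N\<close> by simp
    qed
    have "coeff minpoly i = 0" if "i \<ge> m + (Suc N - m)" for i
      using that \<open>m < N\<close> minpoly(2) by (simp add: coeff_eq_0)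
    then obtain e q r where qr: "q \<in> polys S" "r \<in> polys S" "[:coeff F m ^ e:] * minpoly = q * F + r"
      "\<forall>i\<ge>Suc N - m. coeff q i = 0" "\<forall>i\<ge>m. coeff r i = 0"
      using pseudo_division[OF F(1,3) minpoly(1), of "Suc N - m"] by metis
    define l where "l = coeff F m ^ e"
    have l: "l \<in> S - P" unfolding l_def using leading_power_notin F by blast
    have eq: "l * poly minpoly v = poly q v * poly F v + poly r v"
      using arg_cong[OF qr(3), of "\<lambda>F. poly F v"] by (simp add: l_def)
    have lm: "l * poly minpoly v \<in> P" using minpoly(4) ideal_ofD(4)[OF P_ideal] by blast
    have "poly r v \<in> P"
    proof (rule ccontr)
      assume r: "poly r v \<notin> P"
      have e': "(- poly q v * g) * f - poly r v = (- poly q v) * (g * f - poly F v) + - (l * poly minpoly v)"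
        using eq by (simp add: algebra_simps)
      have "(- poly q v * g) * f - poly r v \<in> P"
        unfolding e'
        by (intro ideal_ofD(3)[OF P_ideal] ideal_ofD(4)[OF P_ideal _ F(6)] csubring.ideal_uminus[OF U P_ideal lm] UNIV_I)
      moreover have "- poly q v * g \<in> adjoin v S" using F(2) adjoinI[OF qr(1)] by blast
      ultimately obtain n where "n < m" "Z n" using ZI[OF qr(2) _ r] qr(5) by blast
      then show False using m_le[of n] by simp
    qed
    then have "poly q v * poly F v \<in> P"
      using eq lm csubring.ideal_add_cancel[OF U P_ideal] by metis
    \<comment> \<open>The quotient has degree at most \<open>N - m\<close>, which is below
      \<open>N\<close> because \<open>m\<close> is positive. So its coefficients are in
      \<open>P\<close>, whereas the product with \<open>F\<close> has a coefficient outside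
      \<open>P\<close>.\<close>
    then have "poly q v \<in> P" using prime_ofD(3)[OF prime] F(5) by blast
    then have "q \<in> polys P" using low_degree[OF qr(1)] qr(4) False \<open>m < N\<close> by auto
    then have "q * F \<in> polys P" using csubring.coeff_mult_ideal[OF U P_ideal, of F q] by (auto simp: polys_def mult.commute)
    moreover have "coeff (q * F) N = l * coeff minpoly N"
      using arg_cong[OF qr(3), of "\<lambda>F. coeff F N"] qr(5) \<open>m < N\<close> by (simp add: l_def)
    ultimately have "l * coeff minpoly N \<in> P" using polysD by metis
    then show ?thesis using prime_ofD(3)[OF prime] l minpoly(3) by blast
  qed
qed

end

section \<open>Towers of simple algebraic steps\<close>

text \<open>A substitute for Noether normalization: \<open>S 0\<close> embeds into the quotient by
  \<open>P\<close>, and the remaining generators are adjoined one by one, each algebraic rather than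
  integral modulo \<open>P\<close>.\<close>

locale algebraic_tower =
  fixes S :: "nat \<Rightarrow> 'a::idom set" and v :: "nat \<Rightarrow> 'a" and r :: nat and P :: "'a set"
  assumes step: "i < r \<Longrightarrow> algebraic_step (S i) (v i) P"
    and S_Suc: "i < r \<Longrightarrow> S (Suc i) = adjoin (v i) (S i)"
    and S_top: "S r = UNIV"
    and prime: "prime_of UNIV P"
    and base: "P \<inter> S 0 = {0}"
begin

lemmas P_ideal = prime_ofD(1)[OF prime]

lemma subring: "i \<le> r \<Longrightarrow> csubring (S i)"
  using step[of i] S_top by (cases "i = r") (auto simp: algebraic_step_def polynomial_extension_def)

lemma extension: "i < r \<Longrightarrow> polynomial_extension (S i) (v i)"
  using step algebraic_step_def by blast

lemma S_mono: "i + d \<le> r \<Longrightarrow> S i \<subseteq> S (i + d)"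
proof (induction d)
  case (Suc d)
  then show ?case using csubring.adjoin_sub[OF subring[of "i + d"]] S_Suc[of "i + d"] by auto
qed auto

text \<open>The extension of the prime contracted to \<open>S i\<close> along the next
  \<open>d\<close> steps. At the top of the tower this gives \<open>E i\<close>, and the
  \<open>E i\<close> form a chain of primes from zero to \<open>P\<close>.\<close>

primrec Q :: "nat \<Rightarrow> nat \<Rightarrow> 'a set"
  where "Q i 0 = P \<inter> S i"
  | "Q i (Suc d) = adjoin (v (i + d)) (Q i d)"

definition E where "E i = Q i (r - i)"

text \<open>The future regular parameters at \<open>P\<close>: each one enters the chain of primes
  exactly at \<open>E (Suc i)\<close>.\<close>

definition \<psi> where "\<psi> i = poly (algebraic_step.minpoly (S i) (v i) P) (v i)"

lemma Q_prime: "i + d \<le> r \<Longrightarrow> prime_of (S (i + d)) (Q i d)"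
proof (induction d)
  case 0
  then interpret csubring "S i" using subring by simp
  show ?case
    using prime_ofD[OF prime] ideal_ofD[OF P_ideal] by (auto simp: prime_of_def ideal_of_def)
next
  case (Suc d)
  then show ?case using polynomial_extension.adjoin_prime[OF extension[of "i + d"]] S_Suc[of "i + d"] by simp
qed

lemma Q_sub_P: "i + d \<le> r \<Longrightarrow> Q i d \<subseteq> P"
proof (induction d)
  case (Suc d)
  then interpret algebraic_step "S (i + d)" "v (i + d)" P using step by simp
  have "polys (Q i d) \<subseteq> polys P" using Suc by (intro polys_mono) auto
  then show ?case using poly_in_P by (auto simp: adjoin_def)
qed auto

lemma Q_sub_S: "i + d \<le> r \<Longrightarrow> Q i d \<subseteq> S (i + d)"
  using ideal_ofD(1)[OF prime_ofD(1)[OF Q_prime]] .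

lemma Q_Suc: "Suc i + d \<le> r \<Longrightarrow> Q i (Suc d) \<subseteq> Q (Suc i) d"
proof (induction d)
  case 0
  then show ?case using Q_sub_P[of i 1] Q_sub_S[of i 1] by auto
next
  case (Suc d)
  then have "adjoin (v (i + Suc d)) (Q i (Suc d)) \<subseteq> adjoin (v (i + Suc d)) (Q (Suc i) d)"
    by (intro adjoin_mono) auto
  then show ?case by simp
qed

text \<open>A minimal polynomial is known to avoid only the one-step extension \<open>Q i 1\<close>.
  As it lies in \<open>S (Suc i)\<close>, contraction shows that it avoids all of
  \<open>E i\<close>.\<close>

lemma Q_contract: "Suc i + d \<le> r \<Longrightarrow> Q i (Suc d) \<inter> S (Suc i) \<subseteq> Q i 1"
proof (induction d)
  case (Suc d)
  have ij: "i + Suc d < r" "i + Suc d \<le> r" using Suc.prems by auto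
  have "adjoin (v (i + Suc d)) (Q i (Suc d)) \<inter> S (i + Suc d) = Q i (Suc d)"
    using ideal_ofD(2)[OF prime_ofD(1)[OF Q_prime[OF ij(2)]]] Q_sub_S[OF ij(2)]
    by (intro polynomial_extension.adjoin_contract[OF extension[OF ij(1)]])
  moreover have "S (Suc i) \<subseteq> S (i + Suc d)" using S_mono[of "Suc i" d] ij by simp
  ultimately show ?case using Suc.IH Suc.prems by (simp only: Q.simps(2)[of i "Suc d"]) auto
qed auto

lemma Q_base_sub: "i + d \<le> r \<Longrightarrow> P \<inter> S i \<subseteq> Q i d"
proof (induction d)
  case (Suc d)
  have "Q i d \<subseteq> adjoin (v (i + d)) (Q i d)"
  proof
    fix a assume "a \<in> Q i d"
    moreover have "0 \<in> Q i d" using ideal_ofD(2)[OF prime_ofD(1)[OF Q_prime[of i d]]] Suc by simp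
    ultimately have "[:a:] \<in> polys (Q i d)" by (simp add: pCons_in_polys) (auto simp: polys_def)
    from adjoinI[OF this, of "v (i + d)"] show "a \<in> adjoin (v (i + d)) (Q i d)" by simp
  qed
  then show ?case using Suc by auto
qed auto

lemma E_prime: "i \<le> r \<Longrightarrow> prime_of UNIV (E i)"
  using Q_prime[of i "r - i"] S_top by (simp add: E_def)

lemma E_sub_P: "i \<le> r \<Longrightarrow> E i \<subseteq> P"
  using Q_sub_P[of i "r - i"] by (simp add: E_def)

lemma E_top: "E r = P"
  using S_top by (simp add: E_def)

lemma E_0: "E 0 = {0}"
proof -
  have "Q 0 d = {0}" for d
  proof (induction d)
    case (Suc d)
    have "polys {0} = {0 :: 'a poly}" by (auto simp: polys_def poly_eq_iff)
    then show ?case using Suc by (simp add: adjoin_def)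
  qed (use base in auto)
  then show ?thesis by (simp add: E_def)
qed

lemma E_Suc: "i < r \<Longrightarrow> E i \<subseteq> E (Suc i)"
  using Q_Suc[of i "r - Suc i"] by (simp add: E_def Suc_diff_Suc del: Q.simps)

lemma \<psi>_mem:
  assumes "i < r"
  shows "\<psi> i \<in> E (Suc i)" "\<psi> i \<notin> E i" "\<psi> i \<in> P" "\<psi> i \<in> S (Suc i)"
proof -
  interpret algebraic_step "S i" "v i" P using step assms .
  have *: "\<psi> i \<in> P \<inter> S (Suc i)" using minpoly S_Suc[OF assms] adjoinI by (simp add: \<psi>_def)
  then show "\<psi> i \<in> P" "\<psi> i \<in> S (Suc i)" by auto
  show "\<psi> i \<in> E (Suc i)" using * Q_base_sub[of "Suc i" "r - Suc i"] assms by (auto simp: E_def)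
  have "\<psi> i \<notin> Q i 1" using minpoly_notin by (simp add: \<psi>_def)
  then show "\<psi> i \<notin> E i" using Q_contract[of i "r - Suc i"] * assms by (auto simp: E_def Suc_diff_Suc simp del: Q.simps)
qed

text \<open>The contraction of the ideal that the first \<open>i\<close> parameters generate in the
  localization at \<open>P\<close>.\<close>

definition Gen where "Gen i = {f. \<exists>l. l \<notin> P \<and> (\<exists>c. l * f = (\<Sum>j<i. c j * \<psi> j))}"

lemma Gen_ideal: "ideal_of UNIV (Gen i)"
  unfolding ideal_of_def
proof (intro conjI ballI)
  show "0 \<in> Gen i" using prime_ofD(2)[OF prime] by (auto simp: Gen_def intro!: exI[of _ 1] exI[of _ "\<lambda>_. 0"])
  fix f g assume "f \<in> Gen i" "g \<in> Gen i"
  then obtain l c m d where *: "l \<notin> P" "l * f = (\<Sum>j<i. c j * \<psi> j)" "m \<notin> P" "m * g = (\<Sum>j<i. d j * \<psi> j)"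
    by (auto simp: Gen_def)
  have "(l * m) * (f + g) = m * (l * f) + l * (m * g)" by (simp add: algebra_simps)
  also have "\<dots> = (\<Sum>j<i. (m * c j + l * d j) * \<psi> j)"
    unfolding * by (simp add: sum_distrib_left distrib_right sum.distrib mult.assoc)
  finally have "(l * m) * (f + g) = (\<Sum>j<i. (m * c j + l * d j) * \<psi> j)" .
  moreover have "l * m \<notin> P" using prime_ofD(3)[OF prime, of l m] * by blast
  ultimately show "f + g \<in> Gen i"
    unfolding Gen_def by (intro CollectI exI[of _ "l * m"] conjI exI[of _ "\<lambda>j. m * c j + l * d j"])
next
  fix a f assume "f \<in> Gen i"
  then obtain l c where *: "l \<notin> P" "l * f = (\<Sum>j<i. c j * \<psi> j)" by (auto simp: Gen_def)
  have "l * (a * f) = a * (l * f)" by simp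
  also have "\<dots> = (\<Sum>j<i. (a * c j) * \<psi> j)" unfolding * by (simp add: sum_distrib_left mult.assoc)
  finally show "a * f \<in> Gen i"
    using * unfolding Gen_def by (intro CollectI exI[of _ l] conjI exI[of _ "\<lambda>j. a * c j"])
qed auto

lemma Gen_Suc: "Gen i \<subseteq> Gen (Suc i)"
proof
  fix f assume "f \<in> Gen i"
  then obtain l c where *: "l \<notin> P" "l * f = (\<Sum>j<i. c j * \<psi> j)" by (auto simp: Gen_def)
  then show "f \<in> Gen (Suc i)"
    unfolding Gen_def by (intro CollectI exI[of _ l] conjI exI[of _ "\<lambda>j. if j < i then c j else 0"]) auto
qed

lemma Gen_\<psi>: "\<psi> i \<in> Gen (Suc i)"
  unfolding Gen_def using prime_ofD(2)[OF prime]
  by (intro CollectI exI[of _ 1] conjI exI[of _ "\<lambda>j. if j < i then 0 else 1"]) auto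

lemma Gen_adjoin: "Y \<subseteq> Gen i \<Longrightarrow> adjoin a Y \<subseteq> Gen i"
proof
  fix f assume Y: "Y \<subseteq> Gen i" and "f \<in> adjoin a Y"
  then obtain F where F: "F \<in> polys Y" "f = poly F a" by (auto simp: adjoin_def)
  show "f \<in> Gen i"
    unfolding F(2) poly_altdef
    using Y polysD[OF F(1)] by (intro ideal_of_sum[OF Gen_ideal] ideal_ofD(5)[OF Gen_ideal]) auto
qed

lemma Gen_cancel: "l \<notin> P \<Longrightarrow> l * f \<in> Gen i \<Longrightarrow> f \<in> Gen i"
proof -
  assume l: "l \<notin> P" and "l * f \<in> Gen i"
  then obtain m c where m: "m \<notin> P" "m * (l * f) = (\<Sum>j<i. c j * \<psi> j)" by (auto simp: Gen_def)
  then have "m * l \<notin> P" using l prime_ofD(3)[OF prime] by blast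
  then show "f \<in> Gen i" using m(2) unfolding Gen_def by (metis (mono_tags, lifting) mem_Collect_eq mult.assoc)
qed

text \<open>By \<open>generates_locally\<close>, passing from \<open>S i\<close> to
  \<open>S (Suc i)\<close> enlarges the contracted prime, up to multipliers, by the one parameter
  \<open>\<psi> i\<close>. The other part is in \<open>Q i 1\<close>, which is why the outer
  induction keeps \<open>d\<close> arbitrary. The inner induction only adjoins further
  elements.\<close>

lemma Q_sub_Gen: "i + d \<le> r \<Longrightarrow> Q i d \<subseteq> Gen i"
proof (induction i arbitrary: d)
  case 0
  then show ?case
  proof (induction d)
    case (Suc d)
    then show ?case using Gen_adjoin by auto
  qed (use base ideal_ofD(2)[OF Gen_ideal] in auto)
next
  case (Suc i)
  note outer = Suc.IH
  from Suc.prems show ?case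
  proof (induction d)
    case 0
    then interpret algebraic_step "S i" "v i" P using step by simp
    show ?case
    proof
      fix f assume "f \<in> Q (Suc i) 0"
      then have f: "f \<in> adjoin (v i) (S i)" "f \<in> P" using S_Suc[of i] 0 by auto
      from generates_locally[OF f] obtain l q s where *: "l \<in> S i - P" "s \<in> adjoin (v i) (P \<inter> S i)"
        "l * f = q * \<psi> i + s" unfolding \<psi>_def by blast
      have "s \<in> Gen (Suc i)" using outer[of 1] * 0 Gen_Suc by auto
      then have "l * f \<in> Gen (Suc i)"
        unfolding *(3) by (intro ideal_ofD(3)[OF Gen_ideal] ideal_ofD(4)[OF Gen_ideal] Gen_\<psi> UNIV_I)
      then show "f \<in> Gen (Suc i)" using Gen_cancel * by blast
    qed
  next
    case (Suc d)
    then show ?case using Gen_adjoin by auto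
  qed
qed

lemma E_generated:
  assumes "i \<le> r" "f \<in> E i"
  obtains l c where "l \<notin> P" "l * f = (\<Sum>j<i. c j * \<psi> j)"
  using Q_sub_Gen[of i "r - i"] assms unfolding E_def Gen_def by auto

lemma E_mono: "i \<le> j \<Longrightarrow> j \<le> r \<Longrightarrow> E i \<subseteq> E j"
proof (induction j rule: dec_induct)
  case (step j)
  then show ?case using E_Suc[of j] by auto
qed auto

lemma invertible_mod_P:
  assumes "f \<notin> P"
  obtains g c where "c \<in> S 0" "c \<notin> P" "g * f - c \<in> P"
proof -
  have "\<forall>f\<in>S i - P. \<exists>g. \<exists>c\<in>S 0 - P. g * f - c \<in> P" if "i \<le> r" for i
    using that
  proof (induction i)
    case 0
    show ?case
    proof
      fix f assume "f \<in> S 0 - P"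
      then show "\<exists>g. \<exists>c\<in>S 0 - P. g * f - c \<in> P"
        using ideal_ofD(2)[OF P_ideal] by (intro exI[of _ 1] bexI[of _ f]) auto
    qed
  next
    case (Suc i)
    interpret algebraic_step "S i" "v i" P using step Suc.prems by simp
    show ?case
    proof
      fix f assume "f \<in> S (Suc i) - P"
      then obtain g c where gc: "c \<in> S i - P" "g * f - c \<in> P"
        using invertible_mod[of f] S_Suc[of i] Suc.prems by auto
      have "\<exists>g. \<exists>c'\<in>S 0 - P. g * c - c' \<in> P" using Suc.IH Suc.prems gc(1) by auto
      then obtain g' c' where gc': "c' \<in> S 0 - P" "g' * c - c' \<in> P" by blast
      have eq: "(g' * g) * f - c' = g' * (g * f - c) + (g' * c - c')" by (simp add: algebra_simps)
      have "(g' * g) * f - c' \<in> P"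
        unfolding eq by (rule ideal_ofD(3)[OF P_ideal ideal_ofD(4)[OF P_ideal UNIV_I gc(2)] gc'(2)])
      then show "\<exists>g. \<exists>c\<in>S 0 - P. g * f - c \<in> P" using gc' by blast
    qed
  qed
  from this[of r] show ?thesis using that assms S_top by auto
qed

text \<open>The source of all the dimension theory below: the quotient by \<open>P\<close> is
  algebraic over \<open>S 0\<close>, so an element outside \<open>P\<close> has a multiple that is
  congruent modulo \<open>P\<close> to a nonzero element of the base.\<close>

lemma larger_prime_meets_base:
  assumes "ideal_of UNIV P'" "P \<subseteq> P'" "f \<in> P'" "f \<notin> P"
  shows "\<exists>c\<in>S 0. c \<in> P' \<and> c \<noteq> 0"
proof -
  obtain g c where *: "c \<in> S 0" "c \<notin> P" "g * f - c \<in> P" using invertible_mod_P[OF assms(4)] .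
  have "g * f - (g * f - c) \<in> P'"
    by (rule csubring.ideal_diff[OF csubring_UNIV assms(1) ideal_ofD(4)[OF assms(1) UNIV_I assms(3)]])
      (use assms(2) * in auto)
  then have "c \<in> P'" by simp
  moreover have "c \<noteq> 0" using * ideal_ofD(2)[OF P_ideal] by auto
  ultimately show ?thesis using * by blast
qed

end

section \<open>The polynomial ring in four variables\<close>

text \<open>The polynomial subring in the variables with index in \<open>T\<close>.\<close>

definition supported :: "4 set \<Rightarrow> 'k::field poly4 set"
  where "supported T = {f. \<forall>t\<in>Poly_Mapping.keys f. \<forall>i. i \<notin> T \<longrightarrow> Poly_Mapping.lookup t i = 0}"

lemma supported_mono: "T \<subseteq> T' \<Longrightarrow> supported T \<subseteq> supported T'"
  unfolding supported_def by auto

lemma supported_UNIV [simp]: "supported UNIV = UNIV"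
  unfolding supported_def by auto

lemma csubring_supported: "csubring (supported T :: 'k::field poly4 set)"
proof
  show "0 \<in> supported T" "1 \<in> supported T" by (auto simp: supported_def)
  fix f g :: "'k poly4" assume fg: "f \<in> supported T" "g \<in> supported T"
  show "f + g \<in> supported T"
    using fg Poly_Mapping.keys_add[of f g] by (auto simp: supported_def)
  have "Poly_Mapping.keys (- f) = Poly_Mapping.keys f" by (auto simp: in_keys_iff)
  then show "- f \<in> supported T" using fg by (simp add: supported_def)
  show "f * g \<in> supported T"
    unfolding supported_def
  proof (intro CollectI ballI allI impI)
    fix t i assume "t \<in> Poly_Mapping.keys (f * g)" "i \<notin> T"
    then obtain a b where "a \<in> Poly_Mapping.keys f" "b \<in> Poly_Mapping.keys g" "t = a + b"
      using subsetD[OF keys_mult, of t f g] by blast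
    then show "Poly_Mapping.lookup t i = 0" using fg \<open>i \<notin> T\<close> by (simp add: supported_def lookup_add)
  qed
qed

lemma poly_var_power: "poly_var i ^ n = Poly_Mapping.single (Poly_Mapping.single i n) 1"
  by (induction n) (auto simp: poly_var_def mult_single single_add[symmetric])

lemma poly_var_supported: "i \<in> T \<Longrightarrow> poly_var i \<in> supported T"
  by (auto simp: supported_def poly_var_def lookup_single when_def)

lemma keys_times_var_power:
  fixes f :: "'k::field poly4"
  assumes "f \<in> supported T" "i \<notin> T" "t \<in> Poly_Mapping.keys (f * poly_var i ^ n)"
  shows "Poly_Mapping.lookup t i = n"
proof -
  obtain a b where "a \<in> Poly_Mapping.keys f" "b \<in> Poly_Mapping.keys (poly_var i ^ n :: 'k poly4)" "t = a + b"
    using subsetD[OF keys_mult assms(3)] by blast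
  then show ?thesis using assms by (auto simp: supported_def poly_var_power lookup_add split: if_splits)
qed

text \<open>The coefficients do not involve variable \<open>i\<close>, so all monomials of the n-th
  summand have exponent n there, and different summands cannot cancel.\<close>

lemma polynomial_extension_supported:
  assumes i: "i \<notin> T"
  shows "polynomial_extension (supported T) (poly_var i :: 'k::field poly4)"
proof (intro polynomial_extension.intro csubring_supported polynomial_extension_axioms.intro)
  fix F :: "'k poly4 poly" assume F: "F \<in> polys (supported T)" "poly F (poly_var i) = 0"
  show "F = 0"
  proof (rule poly_eqI, rule ccontr)
    fix n assume "coeff F n \<noteq> coeff 0 n"
    then have "coeff F n * poly_var i ^ n \<noteq> 0" by (simp add: poly_var_power) (metis lookup_single_eq lookup_zero zero_neq_one)
    then obtain t where t: "t \<in> Poly_Mapping.keys (coeff F n * poly_var i ^ n)"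
      by (metis all_not_in_conv keys_eq_empty)
    have tn: "Poly_Mapping.lookup t i = n" using keys_times_var_power[OF polysD[OF F(1)] i t] .
    have "0 = Poly_Mapping.lookup (\<Sum>m\<le>degree F. coeff F m * poly_var i ^ m) t"
      using F(2) by (simp add: poly_altdef)
    also have "\<dots> = (\<Sum>m\<le>degree F. Poly_Mapping.lookup (coeff F m * poly_var i ^ m) t)"
      by (simp add: lookup_sum)
    also have "\<dots> = (\<Sum>m\<le>degree F. if m = n then Poly_Mapping.lookup (coeff F n * poly_var i ^ n) t else 0)"
    proof (intro sum.cong refl)
      fix m
      show "Poly_Mapping.lookup (coeff F m * poly_var i ^ m) t
          = (if m = n then Poly_Mapping.lookup (coeff F n * poly_var i ^ n) t else 0)"
        using keys_times_var_power[OF polysD[OF F(1)] i, of t m] tn by (auto simp: in_keys_iff)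
    qed
    also have "\<dots> = Poly_Mapping.lookup (coeff F n * poly_var i ^ n) t"
      using \<open>coeff F n \<noteq> coeff 0 n\<close> by (simp add: le_degree)
    finally show False using t by (simp add: in_keys_iff)
  qed
qed

lemma poly_mapping_decompose: "f = (\<Sum>t\<in>Poly_Mapping.keys f. Poly_Mapping.single t (Poly_Mapping.lookup f t))"
proof (rule poly_mapping_eqI)
  fix t
  have "Poly_Mapping.lookup (\<Sum>t\<in>Poly_Mapping.keys f. Poly_Mapping.single t (Poly_Mapping.lookup f t)) t
      = (\<Sum>u\<in>Poly_Mapping.keys f. if u = t then Poly_Mapping.lookup f t else 0)"
    by (auto simp: lookup_sum lookup_single when_def intro!: sum.cong)
  then show "Poly_Mapping.lookup f t = Poly_Mapping.lookup (\<Sum>t\<in>Poly_Mapping.keys f. Poly_Mapping.single t (Poly_Mapping.lookup f t)) t"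
    by (simp add: in_keys_iff)
qed

lemma supported_insert:
  "supported (insert i T) = adjoin (poly_var i) (supported T :: 'k::field poly4 set)"
proof
  interpret T: csubring "supported T :: 'k poly4 set" by (rule csubring_supported)
  interpret I: csubring "supported (insert i T) :: 'k poly4 set" by (rule csubring_supported)
  interpret Ad: csubring "adjoin (poly_var i) (supported T :: 'k poly4 set)" by (rule T.csubring_adjoin)
  show "adjoin (poly_var i) (supported T) \<subseteq> (supported (insert i T) :: 'k poly4 set)"
    unfolding adjoin_def
    using polys_poly[OF I.csubring_axioms _ poly_var_supported[of i "insert i T"]]
      polys_mono[OF supported_mono[of T "insert i T"]] by auto
  show "(supported (insert i T) :: 'k poly4 set) \<subseteq> adjoin (poly_var i) (supported T)"
  proof
    fix f :: "'k poly4" assume f: "f \<in> supported (insert i T)"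
    have "Poly_Mapping.single t (Poly_Mapping.lookup f t) \<in> adjoin (poly_var i) (supported T)"
      if t: "t \<in> Poly_Mapping.keys f" for t
    proof -
      define n where "n = Poly_Mapping.lookup t i"
      define u where "u = t - Poly_Mapping.single i n"
      have tu: "t = u + Poly_Mapping.single i n"
        by (rule poly_mapping_eqI) (auto simp: u_def n_def lookup_add lookup_minus lookup_single when_def)
      have "Poly_Mapping.lookup u j = 0" if "j \<notin> T" for j
        using f t that by (auto simp: u_def n_def lookup_minus lookup_single when_def supported_def)
      then have "Poly_Mapping.single u (Poly_Mapping.lookup f t) \<in> supported T"
        by (auto simp: supported_def)
      moreover have "Poly_Mapping.single t (Poly_Mapping.lookup f t)
          = Poly_Mapping.single u (Poly_Mapping.lookup f t) * poly_var i ^ n"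
        by (simp add: poly_var_power mult_single flip: tu)
      moreover have "(poly_var i ^ n :: 'k poly4) \<in> adjoin (poly_var i) (supported T)" by (rule Ad.power[OF T.adjoin_var])
      ultimately show ?thesis using Ad.mult T.adjoin_sub by (metis subsetD)
    qed
    then show "f \<in> adjoin (poly_var i) (supported T)"
      by (subst poly_mapping_decompose) (intro Ad.sum)
  qed
qed

lemma supported_empty:
  assumes "f \<in> supported {}"
  shows "\<exists>a. f = Poly_Mapping.single 0 a"
proof (intro exI poly_mapping_eqI)
  fix t
  have "t = 0" if "t \<in> Poly_Mapping.keys f"
    using assms that by (intro poly_mapping_eqI) (auto simp: supported_def)
  then show "Poly_Mapping.lookup f t = Poly_Mapping.lookup (Poly_Mapping.single 0 (Poly_Mapping.lookup f 0)) t"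
    by (auto simp: lookup_single when_def in_keys_iff)
qed

lemma noetherian_constants: "noetherian_of (supported {} :: 'k::field poly4 set)"
  unfolding noetherian_of_def
proof (intro allI impI)
  fix I :: "'k poly4 set" assume I: "ideal_of (supported {}) I"
  show "\<exists>n g. (\<forall>i<n. g i \<in> I) \<and> I = lin_span (supported {}) n g"
  proof (cases "I \<subseteq> {0}")
    case True
    then have "I = {0}" using ideal_ofD(2)[OF I] by blast
    then show ?thesis by (intro exI[of _ "0::nat"]) (auto simp: lin_span_def)
  next
    case False
    then obtain f where f: "f \<in> I" "f \<noteq> 0" by blast
    then obtain a where a: "f = Poly_Mapping.single 0 a" "a \<noteq> 0"
      using supported_empty ideal_ofD(1)[OF I] by (metis single_zero subsetD)
    have inv: "Poly_Mapping.single 0 (inverse a) \<in> supported {}" by (simp add: supported_def)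
    have "Poly_Mapping.single 0 (inverse a) * f \<in> I" using ideal_ofD(4)[OF I inv f(1)] .
    moreover have "Poly_Mapping.single 0 (inverse a) * f = 1" using a by (simp add: mult_single)
    ultimately have one: "1 \<in> I" by simp
    have "I = lin_span (supported {}) 1 (\<lambda>_. 1)"
      using ideal_ofD(1)[OF I] ideal_ofD(4)[OF I _ one] by (force simp: lin_span_def)
    then show ?thesis using one by (intro exI[of _ "1::nat"] exI[of _ "\<lambda>_. 1"]) auto
  qed
qed

lemma noetherian_supported: "noetherian_of (supported T :: 'k::field poly4 set)"
proof -
  have "finite T" by simp
  then show ?thesis
  proof (induction T rule: finite_induct)
    case (insert i T)
    interpret noetherian_subring "supported T :: 'k poly4 set"
      by (intro noetherian_subring.intro csubring_supported noetherian_subring_axioms.intro insert)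
    show ?case unfolding supported_insert by (rule noetherian_adjoin)
  qed (rule noetherian_constants)
qed

lemma noetherian_poly4: "noetherian_of (UNIV :: 'k::field poly4 set)"
  using noetherian_supported[of UNIV] by simp

section \<open>Transcendence degree of a prime\<close>

definition indep :: "4 set \<Rightarrow> 'k::field poly4 set \<Rightarrow> bool"
  where "indep B P \<longleftrightarrow> supported B \<inter> P = {0}"

text \<open>For a prime this is the transcendence degree of its residue field over the ground field.
  Sets of variables suffice, since the variables generate that field and so contain a transcendence
  base.\<close>

definition trdeg :: "'k::field poly4 set \<Rightarrow> nat"
  where "trdeg P = Max {card B |B. indep B P}"

lemma indep_antimono: "P \<subseteq> P' \<Longrightarrow> 0 \<in> P \<Longrightarrow> indep B P' \<Longrightarrow> indep B P"
  using csubring.zero[OF csubring_supported] by (auto simp: indep_def)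

lemma trdeg_ge: "indep B P \<Longrightarrow> card B \<le> trdeg P"
  unfolding trdeg_def by (rule Max_ge) auto

lemma trdeg_attained:
  fixes P :: "'k::field poly4 set"
  assumes "prime_of UNIV P"
  obtains B where "indep B P" "card B = trdeg P"
proof -
  have "indep {} P"
    unfolding indep_def
  proof
    note I = prime_ofD(1)[OF assms]
    show "{0} \<subseteq> supported {} \<inter> P" using ideal_ofD(2)[OF I] csubring.zero[OF csubring_supported] by auto
    show "supported {} \<inter> P \<subseteq> {0}"
    proof (rule ccontr)
      assume "\<not> ?thesis"
      then obtain f where f: "f \<in> supported {}" "f \<in> P" "f \<noteq> 0" by blast
      then obtain a where a: "f = Poly_Mapping.single 0 a" "a \<noteq> 0" using supported_empty by (metis single_zero)
      then have "Poly_Mapping.single 0 (inverse a) * f = 1" by (simp add: mult_single)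
      then show False using ideal_ofD(4)[OF I UNIV_I f(2)] prime_ofD(2)[OF assms] by metis
    qed
  qed
  moreover have "card B \<le> card (UNIV :: 4 set)" for B :: "4 set" by (rule card_mono) auto
  then have "finite {card B |B :: 4 set. indep B P}"
    by (intro finite_subset[of "{card B |B. indep B P}" "{..card (UNIV :: 4 set)}"]) blast+
  ultimately have "trdeg P \<in> {card B |B. indep B P}" unfolding trdeg_def by (intro Max_in) auto
  then show ?thesis using that by auto
qed

text \<open>Maximality of \<open>B\<close> is meant by inclusion only: it gives each remaining
  variable a relation over \<open>B\<close>, and the relation stays valid over all later
  stages.\<close>

lemma algebraic_tower_supported:
  fixes P :: "'k::field poly4 set"
  assumes P: "prime_of UNIV P" and B: "indep B P" and max: "\<And>i. i \<notin> B \<Longrightarrow> \<not> indep (insert i B) P"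
    and w: "inj_on w {..<r}" "w ` {..<r} = - B"
  shows "algebraic_tower (\<lambda>i. supported (B \<union> w ` {..<i})) (\<lambda>i. poly_var (w i)) r P"
proof (rule algebraic_tower.intro)
  fix i assume i: "i < r"
  have "w i \<in> - B" unfolding w(2)[symmetric] using i by blast
  moreover have "w i \<noteq> w j" if "j < i" for j using inj_onD[OF w(1), of i j] i that by auto
  ultimately have wi: "w i \<notin> B \<union> w ` {..<i}" by auto
  interpret polynomial_extension "supported (B \<union> w ` {..<i}) :: 'k poly4 set" "poly_var (w i)"
    by (rule polynomial_extension_supported[OF wi])
  show "algebraic_step (supported (B \<union> w ` {..<i})) (poly_var (w i)) P"
  proof
    have "\<not> indep (insert (w i) B) P" using max wi by blast
    then obtain g where g: "g \<in> supported (insert (w i) B)" "g \<in> P" "g \<noteq> 0"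
      using ideal_ofD(2)[OF prime_ofD(1)[OF P]] csubring.zero[OF csubring_supported] by (auto simp: indep_def)
    then obtain F where F: "F \<in> polys (supported B)" "g = poly F (poly_var (w i))"
      unfolding supported_insert by (auto simp: adjoin_def)
    have "F \<notin> polys P"
    proof
      assume "F \<in> polys P"
      then have "coeff F n \<in> supported B \<inter> P" for n using F(1) polysD by blast
      then have "F = 0" using B by (intro poly_eqI) (auto simp: indep_def)
      then show False using F g by simp
    qed
    moreover have "F \<in> polys (supported (B \<union> w ` {..<i}))" using F(1) polys_mono[OF supported_mono[of B "B \<union> w ` {..<i}"]] by auto
    ultimately show "\<exists>F\<in>polys (supported (B \<union> w ` {..<i})) - polys P. poly F (poly_var (w i)) \<in> P" using F g by blast
  qed (rule P)
  show "supported (B \<union> w ` {..<Suc i}) = adjoin (poly_var (w i)) (supported (B \<union> w ` {..<i}) :: 'k poly4 set)"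
    by (simp add: lessThan_Suc supported_insert)
next
  show "supported (B \<union> w ` {..<r}) = (UNIV :: 'k poly4 set)" by (simp add: w)
qed (use P B in \<open>auto simp: indep_def\<close>)

lemma enumerate_complement:
  obtains w :: "nat \<Rightarrow> 4" where "inj_on w {..<4 - card B}" "w ` {..<4 - card B} = - B"
proof -
  have "card (- B) = 4 - card B" by (simp add: Compl_eq_Diff_UNIV card_Diff_subset)
  then obtain w where "bij_betw w {0..<4 - card B} (- B)" using ex_bij_betw_nat_finite[of "- B"] by auto
  then show ?thesis using that[of w] by (auto simp: bij_betw_def lessThan_atLeast0)
qed

text \<open>If a largest independent set \<open>B\<close> for \<open>P'\<close> had at least
  \<open>trdeg P\<close> elements, it would be maximal for \<open>P\<close> too. The tower over
  \<open>B\<close> would then put a nonzero polynomial in the variables of \<open>B\<close> into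
  \<open>P'\<close>.\<close>

lemma trdeg_strict:
  fixes P P' :: "'k::field poly4 set"
  assumes P: "prime_of UNIV P" and P': "prime_of UNIV P'" and less: "P \<subset> P'"
  shows "trdeg P' < trdeg P"
proof (rule ccontr)
  assume not_less: "\<not> ?thesis"
  obtain B where B: "indep B P'" "card B = trdeg P'" using trdeg_attained[OF P'] .
  have BP: "indep B P" using indep_antimono[OF _ _ B(1)] less ideal_ofD(2)[OF prime_ofD(1)[OF P]] by blast
  have max: "\<not> indep (insert i B) P" if "i \<notin> B" for i
    using trdeg_ge[of "insert i B" P] that B(2) not_less by auto
  obtain w :: "nat \<Rightarrow> 4" where w: "inj_on w {..<4 - card B}" "w ` {..<4 - card B} = - B" using enumerate_complement .
  interpret algebraic_tower "\<lambda>i. supported (B \<union> w ` {..<i})" "\<lambda>i. poly_var (w i)" "4 - card B" P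
    by (rule algebraic_tower_supported[OF P BP max w])
  obtain f where "f \<in> P'" "f \<notin> P" using less by blast
  then obtain c where "c \<in> supported B" "c \<in> P'" "c \<noteq> 0"
    using larger_prime_meets_base[OF prime_ofD(1)[OF P']] less by auto
  then show False using B(1) by (auto simp: indep_def)
qed

lemma trdeg_le_4: "prime_of UNIV P \<Longrightarrow> trdeg P \<le> 4"
proof -
  assume "prime_of UNIV P"
  then obtain B :: "4 set" where "card B = trdeg P" by (metis trdeg_attained)
  moreover have "card B \<le> card (UNIV :: 4 set)" by (rule card_mono) auto
  ultimately show ?thesis by simp
qed

section \<open>Ring records and localization\<close>

abbreviation sub_ring :: "'a::comm_ring_1 set \<Rightarrow> 'a ring"
  where "sub_ring S \<equiv> ring_of_type_algebra\<lparr>carrier := S\<rparr>"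

lemma sub_ring_simps [simp]:
  "carrier (sub_ring S) = S"
  "a \<otimes>\<^bsub>sub_ring S\<^esub> b = a * b" "a \<oplus>\<^bsub>sub_ring S\<^esub> b = a + b"
  "\<zero>\<^bsub>sub_ring S\<^esub> = 0" "\<one>\<^bsub>sub_ring S\<^esub> = 1"
  by (simp_all add: ring_of_type_algebra_def)

lemma type_ring_simps [simp]:
  "carrier ring_of_type_algebra = UNIV"
  "a \<otimes>\<^bsub>ring_of_type_algebra\<^esub> b = a * (b :: 'a::comm_ring_1)"
  "a \<oplus>\<^bsub>ring_of_type_algebra\<^esub> b = a + (b :: 'a::comm_ring_1)"
  "\<zero>\<^bsub>ring_of_type_algebra\<^esub> = (0 :: 'a::comm_ring_1)"
  "\<one>\<^bsub>ring_of_type_algebra\<^esub> = (1 :: 'a::comm_ring_1)"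
  by (simp_all add: ring_of_type_algebra_def)

lemma sub_ring_UNIV: "sub_ring UNIV = ring_of_type_algebra"
  by (simp add: ring_of_type_algebra_def)

context csubring
begin

lemma cring_sub_ring: "cring (sub_ring S)"
proof (rule cringI)
  show "abelian_group (sub_ring S)"
  proof (rule abelian_groupI)
    show "\<exists>y\<in>carrier (sub_ring S). y \<oplus>\<^bsub>sub_ring S\<^esub> a = \<zero>\<^bsub>sub_ring S\<^esub>" if "a \<in> carrier (sub_ring S)" for a
      using that by (intro bexI[of _ "- a"]) auto
  qed (auto simp: algebra_simps)
  show "Group.comm_monoid (sub_ring S)"
    by (rule comm_monoidI) (auto simp: algebra_simps)
qed (auto simp: algebra_simps)

lemma ideal_sub_ring: "ideal I (sub_ring S) \<longleftrightarrow> ideal_of S I"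
proof
  interpret R: cring "sub_ring S" by (rule cring_sub_ring)
  assume "ideal I (sub_ring S)"
  then interpret ideal I "sub_ring S" .
  show "ideal_of S I"
    unfolding ideal_of_def
  proof (intro conjI ballI)
    show "I \<subseteq> S" using a_subset by simp
    show "0 \<in> I" using zero_closed by simp
    show "a + b \<in> I" if "a \<in> I" "b \<in> I" for a b using a_closed[OF that] by simp
    show "s * a \<in> I" if "s \<in> S" "a \<in> I" for s a using I_l_closed[OF that(2), of s] that(1) by simp
  qed
next
  interpret R: cring "sub_ring S" by (rule cring_sub_ring)
  assume I: "ideal_of S I"
  have inv: "inv\<^bsub>add_monoid (sub_ring S)\<^esub> a = - a" if "a \<in> S" for a
  proof -
    have "\<ominus>\<^bsub>sub_ring S\<^esub> a = - a" by (rule R.minus_equality) (use that in auto)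
    then show ?thesis by (simp add: a_inv_def)
  qed
  show "ideal I (sub_ring S)"
  proof (rule idealI)
    show "subgroup I (add_monoid (sub_ring S))"
    proof
      show "inv\<^bsub>add_monoid (sub_ring S)\<^esub> a \<in> I" if "a \<in> I" for a
        using that inv ideal_uminus[OF I] ideal_ofD(6)[OF I] by auto
    qed (use ideal_ofD[OF I] in auto)
  qed (use R.ring_axioms ideal_ofD[OF I] in auto)
qed

lemma primeideal_sub_ring: "primeideal P (sub_ring S) \<longleftrightarrow> prime_of S P"
proof
  assume "primeideal P (sub_ring S)"
  then interpret primeideal P "sub_ring S" .
  have I: "ideal_of S P" using ideal_axioms ideal_sub_ring by blast
  have "1 \<notin> P" using I_notcarr ideal_ofD(1,5)[OF I] by (metis mult_1 subset_antisym subsetI sub_ring_simps(1))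
  then show "prime_of S P"
    unfolding prime_of_def using I I_prime by auto
next
  assume P: "prime_of S P"
  show "primeideal P (sub_ring S)"
  proof (rule primeidealI)
    show "ideal P (sub_ring S)" using ideal_sub_ring prime_ofD(1)[OF P] by blast
    show "cring (sub_ring S)" by (rule cring_sub_ring)
    show "carrier (sub_ring S) \<noteq> P" using prime_ofD(2)[OF P] by auto
  qed (use prime_ofD(3)[OF P] in auto)
qed

lemma ideal_prod_sub_ring: "ideal_prod (sub_ring S) I J = idprod I J"
proof
  show "ideal_prod (sub_ring S) I J \<subseteq> idprod I J"
  proof
    show "x \<in> idprod I J" if "x \<in> ideal_prod (sub_ring S) I J" for x
      using that by induction (auto intro: idprod.intros)
  qed
  show "idprod I J \<subseteq> ideal_prod (sub_ring S) I J"
  proof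
    show "x \<in> ideal_prod (sub_ring S) I J" if "x \<in> idprod I J" for x
      using that
    proof induction
      case (prod a b)
      then show ?case using ideal_prod.prod[of a I b J "sub_ring S"] by simp
    next
      case (sum a b)
      then show ?case using ideal_prod.sum[of a "sub_ring S" I J b] by simp
    qed
  qed
qed

lemma ideal_pow_sub_ring: "ideal_pow (sub_ring S) I n = ipow S I n"
  by (induction n) (simp_all add: nat_pow_def ideals_set_def ideal_prod_sub_ring)

lemma genideal_sub_ring:
  assumes "set xs \<subseteq> S"
  shows "genideal (sub_ring S) (set xs) = lin_span S (length xs) (\<lambda>i. xs ! i)"
  unfolding genideal_def ideal_sub_ring
proof
  have "ideal_of S (lin_span S (length xs) (\<lambda>i. xs ! i))"
    using assms by (intro lin_span_ideal) auto
  moreover have "set xs \<subseteq> lin_span S (length xs) (\<lambda>i. xs ! i)"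
    using lin_span_gen by (auto simp: in_set_conv_nth)
  ultimately show "\<Inter> {I. ideal_of S I \<and> set xs \<subseteq> I} \<subseteq> lin_span S (length xs) (\<lambda>i. xs ! i)" by blast
  show "lin_span S (length xs) (\<lambda>i. xs ! i) \<subseteq> \<Inter> {I. ideal_of S I \<and> set xs \<subseteq> I}"
    using lin_span_least[of S _ "length xs" "\<lambda>i. xs ! i"] by (auto simp: subset_iff)
qed

end

lemmas ideal_type_ring = csubring.ideal_sub_ring[OF csubring_UNIV, unfolded sub_ring_UNIV]
lemmas primeideal_type_ring = csubring.primeideal_sub_ring[OF csubring_UNIV, unfolded sub_ring_UNIV]
lemmas ideal_pow_type_ring = csubring.ideal_pow_sub_ring[OF csubring_UNIV, unfolded sub_ring_UNIV]

section \<open>Ideals and primes of a localization\<close>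

locale prime_localization =
  fixes P :: "'a::idom set"
  assumes prime: "prime_of UNIV P"
begin

lemmas P_ideal = prime_ofD(1)[OF prime]

definition A where "A = {Fract a s |a s. s \<notin> P}"

text \<open>An explicit form of \<open>extend_ideal\<close>, see \<open>extend_ideal_eq\<close>.
  Membership of a fraction then amounts to a single multiplier outside \<open>P\<close>, see
  \<open>Fract_mem_ext\<close>.\<close>

definition ext :: "'a set \<Rightarrow> 'a fract set" where "ext I = {Fract a s |a s. a \<in> I \<and> s \<notin> P}"

abbreviation of_R :: "'a \<Rightarrow> 'a fract" where "of_R a \<equiv> Fract a 1"

lemma localization_eq: "localization P = sub_ring A"
  by (simp add: localization_def A_def)

lemma compl_mult: "s \<notin> P \<Longrightarrow> t \<notin> P \<Longrightarrow> s * t \<notin> P"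
  using prime_ofD(3)[OF prime] by blast

lemma one_compl: "1 \<notin> P"
  using prime_ofD(2)[OF prime] .

lemma compl_nz: "s \<notin> P \<Longrightarrow> s \<noteq> 0"
  using ideal_ofD(2)[OF P_ideal] by auto

lemma A_eq_ext: "A = ext UNIV"
  by (simp add: A_def ext_def)

lemma extI: "a \<in> I \<Longrightarrow> s \<notin> P \<Longrightarrow> Fract a s \<in> ext I"
  by (auto simp: ext_def)

lemma of_R_ext: "a \<in> I \<Longrightarrow> of_R a \<in> ext I"
  using extI one_compl by blast

lemma of_R_mem: "of_R a \<in> A"
  using of_R_ext by (simp add: A_eq_ext)

lemma ext_ideal:
  assumes I: "ideal_of UNIV I"
  shows "\<And>f g. f \<in> ext I \<Longrightarrow> g \<in> ext I \<Longrightarrow> f + g \<in> ext I"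
    "\<And>f g. f \<in> ext UNIV \<Longrightarrow> g \<in> ext I \<Longrightarrow> f * g \<in> ext I" "0 \<in> ext I"
proof -
  fix f g assume "f \<in> ext I" "g \<in> ext I"
  then obtain a s b t where *: "f = Fract a s" "g = Fract b t" "a \<in> I" "b \<in> I" "s \<notin> P" "t \<notin> P"
    by (auto simp: ext_def)
  have "f + g = Fract (t * a + s * b) (s * t)" using * compl_nz by (simp add: mult.commute)
  then show "f + g \<in> ext I" using * compl_mult ideal_ofD(3,4)[OF I] extI by auto
next
  fix f g assume "f \<in> ext UNIV" "g \<in> ext I"
  then obtain a s b t where *: "f = Fract a s" "g = Fract b t" "b \<in> I" "s \<notin> P" "t \<notin> P"
    by (auto simp: ext_def)
  then show "f * g \<in> ext I" using compl_mult ideal_ofD(4)[OF I] extI by auto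
next
  show "0 \<in> ext I" using of_R_ext[OF ideal_ofD(2)[OF I]] by (simp add: Zero_fract_def)
qed

lemma UNIV_ideal: "ideal_of UNIV (UNIV :: 'a set)"
  by (simp add: ideal_of_def)

sublocale csubring A
proof
  show "0 \<in> A" "1 \<in> A" using of_R_mem[of 0] of_R_mem[of 1] by (auto simp: Zero_fract_def One_fract_def)
  show "- a \<in> A" if "a \<in> A" for a
  proof -
    from that obtain b s where "a = Fract b s" "s \<notin> P" by (auto simp: A_def)
    then have "- a = Fract (- b) s" by simp
    then show ?thesis using \<open>s \<notin> P\<close> unfolding A_def by blast
  qed
  show "a + b \<in> A" "a * b \<in> A" if "a \<in> A" "b \<in> A" for a b
    using that ext_ideal[OF UNIV_ideal] by (auto simp: A_eq_ext)
qed

lemma ideal_ext: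
  assumes "ideal_of UNIV I"
  shows "ideal_of A (ext I)"
  unfolding ideal_of_def
proof (intro conjI ballI)
  show "ext I \<subseteq> A" by (auto simp: ext_def A_def)
qed (use ext_ideal[OF assms] in \<open>auto simp: A_eq_ext\<close>)

lemma Fract_mem_ext:
  assumes I: "ideal_of UNIV I" and t: "t \<notin> P"
  shows "Fract a t \<in> ext I \<longleftrightarrow> (\<exists>s. s \<notin> P \<and> s * a \<in> I)"
proof
  assume "Fract a t \<in> ext I"
  then obtain b s where *: "Fract a t = Fract b s" "b \<in> I" "s \<notin> P" by (auto simp: ext_def)
  then have "s * a = t * b" using t compl_nz by (simp add: eq_fract mult.commute)
  then show "\<exists>s. s \<notin> P \<and> s * a \<in> I" using * ideal_ofD(4)[OF I] by auto
next
  assume "\<exists>s. s \<notin> P \<and> s * a \<in> I"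
  then obtain s where s: "s \<notin> P" "s * a \<in> I" by blast
  then have "Fract (s * a) (s * t) \<in> ext I" using extI compl_mult t by blast
  then show "Fract a t \<in> ext I" using mult_fract_cancel[OF compl_nz[OF s(1)]] by simp
qed

lemma Fract_mem_ext_prime:
  assumes Q: "prime_of UNIV Q" "Q \<subseteq> P" and t: "t \<notin> P"
  shows "Fract a t \<in> ext Q \<longleftrightarrow> a \<in> Q"
  unfolding Fract_mem_ext[OF prime_ofD(1)[OF Q(1)] t]
  using prime_ofD(3)[OF Q(1)] Q(2) one_compl by (metis UNIV_I mult_1 subsetD)

lemma A_cases:
  assumes "f \<in> A"
  obtains a s where "f = Fract a s" "s \<notin> P"
  using assms by (auto simp: A_def)

lemma prime_ext:
  assumes Q: "prime_of UNIV Q" "Q \<subseteq> P"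
  shows "prime_of A (ext Q)"
  unfolding prime_of_def
proof (intro conjI ballI impI)
  show "ideal_of A (ext Q)" using ideal_ext prime_ofD(1)[OF Q(1)] .
  show "1 \<notin> ext Q" using Fract_mem_ext_prime[OF Q one_compl, of 1] prime_ofD(2)[OF Q(1)] by (simp add: One_fract_def)
  fix f g assume "f \<in> A" "g \<in> A" "f * g \<in> ext Q"
  moreover from this obtain a s b t where "f = Fract a s" "s \<notin> P" "g = Fract b t" "t \<notin> P" using A_cases by metis
  ultimately show "f \<in> ext Q \<or> g \<in> ext Q"
    using Fract_mem_ext_prime[OF Q] compl_mult prime_ofD(3)[OF Q(1)] by auto
qed

definition contr :: "'a fract set \<Rightarrow> 'a set" where "contr K = {a. of_R a \<in> K}"

lemma of_R_add: "of_R (a + b) = of_R a + of_R b"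
  by simp

lemma Fract_eq: "s \<notin> P \<Longrightarrow> Fract a s = Fract 1 s * of_R a" "s \<notin> P \<Longrightarrow> of_R a = of_R s * Fract a s"
  using compl_nz by (simp_all add: eq_fract)

lemma ext_contr:
  assumes K: "ideal_of A K"
  shows "ideal_of UNIV (contr K)" "ext (contr K) = K"
proof -
  show "ideal_of UNIV (contr K)"
    unfolding ideal_of_def
  proof (intro conjI ballI)
    show "0 \<in> contr K" using ideal_ofD(2)[OF K] by (simp add: contr_def Zero_fract_def)
    show "a + b \<in> contr K" if "a \<in> contr K" "b \<in> contr K" for a b
      using that ideal_ofD(3)[OF K, of "of_R a" "of_R b"] by (simp add: contr_def)
    show "a * b \<in> contr K" if "b \<in> contr K" for a b
      using that ideal_ofD(4)[OF K of_R_mem, of "of_R b" a] by (simp add: contr_def)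
  qed auto
  show "ext (contr K) = K"
  proof
    show "ext (contr K) \<subseteq> K"
    proof
      fix f assume "f \<in> ext (contr K)"
      then obtain a s where *: "f = Fract a s" "of_R a \<in> K" "s \<notin> P" by (auto simp: ext_def contr_def)
      have "Fract 1 s \<in> A" using *(3) by (auto simp: A_def)
      then have "Fract 1 s * of_R a \<in> K" using ideal_ofD(4)[OF K] * by blast
      then show "f \<in> K" using trans[OF *(1) Fract_eq(1)[OF *(3)]] by simp
    qed
    show "K \<subseteq> ext (contr K)"
    proof
      fix f assume f: "f \<in> K"
      then obtain a s where *: "f = Fract a s" "s \<notin> P" using ideal_ofD(6)[OF K] A_cases by metis
      have "of_R s * f \<in> K" using ideal_ofD(4)[OF K of_R_mem] f by blast
      then have "of_R a \<in> K" using Fract_eq(2)[OF *(2), of a] *(1) by metis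
      then show "f \<in> ext (contr K)" using * by (auto simp: ext_def contr_def)
    qed
  qed
qed

lemma prime_contr:
  assumes K: "prime_of A K"
  shows "prime_of UNIV (contr K)" "contr K \<subseteq> P"
proof -
  note I = prime_ofD(1)[OF K]
  show "prime_of UNIV (contr K)"
    unfolding prime_of_def
  proof (intro conjI ballI impI)
    show "ideal_of UNIV (contr K)" using ext_contr(1)[OF I] .
    show "1 \<notin> contr K" using prime_ofD(2)[OF K] by (simp add: contr_def One_fract_def)
    show "a \<in> contr K \<or> b \<in> contr K" if "a * b \<in> contr K" for a b
      using that prime_ofD(3)[OF K of_R_mem of_R_mem, of a b] by (simp add: contr_def)
  qed
  show "contr K \<subseteq> P"
  proof
    fix a assume a: "a \<in> contr K"
    show "a \<in> P"
    proof (rule ccontr)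
      assume "a \<notin> P"
      then have "Fract 1 a \<in> A" "Fract 1 a * of_R a = 1"
        using compl_nz by (auto simp: A_def One_fract_def eq_fract)
      then show False using ideal_ofD(4)[OF I, of "Fract 1 a" "of_R a"] a prime_ofD(2)[OF K] by (simp add: contr_def)
    qed
  qed
qed

lemma contr_ext_prime: "prime_of UNIV Q \<Longrightarrow> Q \<subseteq> P \<Longrightarrow> contr (ext Q) = Q"
  using Fract_mem_ext_prime one_compl by (auto simp: contr_def)

lemma extend_ideal_eq:
  assumes I: "ideal_of UNIV I"
  shows "extend_ideal P I = ext I"
  unfolding extend_ideal_def localization_eq genideal_def ideal_sub_ring
proof
  have "(\<lambda>f. Fract f 1) ` I \<subseteq> ext I" using of_R_ext by auto
  then show "\<Inter> {K. ideal_of A K \<and> (\<lambda>f. Fract f 1) ` I \<subseteq> K} \<subseteq> ext I" using ideal_ext[OF I] by blast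
  show "ext I \<subseteq> \<Inter> {K. ideal_of A K \<and> (\<lambda>f. Fract f 1) ` I \<subseteq> K}"
  proof (intro Inter_greatest)
    fix K assume "K \<in> {K. ideal_of A K \<and> (\<lambda>f. Fract f 1) ` I \<subseteq> K}"
    then have K: "ideal_of A K" "I \<subseteq> contr K" by (auto simp: contr_def)
    then have "ext I \<subseteq> ext (contr K)" by (auto simp: ext_def)
    then show "ext I \<subseteq> K" using ext_contr(2)[OF K(1)] by simp
  qed
qed

lemma contract_extend:
  assumes I: "ideal_of UNIV I"
  shows "contract_ideal (extend_ideal P I) = {f. \<exists>s. s \<notin> P \<and> s * f \<in> I}"
  unfolding contract_ideal_def extend_ideal_eq[OF I] Fract_mem_ext[OF I one_compl] ..

lemma ext_ipow:
  assumes I: "ideal_of UNIV I"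
  shows "ipow A (ext I) n = ext (ipow UNIV I n)"
proof (induction n)
  case 0
  then show ?case by (simp add: A_eq_ext)
next
  case (Suc n)
  have J: "ideal_of UNIV (ipow UNIV I n)" "ideal_of UNIV (ipow UNIV I (Suc n))"
    by (rule csubring.ipow_ideal[OF csubring_UNIV I])+
  show ?case
  proof
    show "ipow A (ext I) (Suc n) \<subseteq> ext (ipow UNIV I (Suc n))"
      unfolding ipow.simps(2)[of A] Suc
    proof (rule idprod_least[OF ideal_ext[OF J(2)]])
      fix f g assume "f \<in> ext (ipow UNIV I n)" "g \<in> ext I"
      then obtain a s b t where "f = Fract a s" "g = Fract b t" "a \<in> ipow UNIV I n" "b \<in> I" "s \<notin> P" "t \<notin> P"
        unfolding ext_def by blast
      then show "f * g \<in> ext (ipow UNIV I (Suc n))" using compl_mult by (auto intro!: extI idprod.prod)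
    qed
    show "ext (ipow UNIV I (Suc n)) \<subseteq> ipow A (ext I) (Suc n)"
    proof
      fix f assume "f \<in> ext (ipow UNIV I (Suc n))"
      then obtain a s where as: "f = Fract a s" "a \<in> idprod (ipow UNIV I n) I" "s \<notin> P" by (auto simp: ext_def)
      have "of_R a \<in> ipow A (ext I) (Suc n)"
        using as(2)
      proof induction
        case (prod a b)
        then show ?case
          using idprod.prod[of "of_R a" "ipow A (ext I) n" "of_R b" "ext I"] Suc of_R_ext by auto
      next
        case (sum a b)
        then show ?case using idprod.sum[of "of_R a" "ipow A (ext I) n" "ext I" "of_R b"] by simp
      qed
      moreover have "Fract 1 s \<in> A" using as(3) by (auto simp: A_def)
      ultimately have "Fract 1 s * of_R a \<in> ipow A (ext I) (Suc n)"
        using ideal_ofD(4)[OF ipow_ideal[OF ideal_ext[OF I]]] by blast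
      then show "f \<in> ipow A (ext I) (Suc n)" using trans[OF as(1) Fract_eq(1)[OF as(3)]] by metis
    qed
  qed
qed

lemma local_domain_ext:
  assumes noeth: "noetherian_of (UNIV :: 'a set)"
  shows "local_domain A (ext P)"
proof (intro local_domain.intro noetherian_subring.intro csubring_axioms noetherian_subring_axioms.intro local_domain_axioms.intro)
  show "noetherian_of A"
    unfolding noetherian_of_def
  proof (intro allI impI)
    fix K assume K: "ideal_of A K"
    obtain n g where g: "\<forall>i<n. g i \<in> contr K" "contr K = lin_span UNIV n g"
      using noeth ext_contr(1)[OF K] unfolding noetherian_of_def by blast
    have gK: "of_R (g i) \<in> K" if "i < n" for i using g(1) that by (auto simp: contr_def)
    have "K \<subseteq> lin_span A n (\<lambda>i. of_R (g i))"
    proof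
      fix f assume "f \<in> K"
      then have "f \<in> ext (contr K)" using ext_contr(2)[OF K] by simp
      then obtain a s where as: "f = Fract a s" "a \<in> contr K" "s \<notin> P" by (auto simp: ext_def)
      then obtain c where c: "a = (\<Sum>i<n. c i * g i)" unfolding g(2) by (metis lin_spanE)
      have "of_R (sum h Y) = (\<Sum>i\<in>Y. of_R (h i))" for h and Y :: "nat set"
        by (induction Y rule: infinite_finite_induct) (auto simp: Zero_fract_def of_R_add)
      then have "of_R a = (\<Sum>i<n. of_R (c i) * of_R (g i))" by (simp add: c)
      then have "Fract 1 s * of_R a = (\<Sum>i<n. (Fract 1 s * of_R (c i)) * of_R (g i))"
        by (simp only: sum_distrib_left mult.assoc)
      then have "f = (\<Sum>i<n. (Fract 1 s * of_R (c i)) * of_R (g i))"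
        using trans[OF as(1) Fract_eq(1)[OF as(3)]] by metis
      moreover have "Fract 1 s \<in> A" using as(3) by (auto simp: A_def)
      then have "Fract 1 s * of_R (c i) \<in> A" for i using of_R_mem by (rule mult)
      then have "(\<Sum>i<n. (Fract 1 s * of_R (c i)) * of_R (g i)) \<in> lin_span A n (\<lambda>i. of_R (g i))"
        by (rule lin_spanI)
      ultimately show "f \<in> lin_span A n (\<lambda>i. of_R (g i))" by metis
    qed
    moreover have "lin_span A n (\<lambda>i. of_R (g i)) \<subseteq> K" by (rule lin_span_least[OF K gK])
    ultimately show "\<exists>n g. (\<forall>i<n. g i \<in> K) \<and> K = lin_span A n g"
      using gK by (intro exI[of _ n] exI[of _ "\<lambda>i. of_R (g i)"]) auto
  qed
  show "ideal_of A (ext P)" using ideal_ext[OF P_ideal] .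
  show "1 \<notin> ext P" using prime_ofD(2)[OF prime_ext[OF prime]] by simp
  show "inverse f \<in> A" if f: "f \<in> A" "f \<notin> ext P" for f
  proof -
    obtain a s where *: "f = Fract a s" "s \<notin> P" using A_cases[OF f(1)] .
    then have "a \<notin> P" using f(2) extI by blast
    then show ?thesis using * by (auto simp: A_def)
  qed
  fix v :: "'a fract"
  obtain a b where ab: "v = Fract a b" "b \<noteq> 0" by (cases v) auto
  have "of_R b \<noteq> 0" using ab(2) by (simp add: Zero_fract_def eq_fract)
  moreover have "of_R b * v = of_R a" using ab by (simp add: eq_fract)
  ultimately show "\<exists>s\<in>A. s \<noteq> 0 \<and> s * v \<in> A" using of_R_mem by (intro bexI[of _ "of_R b"]) auto
qed

section \<open>Heights in a localization\<close>

lemma height_prime_eq: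
  "height_prime (localization P) K =
    (SUP n \<in> {n. \<exists>Q. (\<forall>i\<le>n. prime_of A (Q i)) \<and> (\<forall>i<n. Q i \<subset> Q (Suc i)) \<and> Q n = K}. enat n)"
  unfolding height_prime_def localization_eq primeideal_sub_ring ..

lemma height_eq: "height (localization P) K = (INF Q \<in> {Q. prime_of A Q \<and> K \<subseteq> Q}. height_prime (localization P) Q)"
  unfolding height_def localization_eq primeideal_sub_ring ..

lemma contr_strict:
  assumes "prime_of A K" "prime_of A L" "K \<subset> L"
  shows "contr K \<subset> contr L"
proof -
  have "contr K \<subseteq> contr L" using assms(3) by (auto simp: contr_def)
  moreover have "contr K \<noteq> contr L"
    using ext_contr(2)[OF prime_ofD(1)[OF assms(1)]] ext_contr(2)[OF prime_ofD(1)[OF assms(2)]] assms(3)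
    by (metis psubset_imp_ex_mem less_irrefl)
  ultimately show ?thesis by blast
qed

text \<open>Any bounded function that drops strictly along inclusions of primes limits the length of
  chains. It is applied to \<open>trdeg\<close> with the bound 4.\<close>

lemma height_prime_le:
  assumes t: "\<And>Q Q'. prime_of UNIV Q \<Longrightarrow> prime_of UNIV Q' \<Longrightarrow> Q \<subset> Q' \<Longrightarrow> t Q' < (t Q :: nat)"
    "\<And>Q. prime_of UNIV Q \<Longrightarrow> t Q \<le> d"
    and K: "prime_of UNIV K" "K \<subseteq> P"
  shows "height_prime (localization P) (ext K) \<le> enat (d - t K)"
  unfolding height_prime_eq
proof (rule SUP_least)
  fix n assume "n \<in> {n. \<exists>Q. (\<forall>i\<le>n. prime_of A (Q i)) \<and> (\<forall>i<n. Q i \<subset> Q (Suc i)) \<and> Q n = ext K}"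
  then obtain Q where Q: "\<forall>i\<le>n. prime_of A (Q i)" "\<forall>i<n. Q i \<subset> Q (Suc i)" "Q n = ext K" by blast
  have "t (contr (Q i)) + i \<le> d" if "i \<le> n" for i
    using that
  proof (induction i)
    case 0
    then show ?case using t(2) prime_contr(1) Q(1) by simp
  next
    case (Suc i)
    have "t (contr (Q (Suc i))) < t (contr (Q i))"
      using t(1)[OF _ _ contr_strict[of "Q i" "Q (Suc i)"]] Q Suc.prems prime_contr(1) by simp
    then show ?case using Suc by simp
  qed
  from this[of n] show "enat n \<le> enat (d - t K)" using Q(3) contr_ext_prime[OF K] by simp
qed

lemma height_prime_ge:
  assumes "\<And>i. i \<le> n \<Longrightarrow> prime_of A (Q i)" "\<And>i. i < n \<Longrightarrow> Q i \<subset> Q (Suc i)"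
  shows "enat n \<le> height_prime (localization P) (Q n)"
  unfolding height_prime_eq using assms by (intro SUP_upper) blast

end

section \<open>Local structure at primes of the polynomial ring\<close>

lemma (in prime_localization) ext_mono: "I \<subseteq> K \<Longrightarrow> ext I \<subseteq> ext K"
  by (auto simp: ext_def)

lemma (in prime_localization) Fract_in_lin_span:
  assumes "l \<notin> P" "s \<notin> P" "l * a = (\<Sum>j<(n::nat). c j * g j)"
  shows "Fract a s \<in> lin_span A n (\<lambda>j. of_R (g j))"
proof -
  have sum: "of_R (sum h Y) = (\<Sum>i\<in>Y. of_R (h i))" for h and Y :: "nat set"
    by (induction Y rule: infinite_finite_induct) (auto simp: Zero_fract_def of_R_add)
  have ls: "l * s \<notin> P" using assms compl_mult by blast
  have "Fract a s = Fract (l * a) (l * s)" using mult_fract_cancel[OF compl_nz[OF assms(1)]] by simp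
  also have "\<dots> = Fract 1 (l * s) * of_R (l * a)" by (rule Fract_eq(1)[OF ls])
  also have "of_R (l * a) = (\<Sum>j<n. of_R (c j) * of_R (g j))" unfolding assms(3) sum by simp
  also have "Fract 1 (l * s) * \<dots> = (\<Sum>j<n. (Fract 1 (l * s) * of_R (c j)) * of_R (g j))"
    by (simp only: sum_distrib_left mult.assoc)
  finally have eq: "Fract a s = (\<Sum>j<n. (Fract 1 (l * s) * of_R (c j)) * of_R (g j))" .
  have "Fract 1 (l * s) \<in> A" using ls by (auto simp: A_def)
  then have "Fract 1 (l * s) * of_R (c j) \<in> A" for j using of_R_mem by (rule mult)
  then show ?thesis unfolding eq by (rule lin_spanI)
qed

locale tower_localization = algebraic_tower S v r P + prime_localization P
  for S :: "nat \<Rightarrow> 'a::idom set" and v r P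
begin

lemma lin_span_\<psi>:
  assumes "i \<le> r"
  shows "lin_span A i (\<lambda>j. of_R (\<psi> j)) = ext (E i)"
proof
  show "lin_span A i (\<lambda>j. of_R (\<psi> j)) \<subseteq> ext (E i)"
  proof (rule lin_span_least[OF ideal_ext[OF prime_ofD(1)[OF E_prime[OF assms]]]])
    fix j assume "j < i"
    then show "of_R (\<psi> j) \<in> ext (E i)" using \<psi>_mem(1)[of j] E_mono[of "Suc j" i] assms by (auto intro!: of_R_ext)
  qed
  show "ext (E i) \<subseteq> lin_span A i (\<lambda>j. of_R (\<psi> j))"
  proof
    fix f assume "f \<in> ext (E i)"
    then obtain a s where *: "f = Fract a s" "a \<in> E i" "s \<notin> P" by (auto simp: ext_def)
    obtain l c where "l \<notin> P" "l * a = (\<Sum>j<i. c j * \<psi> j)" using E_generated[OF assms *(2)] .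
    then show "f \<in> lin_span A i (\<lambda>j. of_R (\<psi> j))" unfolding *(1) using Fract_in_lin_span *(3) by blast
  qed
qed

lemma E_ext_prime: "i \<le> r \<Longrightarrow> prime_of A (ext (E i))"
  using prime_ext[OF E_prime E_sub_P] .

lemma \<psi>_notin_ext: "i < r \<Longrightarrow> of_R (\<psi> i) \<notin> ext (E i)"
  using Fract_mem_ext_prime[OF E_prime E_sub_P one_compl, of i "\<psi> i"] \<psi>_mem(2) by simp

lemma \<psi>_in_ext: "i < r \<Longrightarrow> of_R (\<psi> i) \<in> ext (E (Suc i))"
  using of_R_ext \<psi>_mem(1) by blast

text \<open>Everything is read off the chain of primes \<open>ext (E i)\<close>, the i-th of which
  is generated by the first \<open>i\<close> parameters: a parameter outside a prime is regular
  modulo it.\<close>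

lemma regular_local_3:
  assumes r: "r = 3" and noeth: "noetherian_of (UNIV :: 'a set)"
  shows "regular_local_3 A (ext P) (of_R (\<psi> 0)) (of_R (\<psi> 1)) (of_R (\<psi> 2))"
proof -
  have two: "{b * of_R (\<psi> 0) + c * of_R (\<psi> 1) |b c. b \<in> A \<and> c \<in> A} = ext (E 2)"
  proof -
    have "lin_span A 2 (\<lambda>j. of_R (\<psi> j)) = {b * of_R (\<psi> 0) + c * of_R (\<psi> 1) |b c. b \<in> A \<and> c \<in> A}"
    proof
      show "lin_span A 2 (\<lambda>j. of_R (\<psi> j)) \<subseteq> {b * of_R (\<psi> 0) + c * of_R (\<psi> 1) |b c. b \<in> A \<and> c \<in> A}"
        by (auto simp: lin_span_def numeral_2_eq_2)
      show "{b * of_R (\<psi> 0) + c * of_R (\<psi> 1) |b c. b \<in> A \<and> c \<in> A} \<subseteq> lin_span A 2 (\<lambda>j. of_R (\<psi> j))"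
      proof
        fix f assume "f \<in> {b * of_R (\<psi> 0) + c * of_R (\<psi> 1) |b c. b \<in> A \<and> c \<in> A}"
        then obtain b c where "b \<in> A" "c \<in> A" "f = b * of_R (\<psi> 0) + c * of_R (\<psi> 1)" by blast
        then show "f \<in> lin_span A 2 (\<lambda>j. of_R (\<psi> j))"
          using lin_spanI[of 2 "\<lambda>i. if i = 0 then b else c" A "\<lambda>j. of_R (\<psi> j)"] by (simp add: numeral_2_eq_2)
      qed
    qed
    then show ?thesis using lin_span_\<psi>[of 2] r by simp
  qed
  have one: "\<exists>c\<in>A. f = of_R (\<psi> 0) * c" if "f \<in> ext (E 1)" for f
    using that lin_span_\<psi>[of 1] r by (auto simp: lin_span_def mult.commute)
  show ?thesis
  proof (intro regular_local_3.intro local_domain_ext[OF noeth] regular_local_3_axioms.intro)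
    show "of_R (\<psi> 0) \<in> ext P" "of_R (\<psi> 1) \<in> ext P" "of_R (\<psi> 2) \<in> ext P"
      using \<psi>_mem(3) r of_R_ext by auto
    show "\<exists>b\<in>A. \<exists>c\<in>A. \<exists>d\<in>A. a = b * of_R (\<psi> 0) + c * of_R (\<psi> 1) + d * of_R (\<psi> 2)" if "a \<in> ext P" for a
    proof -
      have "a \<in> lin_span A 3 (\<lambda>j. of_R (\<psi> j))" using that lin_span_\<psi>[of 3] r E_top by simp
      then obtain c where "\<forall>i<3. c i \<in> A" "a = (\<Sum>i<3. c i * of_R (\<psi> i))" by (auto simp: lin_span_def)
      then show ?thesis
        by (intro bexI[of _ "c 0"] bexI[of _ "c 1"] bexI[of _ "c 2"]) (auto simp: numeral_3_eq_3 numeral_2_eq_2)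
    qed
    show "of_R (\<psi> 0) \<noteq> 0"
      using \<psi>_notin_ext[of 0] r ideal_ofD(2)[OF prime_ofD(1)[OF E_ext_prime[of 0]]] by auto
    show "\<exists>c\<in>A. a = of_R (\<psi> 0) * c" if "a \<in> A" "b \<in> A" "of_R (\<psi> 1) * a = of_R (\<psi> 0) * b" for a b
    proof (rule one)
      have "of_R (\<psi> 1) * a \<in> ext (E 1)"
        unfolding that(3) using ideal_ofD(5)[OF prime_ofD(1)[OF E_ext_prime[of 1]] that(2)] \<psi>_in_ext[of 0] r by simp
      then show "a \<in> ext (E 1)"
        using prime_ofD(3)[OF E_ext_prime[of 1] of_R_mem that(1), of "\<psi> 1"] \<psi>_notin_ext[of 1] r by auto
    qed
    show "prime_of A {b * of_R (\<psi> 0) + c * of_R (\<psi> 1) |b c. b \<in> A \<and> c \<in> A}"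
      unfolding two using E_ext_prime[of 2] r by simp
    show "of_R (\<psi> 2) \<notin> {b * of_R (\<psi> 0) + c * of_R (\<psi> 1) |b c. b \<in> A \<and> c \<in> A}"
      unfolding two using \<psi>_notin_ext[of 2] r by simp
  qed
qed

text \<open>This excludes the case that p is the generic point of V. Each parameter lies outside the
  prime generated by its predecessors; the chain of these primes bounds the height from below, and
  \<open>t\<close> bounds it from above.\<close>

lemma complete_intersection_max:
  assumes t: "\<And>Q Q'. prime_of UNIV Q \<Longrightarrow> prime_of UNIV Q' \<Longrightarrow> Q \<subset> Q' \<Longrightarrow> t Q' < (t Q :: nat)"
    "\<And>Q. prime_of UNIV Q \<Longrightarrow> t Q \<le> d" "r = d - t P"
  shows "complete_intersection (localization P) (extend_ideal P P)"
proof -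
  define xs where "xs = map (\<lambda>j. of_R (\<psi> j)) [0..<r]"
  have len: "length xs = r" by (simp add: xs_def)
  have xs_A: "set xs \<subseteq> A" using of_R_mem by (auto simp: xs_def)
  have gen: "genideal (localization P) (set (take i xs)) = ext (E i)" if "i \<le> r" for i
  proof -
    have "genideal (localization P) (set (take i xs)) = lin_span A i (\<lambda>j. take i xs ! j)"
      unfolding localization_eq using genideal_sub_ring[of "take i xs"] xs_A set_take_subset[of i xs] that len by auto
    also have "\<dots> = lin_span A i (\<lambda>j. of_R (\<psi> j))"
      unfolding lin_span_def using that by (auto simp: xs_def)
    finally show ?thesis using lin_span_\<psi>[OF that] by simp
  qed
  have gen_all: "genideal (localization P) (set xs) = ext P" using gen[of r] len E_top by simp
  have "regular_seq (localization P) xs"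
    unfolding regular_seq_def
  proof (intro conjI allI impI ballI)
    show "set xs \<subseteq> carrier (localization P)" using xs_A by (simp add: localization_eq)
    fix i a assume i: "i < length xs" and a: "a \<in> carrier (localization P)"
      and "xs ! i \<otimes>\<^bsub>localization P\<^esub> a \<in> genideal (localization P) (set (take i xs))"
    then have "of_R (\<psi> i) * a \<in> ext (E i)" using gen[of i] len by (simp add: localization_eq xs_def)
    then show "a \<in> genideal (localization P) (set (take i xs))"
      using prime_ofD(3)[OF E_ext_prime[of i] of_R_mem] \<psi>_notin_ext[of i] gen[of i] i len a
      by (auto simp: localization_eq)
  next
    have "1 \<notin> ext P" using prime_ofD(2)[OF prime_ext[OF prime]] by simp
    then show "genideal (localization P) (set xs) \<noteq> carrier (localization P)"
      unfolding gen_all by (auto simp: localization_eq)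
  qed
  moreover have "extend_ideal P P = genideal (localization P) (set xs)" using extend_ideal_eq[OF P_ideal] gen_all by simp
  moreover have "enat (length xs) = height (localization P) (extend_ideal P P)"
  proof (rule antisym)
    have "Q = ext P" if "prime_of A Q" "ext P \<subseteq> Q" for Q
      using ext_contr(2)[OF prime_ofD(1)[OF that(1)]] ext_mono[OF prime_contr(2)[OF that(1)]] that(2) by auto
    moreover have "enat r \<le> height_prime (localization P) (ext P)"
    proof -
      have "ext (E i) \<subset> ext (E (Suc i))" if "i < r" for i
        using ext_mono[OF E_Suc[OF that]] \<psi>_notin_ext[OF that] \<psi>_in_ext[OF that] by blast
      then show ?thesis using height_prime_ge[of r "\<lambda>i. ext (E i)"] E_ext_prime E_top by simp
    qed
    ultimately show "enat (length xs) \<le> height (localization P) (extend_ideal P P)"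
      unfolding height_eq extend_ideal_eq[OF P_ideal] len by (intro INF_greatest) auto
    have "height (localization P) (extend_ideal P P) \<le> height_prime (localization P) (ext P)"
      unfolding height_eq extend_ideal_eq[OF P_ideal] using prime_ext[OF prime] by (intro INF_lower) auto
    also have "\<dots> \<le> enat (d - t P)" by (rule height_prime_le[OF t(1,2) prime]) auto
    finally show "height (localization P) (extend_ideal P P) \<le> enat (length xs)" using t(3) len by simp
  qed
  ultimately show ?thesis unfolding complete_intersection_def by blast
qed

end

lemma maximal_complete_intersection:
  fixes P :: "'k::field poly4 set"
  assumes P: "prime_of UNIV P"
  shows "complete_intersection (localization P) (extend_ideal P P)"
proof -
  obtain B where B: "indep B P" "card B = trdeg P" using trdeg_attained[OF P] .
  have max: "\<not> indep (insert i B) P" if "i \<notin> B" for i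
    using trdeg_ge[of "insert i B" P] that B(2) by auto
  obtain w :: "nat \<Rightarrow> 4" where w: "inj_on w {..<4 - card B}" "w ` {..<4 - card B} = - B" using enumerate_complement .
  interpret tower_localization "\<lambda>i. supported (B \<union> w ` {..<i})" "\<lambda>i. poly_var (w i)" "4 - card B" P
    by (intro tower_localization.intro algebraic_tower_supported[OF P B(1) max w] prime_localization.intro P)
  show ?thesis
    by (rule complete_intersection_max[where t = trdeg and d = 4]) (use trdeg_strict trdeg_le_4 B in auto)
qed

lemma dt_2: "dt 2 f = f 0 0 * f 1 1 - f 0 1 * f 1 0"
proof -
  have "dt 2 f = (\<Sum>j<2. f 1 j * dt 2 (f(1 := unit_row j)))" using dt_expand_row[of 1 2 f "f 1"] by simp
  moreover have "dt 2 (f(1 := unit_row j)) = (\<Sum>i<2. f 0 i * dt 2 (f(1 := unit_row j, 0 := unit_row i)))" for j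
    using dt_expand_row[of 0 2 "f(1 := unit_row j)" "f 0"] by (simp add: fun_upd_twist fun_upd_idem)
  moreover have "dt 2 (f(1 := unit_row 1, 0 := unit_row 0)) = dt 2 unit_row"
    by (rule dt_cong) (auto simp: less_2_cases_iff)
  moreover have "dt 2 (f(1 := unit_row j, 0 := unit_row j)) = 0" for j by (rule dt_identical_rows[of 0 _ 1]) auto
  moreover have "dt 2 (f(1 := unit_row 0, 0 := unit_row 1)) = -1"
  proof -
    define g where "g = f(1 := unit_row 1, 0 := unit_row 0)"
    have "f(1 := unit_row 0, 0 := unit_row 1) = g(0 := g 1, 1 := g 0)" by (auto simp: g_def fun_eq_iff)
    then show ?thesis using dt_swap_rows[of 0 2 1 g] calculation(3) by (simp add: g_def dt_one)
  qed
  ultimately show ?thesis by (simp add: numeral_2_eq_2 dt_one)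
qed


section \<open>Powers of a height-two prime at a closed point\<close>

text \<open>Two towers cooperate: the one of \<open>P\<close> supplies the regular parameters of the
  local ring, the one of \<open>I\<close> the two elements that generate \<open>I\<close>
  generically. The least number of generators is shown to be at least three by excluding 0, 1 and
  2.\<close>

theorem (in prime_localization) power_embedded_at:
  fixes I :: "'a set"
  assumes noeth: "noetherian_of (UNIV :: 'a set)"
    and reg: "tower_localization S v 3 P"
    and I: "prime_of UNIV I" "I \<subseteq> P" and notin: "algebraic_tower.\<psi> S v P 0 \<notin> I"
    and gen: "algebraic_tower S' v' 2 I"
    and height: "height (localization P) (ext I) = 2"
    and not_ci: "\<not> complete_intersection (localization P) (extend_ideal P I)"
    and m: "m \<ge> 2"
  obtains a e where "a \<in> A - ext I" "e \<in> A" "a * e \<in> ipow A (ext I) m" "e \<notin> ipow A (ext I) m"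
proof -
  interpret T: tower_localization S v 3 P by (rule reg)
  interpret G: algebraic_tower S' v' 2 I by (rule gen)
  define y z x where "y = of_R (T.\<psi> 0)" and "z = of_R (T.\<psi> 1)" and "x = of_R (T.\<psi> 2)"
  interpret R3: regular_local_3 A "ext P" y z x
    unfolding y_def z_def x_def by (rule T.regular_local_3[OF refl noeth])
  define J where "J = ext I"
  have J: "prime_of A J" unfolding J_def by (rule prime_ext[OF I])
  have mem_J: "Fract a s \<in> J \<longleftrightarrow> a \<in> I" if "s \<notin> P" for a s
    unfolding J_def by (rule Fract_mem_ext_prime[OF I that])
  \<comment> \<open>The numbering is reversed: \<open>\<psi>1\<close> has to be regular modulo
    \<open>\<psi>2\<close>, and it is the second parameter of the tower that lies outside the prime
    \<open>G.E 1\<close> of the first.\<close>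
  define \<psi>1 \<psi>2 where "\<psi>1 = of_R (G.\<psi> 1)" and "\<psi>2 = of_R (G.\<psi> 0)"
  have \<psi>J: "\<psi>1 \<in> J" "\<psi>2 \<in> J"
    using G.\<psi>_mem(3) by (auto simp: \<psi>1_def \<psi>2_def mem_J one_compl)
  have "G.\<psi> 0 \<noteq> 0" using G.\<psi>_mem(2)[of 0] G.E_0 by auto
  then have \<psi>2_nz: "\<psi>2 \<noteq> 0" by (simp add: \<psi>2_def Zero_fract_def eq_fract)
  have of_R_compl: "of_R l \<in> A - J" if "l \<notin> I" for l
    using that of_R_mem mem_J[OF one_compl] by auto
  have generate: "\<exists>u\<in>A - J. \<exists>a\<in>A. \<exists>b\<in>A. u * f = a * \<psi>1 + b * \<psi>2" if f: "f \<in> J" for f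
  proof -
    obtain a s where as: "f = Fract a s" "a \<in> I" "s \<notin> P" using f by (auto simp: J_def ext_def)
    obtain l c where l: "l \<notin> I" "l * a = (\<Sum>j<2. c j * G.\<psi> j)" using G.E_generated[of 2 a] as(2) G.E_top by auto
    have "of_R l * f = Fract 1 s * of_R (l * a)" unfolding as(1) by simp
    also have "\<dots> = Fract (c 1) s * \<psi>1 + Fract (c 0) s * \<psi>2"
      unfolding l(2) \<psi>1_def \<psi>2_def using compl_nz[OF as(3)] by (simp add: numeral_2_eq_2 eq_fract algebra_simps)
    finally have "of_R l * f = Fract (c 1) s * \<psi>1 + Fract (c 0) s * \<psi>2" .
    moreover have "Fract (c 1) s \<in> A" "Fract (c 0) s \<in> A" using as(3) by (auto simp: A_def)
    ultimately show ?thesis using of_R_compl[OF l(1)] by blast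
  qed
  have regular: "\<exists>u\<in>A - J. \<exists>c\<in>A. u * q = c * \<psi>2" if q: "q \<in> A" "q' \<in> A" "q * \<psi>1 = q' * \<psi>2" for q q'
  proof -
    have sub: "G.E 1 \<subseteq> P" using G.E_sub_P[of 1] I(2) by auto
    have pr: "prime_of A (ext (G.E 1))" by (rule prime_ext[OF G.E_prime sub]) auto
    obtain a s where as: "q = Fract a s" "s \<notin> P" using A_cases[OF q(1)] .
    have "\<psi>2 \<in> ext (G.E 1)" unfolding \<psi>2_def using G.\<psi>_mem(1)[of 0] of_R_ext by auto
    then have "q * \<psi>1 \<in> ext (G.E 1)" unfolding q(3) using ideal_ofD(4)[OF prime_ofD(1)[OF pr] q(2)] by blast
    moreover have "\<psi>1 \<notin> ext (G.E 1)"
      unfolding \<psi>1_def using Fract_mem_ext_prime[OF G.E_prime sub one_compl] G.\<psi>_mem(2)[of 1] by auto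
    ultimately have "q \<in> ext (G.E 1)" using prime_ofD(3)[OF pr q(1)] ideal_ofD(6)[OF prime_ofD(1)[OF J] \<psi>J(1)] by blast
    then have "a \<in> G.E 1" unfolding as(1) using Fract_mem_ext_prime[OF G.E_prime sub as(2)] by auto
    then obtain l c where l: "l \<notin> I" "l * a = (\<Sum>j<1. c j * G.\<psi> j)" using G.E_generated[of 1 a] by auto
    have "of_R l * q = Fract 1 s * of_R (l * a)" unfolding as(1) by simp
    also have "\<dots> = Fract (c 0) s * \<psi>2" unfolding l(2) \<psi>2_def by simp
    finally show ?thesis using of_R_compl[OF l(1)] as(2) by (intro bexI[of _ "of_R l"] bexI[of _ "Fract (c 0) s"]) (auto simp: A_def)
  qed
  have J_lt: "u \<in> J \<Longrightarrow> u \<in> A" for u using ideal_ofD(6)[OF prime_ofD(1)[OF J]] by blast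
  have ex: "\<exists>n g. J = lin_span A n g" using R3.noetherian prime_ofD(1)[OF J] unfolding noetherian_of_def by blast
  define N where "N = (LEAST n. \<exists>g. J = lin_span A n g)"
  obtain D where D: "J = lin_span A N D" using LeastI_ex[OF ex] unfolding N_def by blast
  have least: "J \<noteq> lin_span A n g" if "n < N" for n g using not_less_Least that unfolding N_def by blast
  have "N \<noteq> 0"
  proof
    assume "N = 0"
    then have "J = {0}" using D by (auto simp: lin_span_def)
    then show False using \<psi>J \<psi>2_nz by blast
  qed
  \<comment> \<open>With one generator, \<open>\<psi>1\<close> and \<open>\<psi>2\<close> are
    multiples of it. Regularity puts both cofactors into \<open>J\<close>, and cancelling the
    generator in its generic expression by \<open>\<psi>1\<close> and \<open>\<psi>2\<close> puts a
    multiplier outside \<open>J\<close> into \<open>J\<close>.\<close>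
  moreover have "N \<noteq> 1"
  proof
    assume "N = 1"
    then have J1: "J = lin_span A 1 D" using D by simp
    define f where "f = D 0"
    have fJ: "f \<in> J" unfolding J1 f_def using lin_span_gen[of 0 1 D] by simp
    have "\<exists>c\<in>A. u = c * f" if "u \<in> J" for u using that unfolding J1 f_def by (auto simp: lin_span_def)
    then obtain \<alpha> \<beta> where ab: "\<alpha> \<in> A" "\<beta> \<in> A" "\<psi>1 = \<alpha> * f" "\<psi>2 = \<beta> * f" using \<psi>J by meson
    have fnz: "f \<noteq> 0" using ab \<psi>2_nz by auto
    have "\<beta> * \<psi>1 = \<alpha> * \<psi>2" using ab by simp
    then obtain u c where u: "u \<in> A - J" "c \<in> A" "u * \<beta> = c * \<psi>2" using regular ab by blast
    have "u * \<beta> \<in> J" unfolding u(3) using ideal_ofD(4)[OF prime_ofD(1)[OF J] u(2) \<psi>J(2)] .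
    then have "\<beta> \<in> J" using prime_ofD(3)[OF J] u ab by blast
    have "u * \<alpha> * \<psi>2 = (u * \<beta>) * (\<alpha> * f)" unfolding ab(4) by (simp only: ac_simps)
    also have "\<dots> = c * \<psi>1 * \<psi>2" unfolding u(3) ab(3) by (simp only: ac_simps)
    finally have "u * \<alpha> * \<psi>2 = c * \<psi>1 * \<psi>2" .
    then have "u * \<alpha> = c * \<psi>1" using \<psi>2_nz by simp
    then have "u * \<alpha> \<in> J" using ideal_ofD(4)[OF prime_ofD(1)[OF J] u(2) \<psi>J(1)] by simp
    then have "\<alpha> \<in> J" using prime_ofD(3)[OF J] u ab by blast
    obtain w a b where w: "w \<in> A - J" "a \<in> A" "b \<in> A" "w * f = a * \<psi>1 + b * \<psi>2" using generate[OF fJ] by blast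
    have "w * f = (a * \<alpha> + b * \<beta>) * f" using w(4) ab by (simp add: algebra_simps)
    then have "w = a * \<alpha> + b * \<beta>" using fnz by simp
    moreover have "a * \<alpha> + b * \<beta> \<in> J"
      using \<open>\<alpha> \<in> J\<close> \<open>\<beta> \<in> J\<close> w ideal_ofD(3,4)[OF prime_ofD(1)[OF J]] by blast
    ultimately show False using w by blast
  qed
  ultimately have N2: "N \<ge> 2" by simp
  have y_notin: "y \<notin> J" unfolding y_def using mem_J[OF one_compl] notin by simp
  interpret H: height_two_prime A "ext P" y z x J N D
    by unfold_locales (use J y_notin D least N2 in auto)
  have "N \<noteq> 2"
  proof
    assume N: "N = 2"
    obtain k where k: "\<forall>l\<in>{..<N} - {1}. \<forall>j<N. k l j \<in> ext P" "J = lin_span A N (\<lambda>i. dt N (k(1 := unit_row i)))"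
      "\<forall>v. (\<forall>j<N. v j \<in> A) \<longrightarrow> (\<Sum>j<N. v j * dt N (k(1 := unit_row j))) = 0 \<longrightarrow>
        (\<exists>c. (\<forall>l\<in>{..<N} - {1}. c l \<in> A) \<and> (\<forall>i<N. v i = (\<Sum>l\<in>{..<N} - {1}. c l * k l i)))"
      using H.hilbert_burch[of 1] N by (auto elim!: exE conjE)
    \<comment> \<open>The Hilbert-Burch matrix has a single row, so the two generators are its
      entries in exchanged order, one of them with a sign. They are shown to be a regular
      sequence.\<close>
    define f g where "f = - k 0 1" and "g = k 0 0"
    have \<delta>: "dt N (k(1 := unit_row 0)) = f" "dt N (k(1 := unit_row 1)) = g"
      by (simp_all add: N dt_2 unit_row_def f_def g_def)
    have fgA: "f \<in> A" "g \<in> A" using k(1) N R3.M_sub by (auto simp: f_def g_def)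
    define xs where "xs = [f, g]"
    have gens: "genideal (localization P) (set ys) = lin_span A (length ys) ((!) ys)" if "set ys \<subseteq> A" for ys
      unfolding localization_eq by (rule genideal_sub_ring[OF that])
    have sum2: "(\<Sum>i<2. F i) = F 0 + F 1" for F :: "nat \<Rightarrow> 'a fract" by (simp add: numeral_2_eq_2)
    have J2: "J = {c 0 * f + c 1 * g |c. \<forall>i<2::nat. c i \<in> A}"
      unfolding k(2) unfolding lin_span_def N sum2 \<delta>[unfolded N] ..
    have "lin_span A 2 ((!) xs) = J" unfolding J2 lin_span_def sum2 by (simp add: xs_def)
    then have J_xs: "J = genideal (localization P) (set xs)"
      using gens[of xs] fgA by (simp add: xs_def numeral_2_eq_2)
    have "f \<noteq> 0"
    proof
      assume "f = 0"
      have "J = lin_span A 1 (\<lambda>_. g)"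
      proof
        show "J \<subseteq> lin_span A 1 (\<lambda>_. g)" unfolding J2 \<open>f = 0\<close> by (auto simp: lin_span_def intro: exI[of _ "\<lambda>_. c 1" for c])
        have "g \<in> J" unfolding J2 by (auto intro!: exI[of _ "\<lambda>i. if i = 0 then 0 else 1"])
        then show "lin_span A 1 (\<lambda>_. g) \<subseteq> J" by (intro lin_span_least[OF prime_ofD(1)[OF J]])
      qed
      then show False using least[of 1 "\<lambda>_. g"] N by simp
    qed
    have "complete_intersection (localization P) (extend_ideal P I)"
      unfolding complete_intersection_def
    proof (intro exI[of _ xs] conjI)
      show "extend_ideal P I = genideal (localization P) (set xs)"
        using extend_ideal_eq[OF prime_ofD(1)[OF I(1)]] J_xs by (simp add: J_def)
      show "enat (length xs) = height (localization P) (extend_ideal P I)"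
        using height extend_ideal_eq[OF prime_ofD(1)[OF I(1)]] by (simp add: xs_def numeral_eq_enat)
      show "regular_seq (localization P) xs"
        unfolding regular_seq_def
      proof (intro conjI allI impI ballI)
        show "set xs \<subseteq> carrier (localization P)" using fgA by (simp add: xs_def localization_eq)
        show "genideal (localization P) (set xs) \<noteq> carrier (localization P)"
          unfolding J_xs[symmetric] using prime_ofD(2)[OF J] one by (auto simp: localization_eq)
        fix i a assume i: "i < length xs" and a: "a \<in> carrier (localization P)"
          and h: "xs ! i \<otimes>\<^bsub>localization P\<^esub> a \<in> genideal (localization P) (set (take i xs))"
        have aA: "a \<in> A" using a by (simp add: localization_eq)
        consider "i = 0" | "i = 1" using i by (auto simp: xs_def less_Suc_eq)
        then show "a \<in> genideal (localization P) (set (take i xs))"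
        proof cases
          case 1
          then have "f * a = 0" using h gens[of "[]"] by (simp add: localization_eq xs_def lin_span_def)
          then have "a = 0" using \<open>f \<noteq> 0\<close> by simp
          then show ?thesis using 1 gens[of "[]"] by (simp add: lin_span_def)
        next
          case 2
          have span1: "genideal (localization P) (set (take i xs)) = {c * f |c. c \<in> A}"
            using 2 gens[of "[f]"] fgA by (auto simp: xs_def lin_span_def)
          then obtain b where b: "b \<in> A" "g * a = b * f" using h 2 by (auto simp: localization_eq xs_def)
          \<comment> \<open>The relation between \<open>f\<close> and \<open>g\<close>. It is a
            multiple of the single row, whose entry 1 is \<open>- f\<close>, so \<open>a\<close> is
            a multiple of \<open>f\<close>.\<close>
          define v where "v j = (if j = 0 then - b else a)" for j :: nat
          have "(\<Sum>j<N. v j * dt N (k(1 := unit_row j))) = - b * f + a * g"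
            using \<delta> by (simp add: N v_def numeral_2_eq_2)
          also have "\<dots> = 0" using b(2) by (simp add: mult.commute)
          finally have "\<exists>c. (\<forall>l\<in>{..<N} - {1}. c l \<in> A) \<and> (\<forall>i<N. v i = (\<Sum>l\<in>{..<N} - {1}. c l * k l i))"
            by (rule k(3)[rule_format, rotated]) (use aA b(1) in \<open>simp add: v_def uminus\<close>)
          then obtain c where c: "\<forall>l\<in>{..<N} - {1}. c l \<in> A" "\<forall>i<N. v i = (\<Sum>l\<in>{..<N} - {1}. c l * k l i)" by blast
          have "{..<N} - {1} = {0}" using N by auto
          then have "a = c 0 * k 0 1" "c 0 \<in> A" using c(1) c(2)[rule_format, of 1] N by (auto simp: v_def)
          then have "a = (- c 0) * f" "- c 0 \<in> A" by (auto simp: f_def)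
          then show ?thesis unfolding span1 by blast
        qed
      qed
    qed
    then show False using not_ci by simp
  qed
  then have N3: "N \<ge> 3" using N2 by simp
  interpret C: generic_complete_intersection A "ext P" y z x J N D \<psi>1 \<psi>2
    by unfold_locales (use \<psi>J \<psi>2_nz generate regular N3 in auto)
  show ?thesis using C.power_embedded[OF m] that unfolding J_def by blast
qed

section \<open>Homogeneous primes and closed subsets of projective space\<close>

definition tdeg :: "(4 \<Rightarrow>\<^sub>0 nat) \<Rightarrow> nat"
  where "tdeg t = (\<Sum>i\<in>UNIV. Poly_Mapping.lookup t i)"

definition hcomp :: "nat \<Rightarrow> 'k::field poly4 \<Rightarrow> 'k poly4"
  where "hcomp d f = (\<Sum>t\<in>{t \<in> Poly_Mapping.keys f. tdeg t = d}. Poly_Mapping.single t (Poly_Mapping.lookup f t))"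

lemma tdeg_add: "tdeg (s + t) = tdeg s + tdeg t"
  by (simp add: tdeg_def lookup_add sum.distrib)

lemma lookup_hcomp: "Poly_Mapping.lookup (hcomp d f) t = (if tdeg t = d then Poly_Mapping.lookup f t else 0)"
  by (auto simp: hcomp_def lookup_sum lookup_single when_def in_keys_iff)

lemma hcomp_add: "hcomp d (f + g) = hcomp d f + hcomp d g"
  by (rule poly_mapping_eqI) (simp add: lookup_hcomp lookup_add)

lemma hcomp_0: "hcomp d 0 = 0"
  by (rule poly_mapping_eqI) (simp add: lookup_hcomp)

lemma hcomp_sum: "hcomp d (sum h Y) = (\<Sum>i\<in>Y. hcomp d (h i))"
  by (induction Y rule: infinite_finite_induct) (auto simp: hcomp_0 hcomp_add)

lemma homogeneous_poly_iff: "homogeneous_poly d f \<longleftrightarrow> (\<forall>t\<in>Poly_Mapping.keys f. tdeg t = d)"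
  by (simp add: homogeneous_poly_def tdeg_def)

lemma homogeneous_hcomp: "homogeneous_poly d (hcomp d f)"
  by (auto simp: homogeneous_poly_iff in_keys_iff lookup_hcomp split: if_splits)

lemma hcomp_homogeneous:
  assumes "homogeneous_poly e f"
  shows "hcomp d f = (if d = e then f else 0)"
  using assms by (intro poly_mapping_eqI) (auto simp: homogeneous_poly_iff lookup_hcomp in_keys_iff)

lemma homogeneous_mult:
  assumes "homogeneous_poly d f" "homogeneous_poly e g"
  shows "homogeneous_poly (d + e) (f * g)"
  unfolding homogeneous_poly_iff
proof
  fix t assume "t \<in> Poly_Mapping.keys (f * g)"
  then obtain a b where "a \<in> Poly_Mapping.keys f" "b \<in> Poly_Mapping.keys g" "t = a + b"
    using subsetD[OF keys_mult, of t f g] by blast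
  then show "tdeg t = d + e" using assms by (simp add: homogeneous_poly_iff tdeg_add)
qed

lemma hcomp_decompose:
  obtains N where "\<And>n. n > N \<Longrightarrow> hcomp n f = 0" "f = (\<Sum>n\<le>N. hcomp n f)"
proof -
  obtain N where N: "\<forall>t\<in>Poly_Mapping.keys f. tdeg t \<le> N"
    using finite_nat_set_iff_bounded_le[of "tdeg ` Poly_Mapping.keys f"] by auto
  have z: "Poly_Mapping.lookup f t = 0" if "tdeg t > N" for t
    using N that by (meson in_keys_iff leD)
  have "hcomp n f = 0" if "n > N" for n
    using z that by (intro poly_mapping_eqI) (auto simp: lookup_hcomp)
  moreover have "f = (\<Sum>n\<le>N. hcomp n f)"
    by (rule poly_mapping_eqI) (use z in \<open>auto simp: lookup_sum lookup_hcomp not_le\<close>)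
  ultimately show ?thesis using that by blast
qed

lemma hcomp_mult:
  assumes f: "f = (\<Sum>i\<le>N. hcomp i f)" and g: "g = (\<Sum>j\<le>N'. hcomp j g)"
  shows "hcomp n (f * g) = (\<Sum>i\<le>N. \<Sum>j\<le>N'. if n = i + j then hcomp i f * hcomp j g else 0)"
proof -
  have "f * g = (\<Sum>i\<le>N. \<Sum>j\<le>N'. hcomp i f * hcomp j g)"
    by (subst f, subst g) (rule sum_product)
  moreover have "hcomp n (hcomp i f * hcomp j g) = (if n = i + j then hcomp i f * hcomp j g else 0)" for i j
    by (rule hcomp_homogeneous[OF homogeneous_mult[OF homogeneous_hcomp homogeneous_hcomp]])
  ultimately show ?thesis by (simp only: hcomp_sum)
qed

lemma genideal_type_ring: "genideal poly4_ring S = \<Inter> {K. ideal_of UNIV K \<and> S \<subseteq> K}"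
  by (simp add: genideal_def ideal_type_ring)

text \<open>The polynomials all of whose homogeneous components lie in \<open>J\<close> form an
  ideal, and this ideal contains the homogeneous generators.\<close>

lemma hcomp_mem:
  fixes J :: "'k::field poly4 set"
  assumes "homogeneous_ideal J" "f \<in> J"
  shows "hcomp d f \<in> J"
proof -
  obtain S where S: "\<forall>f\<in>S. \<exists>d. homogeneous_poly d f" "J = genideal poly4_ring S"
    using assms(1) unfolding homogeneous_ideal_def by blast
  have J: "ideal_of UNIV J"
    unfolding S(2) genideal_type_ring ideal_of_def by auto
  have SJ: "S \<subseteq> J" unfolding S(2) genideal_type_ring by blast
  define K where "K = {f. \<forall>d. hcomp d f \<in> J}"
  have "ideal_of UNIV K"
    unfolding ideal_of_def
  proof (intro conjI ballI)
    show "0 \<in> K" using ideal_ofD(2)[OF J] by (simp add: K_def hcomp_0)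
    show "a + b \<in> K" if "a \<in> K" "b \<in> K" for a b
      using that ideal_ofD(3)[OF J] by (simp add: K_def hcomp_add)
    show "s * a \<in> K" if "a \<in> K" for s a
    proof -
      obtain N where N: "s = (\<Sum>i\<le>N. hcomp i s)" using hcomp_decompose by blast
      obtain N' where N': "a = (\<Sum>i\<le>N'. hcomp i a)" using hcomp_decompose by blast
      have "hcomp n (s * a) \<in> J" for n
        unfolding hcomp_mult[OF N N']
        by (intro ideal_of_sum[OF J]) (use that ideal_ofD(2,4)[OF J] in \<open>auto simp: K_def\<close>)
      then show ?thesis by (simp add: K_def)
    qed
  qed auto
  moreover have "S \<subseteq> K"
  proof
    fix f assume f: "f \<in> S"
    then obtain e where "homogeneous_poly e f" using S(1) by blast
    then show "f \<in> K" using hcomp_homogeneous[of e f] f SJ ideal_ofD(2)[OF J] by (auto simp: K_def)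
  qed
  ultimately have "J \<subseteq> K" unfolding S(2) genideal_type_ring by blast
  then show ?thesis using assms(2) by (auto simp: K_def)
qed

lemma proj3_prime: "P \<in> proj3 \<Longrightarrow> prime_of UNIV P"
  by (simp add: proj3_def primeideal_type_ring)

lemma proj3_hcomp: "P \<in> proj3 \<Longrightarrow> f \<in> P \<Longrightarrow> hcomp d f \<in> P"
  using hcomp_mem by (auto simp: proj3_def)

lemma proj_closed_eq:
  assumes "proj_closed Z"
  shows "Z = {P \<in> proj3. \<Inter>Z \<subseteq> P}"
  using assms unfolding proj_closed_def zero_locus_def by blast

lemma proj_closed_Int_hypersurface:
  fixes Z :: "'k::field poly4 set set"
  assumes Z: "proj_closed Z" and f: "homogeneous_poly d f"
  shows "proj_closed {P \<in> Z. f \<in> P}"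
proof -
  obtain S where S: "\<forall>f\<in>S. \<exists>d. homogeneous_poly d f" "Z = zero_locus (genideal poly4_ring S)"
    using Z unfolding proj_closed_def homogeneous_ideal_def by blast
  have sub: "genideal poly4_ring T \<subseteq> P \<longleftrightarrow> T \<subseteq> P" if "P \<in> proj3" for P T :: "'k poly4 set"
    using prime_ofD(1)[OF proj3_prime[OF that]] unfolding genideal_type_ring by blast
  have "{P \<in> Z. f \<in> P} = zero_locus (genideal poly4_ring (insert f S))"
    unfolding S(2) zero_locus_def by (rule Set.set_eqI) (auto simp: sub cong: conj_cong)
  moreover have "homogeneous_ideal (genideal poly4_ring (insert f S))"
    unfolding homogeneous_ideal_def using S(1) f by (intro exI[of _ "insert f S"]) auto
  ultimately show ?thesis unfolding proj_closed_def by blast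
qed

text \<open>For homogeneous factors, the two hypersurface sections cover \<open>Z\<close>, and
  irreducibility makes one of them all of \<open>Z\<close>. For arbitrary factors take the highest
  components outside the ideal, of degrees a and b: in degree a + b every other product of
  components has a factor in the ideal.\<close>

lemma irreducible_prime:
  fixes Z :: "'k::field poly4 set set"
  assumes Z: "irreducible_closed Z"
  shows "prime_of UNIV (\<Inter>Z)"
proof -
  have closed: "proj_closed Z" and ne: "Z \<noteq> {}"
    and irred: "\<And>Y Y'. proj_closed Y \<Longrightarrow> proj_closed Y' \<Longrightarrow> Z = Y \<union> Y' \<Longrightarrow> Z = Y \<or> Z = Y'"
    using Z unfolding irreducible_closed_def by blast+
  define J where "J = \<Inter>Z"
  have Z3: "Q \<in> proj3" if "Q \<in> Z" for Q using proj_closed_eq[OF closed] that by blast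
  have pr: "prime_of UNIV Q" if "Q \<in> Z" for Q using proj3_prime[OF Z3[OF that]] .
  have J: "ideal_of UNIV J"
    unfolding ideal_of_def J_def using ideal_ofD[OF prime_ofD(1)[OF pr]] by auto
  have hJ: "hcomp d f \<in> J" if "f \<in> J" for d f using that Z3 proj3_hcomp unfolding J_def by blast
  have top: "\<exists>n. hcomp n f \<notin> J \<and> (\<forall>i>n. hcomp i f \<in> J)" if "f \<notin> J" for f
  proof -
    obtain N where N: "\<And>n. n > N \<Longrightarrow> hcomp n f = 0" "f = (\<Sum>n\<le>N. hcomp n f)" using hcomp_decompose by blast
    define Y where "Y = {n. hcomp n f \<notin> J}"
    have "n \<le> N" if "n \<in> Y" for n using N(1)[of n] that ideal_ofD(2)[OF J] by (cases "n > N") (auto simp: Y_def)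
    then have "Y \<subseteq> {..N}" by auto
    then have fin: "finite Y" using finite_subset by blast
    have "\<exists>n. hcomp n f \<notin> J"
    proof (rule ccontr)
      assume "\<nexists>n. hcomp n f \<notin> J"
      then have "(\<Sum>n\<le>N. hcomp n f) \<in> J" by (intro ideal_of_sum[OF J]) auto
      then show False using N(2) that by simp
    qed
    then have "Y \<noteq> {}" by (auto simp: Y_def)
    then obtain M where "M \<in> Y" "\<forall>i>M. i \<notin> Y" using Max_in[OF fin] Max_ge[OF fin] leD by blast
    then show ?thesis by (intro exI[of _ M]) (simp add: Y_def)
  qed
  have hom: "f \<in> J \<or> g \<in> J" if fg: "homogeneous_poly d f" "homogeneous_poly e g" "f * g \<in> J" for d e f g
  proof -
    have "Z = {Q \<in> Z. f \<in> Q} \<union> {Q \<in> Z. g \<in> Q}" using fg(3) prime_ofD(3)[OF pr] unfolding J_def by auto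
    then have "Z = {Q \<in> Z. f \<in> Q} \<or> Z = {Q \<in> Z. g \<in> Q}"
      by (rule irred[OF proj_closed_Int_hypersurface[OF closed fg(1)] proj_closed_Int_hypersurface[OF closed fg(2)]])
    then show ?thesis unfolding J_def by blast
  qed
  have "f \<in> J \<or> g \<in> J" if fg: "f * g \<in> J" for f g
  proof (rule ccontr)
    assume "\<not> ?thesis"
    then obtain a b where a: "hcomp a f \<notin> J" "\<forall>i>a. hcomp i f \<in> J" and b: "hcomp b g \<notin> J" "\<forall>i>b. hcomp i g \<in> J"
      using top by blast
    obtain N0 where N0: "\<And>n. n > N0 \<Longrightarrow> hcomp n f = 0" "f = (\<Sum>n\<le>N0. hcomp n f)" using hcomp_decompose by blast
    obtain N1 where N1: "\<And>n. n > N1 \<Longrightarrow> hcomp n g = 0" "g = (\<Sum>n\<le>N1. hcomp n g)" using hcomp_decompose by blast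
    have aN: "a \<le> N0" using a(1) N0(1) ideal_ofD(2)[OF J] by (metis not_le)
    have bN: "b \<le> N1" using b(1) N1(1) ideal_ofD(2)[OF J] by (metis not_le)
    define T where "T = (\<lambda>(i, j). if a + b = i + j then hcomp i f * hcomp j g else 0)"
    have "hcomp (a + b) (f * g) = (\<Sum>ij\<in>{..N0} \<times> {..N1}. T ij)"
      unfolding hcomp_mult[OF N0(2) N1(2)] T_def by (simp add: sum.cartesian_product)
    also have "\<dots> = T (a, b) + (\<Sum>ij\<in>{..N0} \<times> {..N1} - {(a, b)}. T ij)"
      using aN bN by (intro sum.remove) auto
    finally have eq: "hcomp (a + b) (f * g) = hcomp a f * hcomp b g + (\<Sum>ij\<in>{..N0} \<times> {..N1} - {(a, b)}. T ij)"
      by (simp add: T_def)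
    have "T ij \<in> J" if ne: "ij \<noteq> (a, b)" for ij
    proof -
      obtain i j where ij: "ij = (i, j)" by fastforce
      show ?thesis
      proof (cases "a + b = i + j")
        case True
        then consider "i > a" | "j > b" using ne ij by (metis add_less_le_mono linorder_neqE_nat not_less order_less_irrefl add_left_cancel)
        then show ?thesis
        proof cases
          case 1
          then have "hcomp j g * hcomp i f \<in> J" using ideal_ofD(4)[OF J UNIV_I] a(2) by blast
          then show ?thesis using ideal_ofD(2)[OF J] by (simp add: T_def ij mult.commute)
        next
          case 2
          then have "hcomp i f * hcomp j g \<in> J" using ideal_ofD(4)[OF J UNIV_I] b(2) by blast
          then show ?thesis using ideal_ofD(2)[OF J] by (simp add: T_def ij)
        qed
      qed (use ideal_ofD(2)[OF J] in \<open>simp add: T_def ij\<close>)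
    qed
    then have S: "(\<Sum>ij\<in>{..N0} \<times> {..N1} - {(a, b)}. T ij) \<in> J" by (intro ideal_of_sum[OF J]) auto
    have "hcomp (a + b) (f * g) - (\<Sum>ij\<in>{..N0} \<times> {..N1} - {(a, b)}. T ij) \<in> J"
      by (rule csubring.ideal_diff[OF csubring_UNIV J hJ[OF fg] S])
    then have "hcomp a f * hcomp b g \<in> J" unfolding eq by simp
    then show False using hom[OF homogeneous_hcomp homogeneous_hcomp] a(1) b(1) by blast
  qed
  moreover have "1 \<notin> J" using ne prime_ofD(2)[OF pr] unfolding J_def by blast
  ultimately show ?thesis using J unfolding prime_of_def J_def by blast
qed

lemma irreducible_chain:
  fixes Z Z' :: "'k::field poly4 set set"
  assumes "irreducible_closed Z" "irreducible_closed Z'" "Z \<subset> Z'"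
  shows "\<Inter>Z' \<subset> \<Inter>Z"
proof -
  have closed: "proj_closed Z" "proj_closed Z'" using assms(1,2) by (simp_all add: irreducible_closed_def)
  have "\<Inter>Z' \<noteq> \<Inter>Z"
  proof
    assume eq: "\<Inter>Z' = \<Inter>Z"
    have "Z = {P \<in> proj3. \<Inter>Z \<subseteq> P}" by (rule proj_closed_eq[OF closed(1)])
    also have "\<dots> = {P \<in> proj3. \<Inter>Z' \<subseteq> P}" unfolding eq ..
    also have "\<dots> = Z'" by (rule proj_closed_eq[OF closed(2), symmetric])
    finally show False using assms(3) by simp
  qed
  moreover have "\<Inter>Z' \<subseteq> \<Inter>Z" using assms(3) by (intro Inter_anti_mono) auto
  ultimately show ?thesis by simp
qed

text \<open>A chain of closed sets above \<open>V\<close> gives a chain of primes below its ideal.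
  The middle prime is nonzero because it properly contains the lowest one.\<close>

lemma codim_two_chain:
  fixes V :: "'k::field poly4 set set"
  assumes "proj_codim V = 2"
  obtains Q where "prime_of UNIV Q" "Q \<noteq> {0}" "Q \<subset> \<Inter>V"
proof -
  have "1 < proj_codim V" using assms by simp
  then obtain n C where n: "1 < enat n" and C: "\<forall>i\<le>n. irreducible_closed (C i)" "\<forall>i<n. C i \<subset> C (Suc i)" "C 0 = V"
    unfolding proj_codim_def less_SUP_iff by blast
  have n2: "n \<ge> 2" using n by (simp add: one_enat_def)
  have "\<Inter>(C (Suc 0)) \<subset> \<Inter>(C 0)" "\<Inter>(C (Suc (Suc 0))) \<subset> \<Inter>(C (Suc 0))"
    by (rule irreducible_chain; use C(1,2) n2 in simp)+
  moreover have "prime_of UNIV (\<Inter>(C (Suc 0)))" "prime_of UNIV (\<Inter>(C (Suc (Suc 0))))"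
    by (rule irreducible_prime; use C(1) n2 in simp)+
  moreover have "0 \<in> \<Inter>(C (Suc (Suc 0)))" using ideal_ofD(2)[OF prime_ofD(1)[OF calculation(4)]] .
  moreover have "B \<noteq> {0}" if "A \<subset> B" "0 \<in> A" for A B :: "'k poly4 set" using that by blast
  ultimately show ?thesis using that[of "\<Inter>(C (Suc 0))"] C(3) by metis
qed

text \<open>Homogeneity matters here: the components of a polynomial in one variable are scalar
  multiples of powers of that variable, and the prime contains none of these powers. So a point of
  projective space has transcendence degree at least one.\<close>

lemma proj3_variable:
  assumes "p \<in> proj3"
  obtains i where "poly_var i \<notin> p" "indep {i} p"
proof -
  note P = proj3_prime[OF assms]
  note I = prime_ofD(1)[OF P]
  have "\<not> irrelevant_ideal \<subseteq> p" using assms by (auto simp: proj3_def)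
  then have "\<not> range poly_var \<subseteq> p" using I unfolding irrelevant_ideal_def genideal_type_ring by blast
  then obtain i where i: "poly_var i \<notin> p" by blast
  have "f = 0" if f: "f \<in> supported {i}" "f \<in> p" for f
  proof (rule ccontr)
    assume "f \<noteq> 0"
    then obtain t where t: "t \<in> Poly_Mapping.keys f" by fastforce
    have key: "s = Poly_Mapping.single i (tdeg s)" if "s \<in> Poly_Mapping.keys f" for s
    proof -
      have z: "Poly_Mapping.lookup s j = 0" if "j \<noteq> i" for j
        using f(1) \<open>s \<in> _\<close> that by (auto simp: supported_def)
      have "tdeg s = (\<Sum>j\<in>{i}. Poly_Mapping.lookup s j)"
        unfolding tdeg_def by (rule sum.mono_neutral_right) (use z in auto)
      then show ?thesis using z by (intro poly_mapping_eqI) (auto simp: lookup_single when_def)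
    qed
    define c where "c = Poly_Mapping.lookup f t"
    have cnz: "c \<noteq> 0" using t by (simp add: c_def in_keys_iff)
    have "hcomp (tdeg t) f = Poly_Mapping.single t c"
    proof (rule poly_mapping_eqI)
      fix s
      show "Poly_Mapping.lookup (hcomp (tdeg t) f) s = Poly_Mapping.lookup (Poly_Mapping.single t c) s"
        using key[of s] key[OF t] by (cases "s \<in> Poly_Mapping.keys f")
          (auto simp: lookup_hcomp lookup_single when_def c_def in_keys_iff)
    qed
    then have "Poly_Mapping.single t c \<in> p" using proj3_hcomp[OF assms f(2), of "tdeg t"] by simp
    then have "Poly_Mapping.single 0 (inverse c) * Poly_Mapping.single t c \<in> p" using ideal_ofD(4)[OF I UNIV_I] by blast
    then have "poly_var i ^ tdeg t \<in> p"
      using cnz by (simp add: mult_single poly_var_power flip: key[OF t])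
    then show False using csubring.prime_power[OF csubring_UNIV P UNIV_I] i by blast
  qed
  then have "indep {i} p"
    using ideal_ofD(2)[OF I] csubring.zero[OF csubring_supported] by (auto simp: indep_def)
  then show ?thesis using that i by blast
qed

section \<open>Primes of dimension one over a prime of dimension two\<close>

text \<open>Zorn's lemma: the union of a chain is a finitely generated ideal, and the member of the
  chain that contains the generators is already the union.\<close>

lemma noetherian_maximal:
  assumes noeth: "noetherian_of (UNIV :: 'a::comm_ring_1 set)"
    and F: "F \<noteq> {}" "\<And>K. K \<in> F \<Longrightarrow> ideal_of (UNIV :: 'a set) K"
  obtains M where "M \<in> F" "\<And>K. K \<in> F \<Longrightarrow> M \<subseteq> K \<Longrightarrow> K = M"
proof -
  have "\<Union>C \<in> F" if C: "C \<noteq> {}" "subset.chain F C" for C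
  proof -
    have CF: "C \<subseteq> F" and lin: "\<And>K L. K \<in> C \<Longrightarrow> L \<in> C \<Longrightarrow> K \<subseteq> L \<or> L \<subseteq> K"
      using C(2) by (auto simp: subset.chain_def)
    note ideal = ideal_ofD[OF F(2)[OF subsetD[OF CF]]]
    have "ideal_of UNIV (\<Union>C)"
      unfolding ideal_of_def
    proof (intro conjI ballI)
      show "0 \<in> \<Union>C" using C(1) ideal(2) by blast
      show "a + b \<in> \<Union>C" if ab: "a \<in> \<Union>C" "b \<in> \<Union>C" for a b
      proof -
        obtain K L where KL: "K \<in> C" "a \<in> K" "L \<in> C" "b \<in> L" using ab by blast
        then obtain M where "M \<in> C" "a \<in> M" "b \<in> M" using lin[of K L] by blast
        then show ?thesis using ideal(3) by blast
      qed
      show "s * a \<in> \<Union>C" if "a \<in> \<Union>C" for s a using that ideal(4) by blast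
    qed auto
    then obtain n g where g: "\<forall>i<(n::nat). g i \<in> \<Union>C" "\<Union>C = lin_span UNIV n g"
      using noeth unfolding noetherian_of_def by blast
    have "finite (g ` {..<n})" "g ` {..<n} \<subseteq> \<Union>C" using g(1) by auto
    then obtain K where K: "K \<in> C" "g ` {..<n} \<subseteq> K"
      using finite_subset_Union_chain[OF _ _ C(1) C(2)] by metis
    have "\<Union>C \<subseteq> K" unfolding g(2) by (rule lin_span_least) (use F(2) CF K in auto)
    then have "\<Union>C = K" using K(1) by blast
    then show ?thesis using K(1) CF by auto
  qed
  then obtain M where "M \<in> F" "\<forall>K\<in>F. M \<subseteq> K \<longrightarrow> K = M" using subset_Zorn_nonempty[OF F(1)] by blast
  then show ?thesis using that by blast
qed

text \<open>A maximal ideal among the \<open>(J : D)\<close> with \<open>D\<close> nonzero in the localization of the quotient is prime.\<close>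
lemma colon_prime:
  fixes J :: "'a::comm_ring_1 set"
  assumes noeth: "noetherian_of (UNIV :: 'a set)" and J: "ideal_of UNIV J" and P: "prime_of UNIV P"
    and D0: "\<And>s. s \<notin> P \<Longrightarrow> s * D0 \<notin> J"
  obtains D where "prime_of UNIV {r. r * D \<in> J}" "{r. r * D0 \<in> J} \<subseteq> {r. r * D \<in> J}" "{r. r * D \<in> J} \<subseteq> P"
proof -
  define colon where "colon D = {r. r * D \<in> J}" for D
  define F where "F = {colon D |D. (\<forall>s. s \<notin> P \<longrightarrow> s * D \<notin> J) \<and> colon D0 \<subseteq> colon D}"
  have ideal: "ideal_of UNIV (colon D)" for D
    unfolding ideal_of_def colon_def using ideal_ofD[OF J] by (auto simp: distrib_right mult.assoc)
  obtain M where M: "M \<in> F" "\<And>K. K \<in> F \<Longrightarrow> M \<subseteq> K \<Longrightarrow> K = M"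
  proof (rule noetherian_maximal[OF noeth, of F])
    show "F \<noteq> {}" using D0 unfolding F_def by blast
  qed (use ideal in \<open>auto simp: F_def\<close>)
  then obtain D where D: "M = colon D" "\<And>s. s \<notin> P \<Longrightarrow> s * D \<notin> J" "colon D0 \<subseteq> colon D"
    unfolding F_def by blast
  have sub: "colon D \<subseteq> P" using D(2) by (auto simp: colon_def)
  have up: "colon D \<subseteq> colon (a * D)" for a
    using ideal_ofD(4)[OF J UNIV_I, of "_ * D" a] by (auto simp: colon_def mult.left_commute)
  have max: "colon (a * D) = colon D" if "\<And>s. s \<notin> P \<Longrightarrow> s * (a * D) \<notin> J" for a
    using M(2)[of "colon (a * D)"] that up[of a] D(1,3) unfolding F_def by blast
  have "a \<in> colon D \<or> b \<in> colon D" if ab: "a * b \<in> colon D" for a b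
  proof (rule ccontr)
    assume n: "\<not> ?thesis"
    have "b \<in> colon (a * D)" using ab by (simp add: colon_def ac_simps)
    then have "\<not> (\<forall>s. s \<notin> P \<longrightarrow> s * (a * D) \<notin> J)" using max[of a] n by blast
    then obtain s where s: "s \<notin> P" "s * (a * D) \<in> J" by blast
    \<comment> \<open>Because \<open>s\<close> is outside \<open>P\<close>, the element
      \<open>s * D\<close> is admissible as well, and its colon ideal contains \<open>a\<close>;
      maximality puts \<open>a\<close> into the colon ideal of \<open>D\<close>.\<close>
    have "colon (s * D) = colon D"
    proof (rule max)
      fix s' assume "s' \<notin> P"
      then have "s' * s \<notin> P" using prime_ofD(3)[OF P] s(1) by blast
      then show "s' * (s * D) \<notin> J" using D(2)[of "s' * s"] by (simp add: mult.assoc)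
    qed
    moreover have "a \<in> colon (s * D)" using s(2) by (simp add: colon_def mult.left_commute)
    ultimately show False using n by blast
  qed
  then have "prime_of UNIV (colon D)"
    using ideal sub prime_ofD(2)[OF P] unfolding prime_of_def by blast
  then show ?thesis using that[of D] D(3) sub unfolding colon_def by blast
qed

lemma zero_prime: "prime_of UNIV {0 :: 'a::idom}"
  by (auto simp: prime_of_def ideal_of_def)

text \<open>The transcendence degree bounds the height from above. From below, the zero prime and
  \<open>Q\<close> are followed by an arbitrary prime \<open>K\<close> over \<open>I\<close>, since
  the height is an infimum over all such primes.\<close>

lemma height_extension_eq_2:
  fixes p :: "'k::field poly4 set"
  assumes p: "prime_of UNIV p" and I: "prime_of UNIV I" "I \<subseteq> p" and trI: "trdeg I = 2"
    and Q: "prime_of UNIV Q" "Q \<noteq> {0}" "Q \<subset> I"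
  shows "height (localization p) (prime_localization.ext p I) = 2"
proof -
  interpret prime_localization p by unfold_locales (rule p)
  have mem: "Fract a 1 \<in> ext K \<longleftrightarrow> a \<in> K" if "prime_of UNIV K" "K \<subseteq> p" for a K
    by (rule Fract_mem_ext_prime[OF that one_compl])
  have strict: "ext K \<subset> ext L" if KL: "prime_of UNIV K" "prime_of UNIV L" "K \<subset> L" "L \<subseteq> p" for K L
  proof -
    obtain a where a: "a \<in> L" "a \<notin> K" using KL(3) by blast
    have "Fract a 1 \<in> ext L" using mem[OF KL(2,4)] a(1) by blast
    moreover have "Fract a 1 \<notin> ext K" using mem[OF KL(1), of a] KL(3,4) a(2) by blast
    ultimately show ?thesis using ext_mono[of K L] KL(3) by blast
  qed
  have zQ: "{0} \<subset> Q" using ideal_ofD(2)[OF prime_ofD(1)[OF Q(1)]] Q(2) by blast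
  show ?thesis
  proof (rule antisym)
    have "height (localization p) (ext I) \<le> height_prime (localization p) (ext I)"
      unfolding height_eq using prime_ext[OF I] by (intro INF_lower) auto
    also have "\<dots> \<le> enat (4 - trdeg I)" by (rule height_prime_le[OF trdeg_strict trdeg_le_4 I])
    finally show "height (localization p) (ext I) \<le> 2" by (simp add: trI numeral_eq_enat)
    show "2 \<le> height (localization p) (ext I)"
      unfolding height_eq
    proof (rule INF_greatest)
      fix K assume "K \<in> {Q. prime_of A Q \<and> ext I \<subseteq> Q}"
      then have K: "prime_of A K" "ext I \<subseteq> K" by auto
      define C where "C = (\<lambda>i :: nat. if i = 0 then ext {0} else if i = 1 then ext Q else K)"
      have "enat 2 \<le> height_prime (localization p) (C 2)"
      proof (rule height_prime_ge)
        show "prime_of A (C i)" for i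
          using K(1) prime_ext[OF zero_prime] prime_ext[OF Q(1)] zQ Q(3) I(2) by (auto simp: C_def)
        show "C i \<subset> C (Suc i)" if "i < 2" for i
          using that strict[OF zero_prime Q(1) zQ] strict[OF Q(1) I(1) Q(3) I(2)] K(2) Q(3) I(2)
          by (auto simp: C_def less_2_cases_iff)
      qed
      then show "2 \<le> height_prime (localization p) K" by (simp add: C_def numeral_eq_enat)
    qed
  qed
qed

theorem power_embedded_poly4:
  fixes I p :: "'k::field poly4 set"
  assumes p: "prime_of UNIV p" "indep {i0} p"
    and I: "prime_of UNIV I" "I \<subseteq> p" and Q: "prime_of UNIV Q" "Q \<noteq> {0}" "Q \<subset> I"
    and not_ci: "\<not> complete_intersection (localization p) (extend_ideal p I)"
    and m: "m \<ge> 2"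
  obtains D u where "u \<notin> I" "u * D \<in> ipow UNIV I m" "prime_of UNIV {r. r * D \<in> ipow UNIV I m}"
    "{r. r * D \<in> ipow UNIV I m} = p" "I \<subset> p"
proof -
  interpret prime_localization p by unfold_locales (rule p)
  have ne: "I \<noteq> p" using maximal_complete_intersection[OF p(1)] not_ci by blast
  then have Ip: "I \<subset> p" using I(2) by blast
  have zQ: "{0} \<subset> Q" using ideal_ofD(2)[OF prime_ofD(1)[OF Q(1)]] Q(2) by blast
  \<comment> \<open>The strictly decreasing degrees of zero, \<open>Q\<close>, \<open>I\<close> and
    \<open>p\<close> lie between 4 and 1, which determines the last two.\<close>
  have "trdeg Q < trdeg {0 :: 'k poly4}" "trdeg I < trdeg Q" "trdeg p < trdeg I"
    using trdeg_strict zero_prime Q I p zQ Ip by blast+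
  moreover have "trdeg {0 :: 'k poly4} \<le> 4" by (rule trdeg_le_4[OF zero_prime])
  moreover have "1 \<le> trdeg p" using trdeg_ge[OF p(2)] by simp
  ultimately have tr: "trdeg I = 2" "trdeg p = 1" by linarith+
  have iI: "indep {i0} I" using indep_antimono[OF I(2) ideal_ofD(2)[OF prime_ofD(1)[OF I(1)]] p(2)] .
  \<comment> \<open>Otherwise {i0} would be a maximal independent set for \<open>I\<close>, and the
    larger prime \<open>p\<close> would contain a nonzero polynomial in that variable.\<close>
  have "\<exists>j. j \<noteq> i0 \<and> indep {i0, j} I"
  proof (rule ccontr)
    assume "\<not> ?thesis"
    then have max: "\<not> indep (insert j {i0}) I" if "j \<notin> {i0}" for j using that by (auto simp: insert_commute)
    obtain w where w: "inj_on w {..<4 - card {i0}}" "w ` {..<4 - card {i0}} = - {i0}" using enumerate_complement .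
    interpret T: algebraic_tower "\<lambda>i. supported ({i0} \<union> w ` {..<i})" "\<lambda>i. poly_var (w i)" "4 - card {i0}" I
      by (rule algebraic_tower_supported[OF I(1) iI max w])
    obtain f where "f \<in> p" "f \<notin> I" using Ip by blast
    then obtain c where "c \<in> supported {i0}" "c \<in> p" "c \<noteq> 0"
      using T.larger_prime_meets_base[OF prime_ofD(1)[OF p(1)] I(2)] by auto
    then show False using p(2) by (auto simp: indep_def)
  qed
  then obtain i1 where i1: "i1 \<noteq> i0" "indep {i0, i1} I" by blast
  have card2: "4 - card {i0, i1} = 2" using i1 by simp
  obtain w' :: "nat \<Rightarrow> 4" where w': "inj_on w' {..<2}" "w' ` {..<2} = - {i0, i1}"
    using enumerate_complement[of "{i0, i1}"] unfolding card2 .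
  \<comment> \<open>The variable \<open>i1\<close> is adjoined first, so that the first parameter at
    \<open>p\<close> is a polynomial in the two variables that are independent modulo
    \<open>I\<close>. It is nonzero and hence outside \<open>I\<close>.\<close>
  define w where "w i = (case i of 0 \<Rightarrow> i1 | Suc i \<Rightarrow> w' i)" for i
  have ins: "{..<3} = insert 0 (Suc ` {..<2})" by (auto simp: image_iff less_Suc_eq_0_disj numeral_3_eq_3 numeral_2_eq_2)
  have w: "inj_on w {..<3}" "w ` {..<3} = - {i0}"
  proof -
    have "w ` Suc ` {..<2} = - {i0, i1}" unfolding w'(2)[symmetric] by (simp add: image_image w_def)
    moreover have "inj_on w (Suc ` {..<2})" using w'(1) by (auto simp: inj_on_def w_def)
    moreover have "w 0 = i1" by (simp add: w_def)
    ultimately show "inj_on w {..<3}" "w ` {..<3} = - {i0}" unfolding ins using i1(1) by auto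
  qed
  interpret T: algebraic_tower "\<lambda>i. supported ({i0} \<union> w ` {..<i})" "\<lambda>i. poly_var (w i)" 3 p
  proof (rule algebraic_tower_supported[OF p _ w])
    show "\<not> indep (insert i {i0}) p" if "i \<notin> {i0}" for i
      using trdeg_ge[of "insert i {i0}" p] that tr by auto
  qed
  have G: "algebraic_tower (\<lambda>i. supported ({i0, i1} \<union> w' ` {..<i})) (\<lambda>i. poly_var (w' i)) 2 I"
  proof (rule algebraic_tower_supported[OF I(1) i1(2) _ w'])
    show "\<not> indep (insert i {i0, i1}) I" if "i \<notin> {i0, i1}" for i
      using trdeg_ge[of "insert i {i0, i1}" I] that tr i1 by auto
  qed
  have base1: "{i0} \<union> w ` {..<Suc 0} = {i0, i1}" by (auto simp: w_def)
  have "T.\<psi> 0 \<in> supported ({i0} \<union> w ` {..<Suc 0})" by (rule T.\<psi>_mem(4)) simp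
  then have "T.\<psi> 0 \<in> supported {i0, i1}" unfolding base1 .
  moreover have "T.\<psi> 0 \<noteq> 0" using T.\<psi>_mem(2)[of 0] T.E_0 by auto
  ultimately have notin: "T.\<psi> 0 \<notin> I" using i1(2) by (auto simp: indep_def)
  have TL: "tower_localization (\<lambda>i. supported ({i0} \<union> w ` {..<i})) (\<lambda>i. poly_var (w i)) 3 p"
    by (intro tower_localization.intro T.algebraic_tower_axioms prime_localization_axioms)
  obtain a e where ae: "a \<in> A - ext I" "e \<in> A" "a * e \<in> ipow A (ext I) m" "e \<notin> ipow A (ext I) m"
    using power_embedded_at[OF noetherian_poly4 TL I notin G height_extension_eq_2[OF p(1) I tr(1) Q] not_ci m] .
  define J where "J = ipow UNIV I m"
  have J: "ideal_of UNIV J" unfolding J_def by (rule csubring.ipow_ideal[OF csubring_UNIV prime_ofD(1)[OF I(1)]])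
  have ext_pow: "ipow A (ext I) m = ext J" unfolding J_def by (rule ext_ipow[OF prime_ofD(1)[OF I(1)]])
  obtain a1 s where a1: "a = Fract a1 s" "s \<notin> p" using A_cases ae(1) by blast
  obtain D0 t where D0: "e = Fract D0 t" "t \<notin> p" using A_cases ae(2) by blast
  have a1I: "a1 \<notin> I" using ae(1) a1 Fract_mem_ext_prime[OF I a1(2)] by simp
  have "Fract (a1 * D0) (s * t) \<in> ext J" using ae(3) a1(1) D0(1) ext_pow by simp
  then obtain s' where s': "s' \<notin> p" "s' * (a1 * D0) \<in> J" using Fract_mem_ext[OF J compl_mult[OF a1(2) D0(2)]] by blast
  have u: "s' * a1 \<notin> I" using prime_ofD(3)[OF I(1)] s'(1) I(2) a1I by blast
  have D0J: "r * D0 \<notin> J" if "r \<notin> p" for r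
    using ae(4) that unfolding ext_pow D0(1) Fract_mem_ext[OF J D0(2)] by blast
  obtain D where D: "prime_of UNIV {r. r * D \<in> J}" "{r. r * D0 \<in> J} \<subseteq> {r. r * D \<in> J}" "{r. r * D \<in> J} \<subseteq> p"
    using colon_prime[OF noetherian_poly4 J p(1) D0J] .
  have "s' * a1 \<in> {r. r * D0 \<in> J}" using s'(2) by (simp add: mult.assoc)
  then have uD: "s' * a1 * D \<in> J" using D(2) by blast
  have "I \<subseteq> {r. r * D \<in> J}"
  proof
    fix f assume "f \<in> I"
    then have "f ^ m \<in> J" unfolding J_def by (rule csubring.ipow_power[OF csubring_UNIV prime_ofD(1)[OF I(1)]])
    then have "D * f ^ m \<in> J" by (rule ideal_ofD(4)[OF J UNIV_I])
    then have "f ^ m \<in> {r. r * D \<in> J}" by (simp add: mult.commute)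
    then show "f \<in> {r. r * D \<in> J}" by (rule csubring.prime_power[OF csubring_UNIV D(1) UNIV_I])
  qed
  \<comment> \<open>The colon ideal is a prime strictly above \<open>I\<close> and inside
    \<open>p\<close>; transcendence degrees 2 and 1 leave no room between them.\<close>
  then have less: "I \<subset> {r. r * D \<in> J}" using u uD by blast
  have "{r. r * D \<in> J} = p"
  proof (rule ccontr)
    assume "{r. r * D \<in> J} \<noteq> p"
    then have "trdeg p < trdeg {r. r * D \<in> J}" using trdeg_strict[OF D(1) p(1)] D(3) by blast
    moreover have "trdeg {r. r * D \<in> J} < trdeg I" by (rule trdeg_strict[OF I(1) D(1) less])
    ultimately show False using tr by simp
  qed
  then show ?thesis using that[OF u] uD D(1) Ip unfolding J_def by blast
qed

section \<open>Symbolic powers and saturation\<close>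

lemma ideal_colon_singleton: "ideal_colon ring_of_type_algebra J {D} = {r :: 'a::comm_ring_1. r * D \<in> J}"
  by (simp add: ideal_colon_def)

text \<open>A prime is the only prime associated to its quotient, so the intersection in the
  definition has a single member.\<close>

lemma symbolic_power_prime:
  fixes I :: "'a::idom set"
  assumes I: "prime_of UNIV I"
  shows "symbolic_power I n = {f. \<exists>s. s \<notin> I \<and> s * f \<in> ipow UNIV I n}"
proof -
  have "Ass_quot ring_of_type_algebra I = {I}"
  proof
    show "Ass_quot ring_of_type_algebra I \<subseteq> {I}"
    proof
      fix P assume "P \<in> Ass_quot ring_of_type_algebra I"
      then obtain f where P: "prime_of UNIV P" "P = {r. r * f \<in> I}"
        by (auto simp: Ass_quot_def primeideal_type_ring ideal_colon_singleton)
      have "1 \<notin> P" using prime_ofD(2)[OF P(1)] .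
      then have "f \<notin> I" unfolding P(2) by simp
      then have "P = I" unfolding P(2) using prime_ofD(3)[OF I] ideal_ofD(5)[OF prime_ofD(1)[OF I]] by blast
      then show "P \<in> {I}" by simp
    qed
    have "I = ideal_colon ring_of_type_algebra I {1}" by (simp add: ideal_colon_singleton)
    then show "{I} \<subseteq> Ass_quot ring_of_type_algebra I"
      using I unfolding Ass_quot_def primeideal_type_ring by auto
  qed
  then show ?thesis
    unfolding symbolic_power_def ideal_pow_type_ring
    using prime_localization.contract_extend[OF prime_localization.intro[OF I]
        csubring.ipow_ideal[OF csubring_UNIV prime_ofD(1)[OF I]]] by simp
qed

lemma mem_saturation:
  "f \<in> saturation J \<longleftrightarrow> (\<exists>j. \<forall>s\<in>ipow UNIV irrelevant_ideal j. f * s \<in> J)"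
  by (simp add: saturation_def ideal_colon_def ideal_pow_type_ring)

theorem theorem4p4:
  fixes V :: "'k::field poly4 set set" and p :: "'k poly4 set"
  assumes "irreducible_closed V"
    and "proj_codim V = 2"
    and "p \<in> V"
    and "\<not> complete_intersection (localization p) (extend_ideal p (defining_ideal V))"
  shows "(\<forall>m\<ge>2. embedded_component_at poly4_ring
            (saturation (ideal_pow poly4_ring (defining_ideal V) m)) p) \<and>
         (\<forall>m\<ge>2. ideal_pow poly4_ring (defining_ideal V) m \<noteq> symbolic_power (defining_ideal V) m)"
proof -
  define I where "I = defining_ideal V"
  have I: "prime_of UNIV I" using irreducible_prime[OF assms(1)] by (simp add: I_def defining_ideal_def)
  note idI = prime_ofD(1)[OF I]
  have Ip: "I \<subseteq> p" using assms(3) unfolding I_def defining_ideal_def by blast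
  have "proj_closed V" using assms(1) by (simp add: irreducible_closed_def)
  then have p3: "p \<in> proj3" using assms(3) unfolding proj_closed_def zero_locus_def by blast
  note p = proj3_prime[OF p3]
  obtain i0 where i0: "poly_var i0 \<notin> p" "indep {i0} p" using proj3_variable[OF p3] .
  obtain Q where Q: "prime_of UNIV Q" "Q \<noteq> {0}" "Q \<subset> I"
    using codim_two_chain[OF assms(2)] unfolding I_def defining_ideal_def .
  have "embedded_component_at poly4_ring (saturation (ipow UNIV I m)) p \<and> ipow UNIV I m \<noteq> symbolic_power I m"
    if m: "m \<ge> 2" for m
  proof
    obtain D u where D: "u \<notin> I" "u * D \<in> ipow UNIV I m" "prime_of UNIV {r. r * D \<in> ipow UNIV I m}"
        "{r. r * D \<in> ipow UNIV I m} = p" "I \<subset> p"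
      using power_embedded_poly4[OF p i0(2) I Ip Q assms(4)[folded I_def] m] .
    define J where "J = ipow UNIV I m"
    have J: "ideal_of UNIV J" unfolding J_def by (rule csubring.ipow_ideal[OF csubring_UNIV idI])
    have p_eq: "r \<in> p \<longleftrightarrow> r * D \<in> J" for r using D(4) unfolding J_def by blast
    \<comment> \<open>One element settles both claims: \<open>D\<close> is outside \<open>J\<close>
      because \<open>p\<close> is proper, it is in the symbolic power because \<open>u\<close> is
      outside \<open>I\<close>, and its annihilator modulo the saturation remains
      \<open>p\<close>.\<close>
    have "1 * D \<notin> J" using p_eq[of 1] prime_ofD(2)[OF p] by blast
    moreover have "D \<in> symbolic_power I m" unfolding symbolic_power_prime[OF I] using D(1,2) by blast
    ultimately show "ipow UNIV I m \<noteq> symbolic_power I m" unfolding J_def by auto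
    have JI: "J \<subseteq> I" unfolding J_def using csubring.ipow_le_prime[OF csubring_UNIV idI I] m by simp
    have irr: "ideal_of UNIV (irrelevant_ideal :: 'k poly4 set)" "poly_var i0 \<in> (irrelevant_ideal :: 'k poly4 set)"
      unfolding irrelevant_ideal_def genideal_type_ring by (auto simp: ideal_of_def)
    have pow: "poly_var i0 ^ j \<in> ipow UNIV (irrelevant_ideal :: 'k poly4 set) j" for j
      by (rule csubring.ipow_power[OF csubring_UNIV irr])
    have pow_p: "poly_var i0 ^ j \<notin> p" for j using csubring.prime_power[OF csubring_UNIV p UNIV_I] i0(1) by blast
    \<comment> \<open>Powers of the irrelevant ideal are tested only on powers of one variable. It
      lies outside \<open>p\<close> and \<open>I\<close>, so these factors can be removed in both
      primes.\<close>
    have sat: "\<exists>j. f * poly_var i0 ^ j \<in> J" if "f \<in> saturation J" for f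
      using that pow unfolding mem_saturation by blast
    have J_sat: "f \<in> saturation J" if "f \<in> J" for f
      unfolding mem_saturation using that ideal_ofD(5)[OF J] by auto
    have "p = ideal_colon poly4_ring (saturation J) {D}"
      unfolding ideal_colon_singleton
    proof (intro Set.set_eqI iffI CollectI)
      show "r * D \<in> saturation J" if "r \<in> p" for r using that p_eq J_sat by blast
      fix r assume "r \<in> {r. r * D \<in> saturation J}"
      then obtain j where "r * D * poly_var i0 ^ j \<in> J" using sat by blast
      then have "r * poly_var i0 ^ j \<in> p" unfolding p_eq by (simp add: ac_simps)
      then show "r \<in> p" using prime_ofD(3)[OF p] pow_p by blast
    qed
    then have "p \<in> Ass_quot poly4_ring (saturation J)"
      using p unfolding Ass_quot_def primeideal_type_ring by auto
    moreover have "saturation J \<subseteq> I"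
    proof
      fix f assume "f \<in> saturation J"
      then obtain j where "f * poly_var i0 ^ j \<in> I" using sat JI by blast
      then show "f \<in> I" using prime_ofD(3)[OF I] pow_p Ip by blast
    qed
    then have "p \<notin> minimal_primes poly4_ring (saturation J)"
      using I D(5) unfolding minimal_primes_def primeideal_type_ring by blast
    ultimately show "embedded_component_at poly4_ring (saturation (ipow UNIV I m)) p"
      unfolding embedded_component_at_def J_def by blast
  qed
  then show ?thesis unfolding I_def[symmetric] ideal_pow_type_ring by blast
qed

end
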